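(* Let $(U_1,Z_1,W_1),\dots,(U_n,Z_n,W_n)$ be independent copies of a random element $(U,Z,W)\in\mathcal{H}_1\times\mathbb{R}^q\times\mathcal{H}_2$, $q\ge1$, and let $\omega:\mathbb{R}^q\to(0,\infty)$ be measurable. Assume: (D)(a) $\mathbb{E}\|U\omega(Z)\|^4_{\mathcal{H}_1}<\infty$. (D)(b)(i) $Z$ admits a density $f_Z$ that is either bounded or satisfies $\int_{\mathbb{R}^q}|\mathcal{F}[f_Z](t)|^{2-a}dt<\infty$ for some $a\in(0,1]$; (ii) $\mathbb{E}[\|W\|^2_{\mathcal{H}_2}]<\infty$; (iii) $\{a_k\}_{k\ge1}$ is a sequence of positive reals with $\sum_{k\ge1}a_k<\infty$. (D)(c) There exist $\underline{\sigma}^2>0$, $C>0$ and $\nu>2$ such that (i) $\underline{\sigma}^2\le\mathbb{E}[\langle U_1\omega(Z_1),U_2\omega(Z_2)\rangle^2_{\mathcal{H}_1}\mid(Z_1,W_1),(Z_2,W_2)]$ almost surely; (ii) $\mathbb{E}[\|U\omega(Z)\|^\nu_{\mathcal{H}_1}\mid Z,W]\le C$ almost surely. (K)(a) $K(z_1,\dots,z_q)=\tilde K(z_1)\cdots\tilde K(z_q)$, where $\tilde K$ is a symmetric probability density of bounded variation on the real line whose Fourier transform $\mathcal{F}[\tilde K]$ is positive and integrable; (K)(b) $h=h_n\to0$ and $nh^q/\ln n\to\infty$. If $\mathbb{E}[U\mid Z,W]=0$ a.s., then the statistic $T_n=I_n(h)/v_n(h)$ converges in law to the standard normal distribution as $n\to\infty$.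 Consequently, for $\alpha\in(0,1)$, the test that rejects when $T_n\ge z_{1-\alpha}$, where $z_{1-\alpha}$ is the $(1-\alpha)$-quantile of the standard normal distribution, has asymptotic level $\alpha$.
   Context: $\mathcal{H}_1,\mathcal{H}_2$ are real separable Hilbert spaces. By convention (without loss of generality) $\mathbb{E}(W)=0$. $\mathcal{F}$ denotes the Fourier transform. $\{\phi_k\}_{k\ge1}$ is a fixed orthonormal basis of $\mathcal{H}_2$ and $\|w\|^2_{\mathcal{A}}=\sum_{k\ge1}a_k\langle w,\phi_k\rangle^2_{\mathcal{H}_2}$ for $w\in\mathcal{H}_2$. Put $K_{ij}(h)=K((Z_i-Z_j)/h)$, $\varphi_{ij}=\exp(-\|W_i-W_j\|^2_{\mathcal{A}}/2)$, and $$I_n(h)=\frac{1}{n(n-1)h^q}\sum_{1\le i\ne j\le n}\langle U_i\omega(Z_i),U_j\omega(Z_j)\rangle_{\mathcal{H}_1}K_{ij}(h)\varphi_{ij},$$ $$v_n^2(h)=\frac{2}{n^2(n-1)^2h^{2q}}\sum_{1\le i\ne j\le n}\langle U_i\omega(Z_i),U_j\omega(Z_j)\rangle^2_{\mathcal{H}_1}K^2_{ij}(h)\varphi^2_{ij},\qquad v_n(h)\ge0.$$ ($T_n$ may be given an arbitrary value when $v_n(h)=0$.) "Asymptotic level $\alpha$" means $\mathbb{P}(T_n\ge z_{1-\alpha})\to\alpha$ under $\mathbb{E}[U\mid Z,W]=0$ a.s. *)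

theory Defs
  imports "HOL-Probability.Probability"
begin

definition fourier :: "('e::euclidean_space \<Rightarrow> real) \<Rightarrow> 'e \<Rightarrow> complex" where
  "fourier f t = (LINT x|lborel. f x *\<^sub>R cis (- (t \<bullet> x)))"

text \<open>A finite nondecreasing tuple of points extends to a monotone sequence by repeating its last
  entry, so the sums below range over all finite partitions.\<close>

definition bounded_variation :: "(real \<Rightarrow> real) \<Rightarrow> bool" where
  "bounded_variation f \<longleftrightarrow>
     (\<exists>B. \<forall>(n::nat) (x::nat \<Rightarrow> real). mono x \<longrightarrow> (\<Sum>k<n. \<bar>f (x (Suc k)) - f (x k)\<bar>) \<le> B)"

definition orthonormal_basis :: "nat set \<Rightarrow> (nat \<Rightarrow> 'b::real_inner) \<Rightarrow> bool" where
  "orthonormal_basis J \<phi> \<longleftrightarrow>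
     (\<forall>i\<in>J. \<forall>j\<in>J. \<phi> i \<bullet> \<phi> j = (if i = j then 1 else 0)) \<and> closure (span (\<phi> ` J)) = UNIV"

text \<open>The \<open>\<sigma>\<close>-algebra generated by a random element.\<close>

definition sigma_gen :: "'s measure \<Rightarrow> ('s \<Rightarrow> 'x::topological_space) \<Rightarrow> 's measure" where
  "sigma_gen M X = vimage_algebra (space M) X borel"

text \<open>\<open>g\<close> is a version of the conditional expectation of the vector-valued \<open>f\<close> given \<open>F\<close>
  (the library's conditional expectation is real-valued).
  As usual, \<open>f\<close> need only be integrable on each set of a countable \<open>F\<close>-measurable cover;
  when \<open>f\<close> is integrable this is the standard definition, with the trivial cover.\<close>

definition has_cond_exp ::
  "'s measure \<Rightarrow> 's measure \<Rightarrow> ('s \<Rightarrow> 'x::{banach, second_countable_topology}) \<Rightarrow> ('s \<Rightarrow> 'x) \<Rightarrow> bool" where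
  "has_cond_exp M F f g \<longleftrightarrow>
     g \<in> borel_measurable F \<and>
     (\<exists>A::nat \<Rightarrow> 's set. range A \<subseteq> sets F \<and> (\<Union>m. A m) = space M \<and> (\<forall>m. set_integrable M (A m) f)) \<and>
     (\<forall>A\<in>sets F. set_integrable M A f \<longrightarrow>
        set_integrable M A g \<and> (LINT s:A|M. g s) = (LINT s:A|M. f s))"

definition quantile :: "real measure \<Rightarrow> real \<Rightarrow> real" where
  "quantile \<mu> p = Inf {x. p \<le> cdf \<mu> x}"

definition sqnorm_A :: "nat set \<Rightarrow> (nat \<Rightarrow> real) \<Rightarrow> (nat \<Rightarrow> 'b::real_inner) \<Rightarrow> 'b \<Rightarrow> real" where
  "sqnorm_A J a \<phi> w = (\<Sum>\<^sub>\<infinity>k\<in>J. a k * (w \<bullet> \<phi> k)\<^sup>2)"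

text \<open>In the following, \<open>u\<close>, \<open>z\<close>, \<open>w\<close> are the observations (indexed from 1) and \<open>N\<close> is the
  squared seminorm applied to the differences of the \<open>w i\<close>.\<close>

definition pair_weight ::
  "(real^'q \<Rightarrow> real) \<Rightarrow> ('b \<Rightarrow> real) \<Rightarrow> (real^'q \<Rightarrow> real) \<Rightarrow> real
     \<Rightarrow> (nat \<Rightarrow> 'a::real_inner) \<Rightarrow> (nat \<Rightarrow> real^'q) \<Rightarrow> (nat \<Rightarrow> 'b::real_inner) \<Rightarrow> nat \<Rightarrow> nat \<Rightarrow> real" where
  "pair_weight K N \<omega> h u z w i j =
     ((\<omega> (z i) *\<^sub>R u i) \<bullet> (\<omega> (z j) *\<^sub>R u j)) * K ((z i - z j) /\<^sub>R h) * exp (- N (w i - w j) / 2)"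

definition I_stat ::
  "(real^'q \<Rightarrow> real) \<Rightarrow> ('b \<Rightarrow> real) \<Rightarrow> (real^'q \<Rightarrow> real) \<Rightarrow> nat \<Rightarrow> real
     \<Rightarrow> (nat \<Rightarrow> 'a::real_inner) \<Rightarrow> (nat \<Rightarrow> real^'q) \<Rightarrow> (nat \<Rightarrow> 'b::real_inner) \<Rightarrow> real" where
  "I_stat K N \<omega> n h u z w =
     1 / (real n * (real n - 1) * h ^ CARD('q)) *
     (\<Sum>i\<in>{1..n}. \<Sum>j\<in>{1..n} - {i}. pair_weight K N \<omega> h u z w i j)"

definition v_stat ::
  "(real^'q \<Rightarrow> real) \<Rightarrow> ('b \<Rightarrow> real) \<Rightarrow> (real^'q \<Rightarrow> real) \<Rightarrow> nat \<Rightarrow> real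
     \<Rightarrow> (nat \<Rightarrow> 'a::real_inner) \<Rightarrow> (nat \<Rightarrow> real^'q) \<Rightarrow> (nat \<Rightarrow> 'b::real_inner) \<Rightarrow> real" where
  "v_stat K N \<omega> n h u z w =
     sqrt (2 / ((real n)\<^sup>2 * (real n - 1)\<^sup>2 * h ^ (2 * CARD('q))) *
       (\<Sum>i\<in>{1..n}. \<Sum>j\<in>{1..n} - {i}. (pair_weight K N \<omega> h u z w i j)\<^sup>2))"

end

theory Submission
  imports Defs
begin

text \<open>
  Up to a common factor \<open>I\<^sub>n\<close> is a U-statistic \<open>S = (\<Sum>i \<noteq> j. H X\<^sub>i X\<^sub>j)\<close> whose symmetric kernel is degenerate
  because \<open>E[U | Z, W] = 0\<close>, and \<open>T\<^sub>n = S / sqrt (2 * (\<Sum>i \<noteq> j. (H X\<^sub>i X\<^sub>j)\<^sup>2))\<close>. Its normal limit is obtained by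
  Stein's method on characteristic functions. Let \<open>V\<^sub>i = (\<Sum>j \<noteq> i. H X\<^sub>i X\<^sub>j)\<close> and \<open>W = (\<Sum>i. V\<^sub>i) / 2\<close>. Since
  \<open>W - V\<^sub>i\<close> does not depend on \<open>X\<^sub>i\<close>, degeneracy gives \<open>E (V\<^sub>i exp (\<i> t (W - V\<^sub>i))) = 0\<close>, so that
  \<open>E (W exp (\<i> t W)) = \<i> t E (exp (\<i> t W)) + o(1)\<close> as soon as \<open>(\<Sum>i. V\<^sub>i\<^sup>2) / 2 \<rightarrow> 1\<close> in \<open>L\<^sup>1\<close> and
  \<open>(\<Sum>i. E \<bar>V\<^sub>i\<bar>\<^sup>3) \<rightarrow> 0\<close>. Both reduce to three moments of \<open>H\<close>, namely \<open>E H\<^sup>4\<close>, \<open>E (E (H\<^sup>2 | X\<^sub>1)\<^sup>2)\<close> and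
  \<open>E G\<^sup>2\<close> with \<open>G x y = E (H x X H y X)\<close>.

  The moments are controlled by \<open>s = sup\<^sub>z E (K ((z - Z) / h))\<close>: what is needed is \<open>s\<^sup>2 = o(h\<^sup>q)\<close> and
  \<open>E (K ((Z\<^sub>1 - Z\<^sub>2) / h)) = O(h\<^sup>q)\<close>. For a bounded density this is immediate; otherwise \<open>K\<close> is written as an
  inverse Fourier transform and the integrability of \<open>\<bar>F f\<^sub>Z\<bar>\<^sup>2\<^sup>-\<^sup>a\<close> is used. Positivity of \<open>F K\<close> makes \<open>K\<close>
  bounded below near the origin, which yields \<open>E H\<^sup>2 \<ge> c h\<^sup>q\<close> by averaging over balls of radius
  proportional to \<open>h\<close>.
\<close>

section \<open>Stein's method for characteristic functions\<close>

text \<open>What shapes the estimates is that the hypotheses control the weighted residual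
  \<omega>(Z) U conditionally in little more than its second moment, while the fourth moment is
  merely finite. A localization can be exploited only at an argument whose residual enters squared.
  In E H^4 every residual enters to the fourth power, so this moment is only O(1); in E (E (H^2 |
  X_1)^2) the inner argument can be localized, which gives O(s^2); in E G^2 all arguments can, which
  gives O(s^2 h^q). The variance of the statistic is at least of order n^2 h^q, and relative to its
  square the three error terms become (n h^q)^-2, (s^2 / h^q) (n h^q)^-1 and s^2 / h^q. This is
  where the conditions s^2 = o(h^q) and n h^q \<longlonglongrightarrow> \<infinity> come from. In
  the Fourier case s = O(h^(q / (2 - a))), and 2 q / (2 - a) exceeds q exactly because a > 0. The
  kernel is a density, hence fixed only up to null sets. Its values near the origin are reached
  through a continuous representative, and the bounds hold almost everywhere, which suffices because
  Z has a density.\<close>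

lemma norm_integral_le_AE:
  fixes f :: "'x \<Rightarrow> 'y::{banach, second_countable_topology}" and g :: "'x \<Rightarrow> real"
  assumes "integrable M g" "f \<in> borel_measurable M" "AE x in M. norm (f x) \<le> g x"
  shows "norm (integral\<^sup>L M f) \<le> integral\<^sup>L M g"
proof -
  have "integrable M f"
    using assms by (intro Bochner_Integration.integrable_bound[OF assms(1)]) auto
  with assms show ?thesis
    by (intro order_trans[OF integral_norm_bound] integral_mono_AE) auto
qed

text \<open>The remainder bound |exp(ix) - 1 - ix| <= x^2 / 2 gives difference quotients the
  explicit error |y - s| E W^2 / 2, so a finite second moment yields differentiability without a
  limit theorem for integrals.\<close>

lemma (in prob_space) has_vector_derivative_char:
  fixes W :: "'a \<Rightarrow> real"
  assumes [measurable]: "W \<in> borel_measurable M" and W2: "integrable M (\<lambda>x. (W x)\<^sup>2)"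
  shows "((\<lambda>s. expectation (\<lambda>x. iexp (s * W x))) has_vector_derivative
    (\<i> * expectation (\<lambda>x. W x * iexp (s * W x)))) (at s)"
proof -
  have W1: "integrable M W"
    using W2 by (rule square_integrable_imp_integrable[rotated]) simp
  have iW: "integrable M (\<lambda>x. W x * iexp (t * W x))" for t
    by (rule Bochner_Integration.integrable_bound[OF integrable_norm[OF W1]]) (auto simp: norm_mult)
  have iE: "integrable M (\<lambda>x. iexp (t * W x))" for t
    by (rule integrable_const_bound[of _ 1]) auto
  define D where "D = \<i> * expectation (\<lambda>x. W x * iexp (s * W x))"
  have bound: "norm (expectation (\<lambda>x. iexp (y * W x)) - expectation (\<lambda>x. iexp (s * W x)) - (y - s) *\<^sub>R D)
      \<le> (y - s)\<^sup>2 * expectation (\<lambda>x. (W x)\<^sup>2) / 2" for y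
  proof -
    have eq: "expectation (\<lambda>x. iexp (y * W x)) - expectation (\<lambda>x. iexp (s * W x)) - (y - s) *\<^sub>R D
      = expectation (\<lambda>x. iexp (s * W x) * (iexp ((y - s) * W x) - 1 - \<i> * ((y - s) * W x)))"
    proof -
      have "expectation (\<lambda>x. iexp (s * W x) * (iexp ((y - s) * W x) - 1 - \<i> * ((y - s) * W x)))
        = expectation (\<lambda>x. iexp (y * W x) - iexp (s * W x) - (\<i> * (y - s)) * (W x * iexp (s * W x)))"
        by (intro Bochner_Integration.integral_cong) (auto simp: algebra_simps simp flip: exp_add)
      also have "\<dots> = expectation (\<lambda>x. iexp (y * W x)) - expectation (\<lambda>x. iexp (s * W x))
         - (\<i> * (y - s)) * expectation (\<lambda>x. W x * iexp (s * W x))"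
        using iE iW by (subst Bochner_Integration.integral_diff) (auto intro!: integrable_mult_right)
      finally show ?thesis by (simp add: D_def scaleR_conv_of_real algebra_simps)
    qed
    have pw: "norm (iexp (s * W x) * (iexp ((y - s) * W x) - 1 - \<i> * ((y - s) * W x))) \<le> (y - s)\<^sup>2 * (W x)\<^sup>2 / 2" for x
    proof -
      have "norm (iexp ((y - s) * W x) - 1 - \<i> * ((y - s) * W x)) \<le> (y - s)\<^sup>2 * (W x)\<^sup>2 / 2"
        using iexp_approx1[of "(y - s) * W x" 1]
        by (simp add: power2_eq_square abs_mult[symmetric] diff_diff_eq) (simp add: algebra_simps)
      then show ?thesis by (simp add: norm_mult)
    qed
    have "norm (expectation (\<lambda>x. iexp (s * W x) * (iexp ((y - s) * W x) - 1 - \<i> * ((y - s) * W x))))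
       \<le> expectation (\<lambda>x. (y - s)\<^sup>2 * (W x)\<^sup>2 / 2)"
      using W2 by (intro norm_integral_le_AE AE_I2 pw) auto
    then show ?thesis unfolding eq by simp
  qed
  show ?thesis
    unfolding has_vector_derivative_def D_def[symmetric]
  proof (rule has_derivativeI_sandwich[of 1])
    show "bounded_linear (\<lambda>x. x *\<^sub>R D)" by (rule bounded_linear_scaleR_left)
    show "((\<lambda>y. norm (y - s) * expectation (\<lambda>x. (W x)\<^sup>2) / 2) \<longlongrightarrow> 0) (at s within UNIV)"
      by (auto intro!: tendsto_eq_intros)
    fix y assume "y \<noteq> s"
    then show "norm (expectation (\<lambda>x. iexp (y * W x)) - expectation (\<lambda>x. iexp (s * W x)) - (y - s) *\<^sub>R D) / norm (y - s)
       \<le> norm (y - s) * expectation (\<lambda>x. (W x)\<^sup>2) / 2"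
      using bound[of y] by (simp add: divide_simps power2_eq_square algebra_simps abs_if split: if_splits)
  qed auto
qed

text \<open>The premise \<open>R\<close> is an approximate Stein equation tested on exp(isW).
  Multiplying the characteristic function by exp(s^2 / 2) turns the defect of that equation into a
  derivative (\<open>\<psi>'\<close>), so the mean value inequality bounds
  \<open>\<psi> t - 1\<close>; the factor exp(t^2 / 2) cancels on dividing back.\<close>

lemma (in prob_space) char_near_normal:
  fixes W :: "'a \<Rightarrow> real"
  assumes [measurable]: "W \<in> borel_measurable M" and W2: "integrable M (\<lambda>x. (W x)\<^sup>2)"
    and R: "\<And>s. norm (expectation (\<lambda>x. W x * iexp (s * W x)) - \<i> * s * expectation (\<lambda>x. iexp (s * W x)))
       \<le> \<bar>s\<bar> * \<alpha> + s\<^sup>2 * \<beta>"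
    and "0 \<le> \<alpha>" "0 \<le> \<beta>"
  shows "norm (expectation (\<lambda>x. iexp (t * W x)) - of_real (exp (- t\<^sup>2 / 2))) \<le> t\<^sup>2 * \<alpha> + \<bar>t\<bar> ^ 3 * \<beta>"
proof -
  define \<psi> where "\<psi> s = exp (s\<^sup>2 / 2) *\<^sub>R expectation (\<lambda>x. iexp (s * W x))" for s :: real
  define \<psi>' where "\<psi>' s = (exp (s\<^sup>2 / 2) * s) *\<^sub>R expectation (\<lambda>x. iexp (s * W x)) +
     exp (s\<^sup>2 / 2) *\<^sub>R (\<i> * expectation (\<lambda>x. W x * iexp (s * W x)))" for s
  have der: "(\<psi> has_vector_derivative \<psi>' s) (at s within S)" for s S
  proof -
    have "((\<lambda>s. exp (s\<^sup>2 / 2)) has_vector_derivative exp (s\<^sup>2 / 2) * s) (at s)"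
      unfolding has_real_derivative_iff_has_vector_derivative[symmetric]
      by (auto intro!: derivative_eq_intros)
    from has_vector_derivative_scaleR[OF this[unfolded has_real_derivative_iff_has_vector_derivative[symmetric]] has_vector_derivative_char[OF assms(1,2)]]
    show ?thesis unfolding \<psi>_def \<psi>'_def
      by (auto intro: has_vector_derivative_at_within simp: add.commute)
  qed
  have b: "norm (\<psi>' s) \<le> exp (t\<^sup>2 / 2) * (\<bar>t\<bar> * \<alpha> + t\<^sup>2 * \<beta>)" if "\<bar>s\<bar> \<le> \<bar>t\<bar>" for s
  proof -
    have "\<psi>' s = exp (s\<^sup>2 / 2) *\<^sub>R (\<i> * (expectation (\<lambda>x. W x * iexp (s * W x)) - \<i> * s * expectation (\<lambda>x. iexp (s * W x))))"
      by (simp add: \<psi>'_def algebra_simps scaleR_conv_of_real)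
    then have "norm (\<psi>' s) = exp (s\<^sup>2 / 2) * norm (expectation (\<lambda>x. W x * iexp (s * W x)) - \<i> * s * expectation (\<lambda>x. iexp (s * W x)))"
      by (simp add: norm_mult)
    also have "\<dots> \<le> exp (s\<^sup>2 / 2) * (\<bar>s\<bar> * \<alpha> + s\<^sup>2 * \<beta>)" using R by simp
    also have "\<dots> \<le> exp (t\<^sup>2 / 2) * (\<bar>t\<bar> * \<alpha> + t\<^sup>2 * \<beta>)"
      using that assms(4,5) abs_le_square_iff[of s t] by (intro mult_mono add_mono) auto
    finally show ?thesis .
  qed
  have "norm (\<psi> t - \<psi> 0) \<le> exp (t\<^sup>2 / 2) * (\<bar>t\<bar> * \<alpha> + t\<^sup>2 * \<beta>) * norm (t - 0)"
  \<comment> \<open>The symmetric interval treats both signs of \<open>t\<close> at once, and on it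
    exp(s^2 / 2) is at most exp(t^2 / 2).\<close>
  proof (rule differentiable_bound[where S = "{-\<bar>t\<bar>..\<bar>t\<bar>}" and f' = "\<lambda>s x. x *\<^sub>R \<psi>' s"])
    fix s assume "s \<in> {-\<bar>t\<bar>..\<bar>t\<bar>}"
    then show "onorm (\<lambda>x. x *\<^sub>R \<psi>' s) \<le> exp (t\<^sup>2 / 2) * (\<bar>t\<bar> * \<alpha> + t\<^sup>2 * \<beta>)"
      using b[of s] by (intro onorm_le) (auto simp: mult.commute mult_left_mono)
  qed (use der in \<open>auto simp: has_vector_derivative_def\<close>)
  also have "\<psi> 0 = 1" by (simp add: \<psi>_def prob_space)
  finally have *: "norm (\<psi> t - 1) \<le> exp (t\<^sup>2 / 2) * (t\<^sup>2 * \<alpha> + \<bar>t\<bar> ^ 3 * \<beta>)"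
    by (simp add: algebra_simps power2_eq_square power3_eq_cube abs_if split: if_splits)
  have "expectation (\<lambda>x. iexp (t * W x)) - of_real (exp (- t\<^sup>2 / 2)) = exp (- t\<^sup>2 / 2) *\<^sub>R (\<psi> t - 1)"
    by (simp add: \<psi>_def scaleR_conv_of_real algebra_simps exp_of_real[symmetric] flip: of_real_mult exp_add)
  then have "norm (expectation (\<lambda>x. iexp (t * W x)) - of_real (exp (- t\<^sup>2 / 2))) = exp (- t\<^sup>2 / 2) * norm (\<psi> t - 1)"
    by simp
  also have "\<dots> \<le> exp (- t\<^sup>2 / 2) * (exp (t\<^sup>2 / 2) * (t\<^sup>2 * \<alpha> + \<bar>t\<bar> ^ 3 * \<beta>))"
    using * by (intro mult_left_mono) auto
  also have "\<dots> = t\<^sup>2 * \<alpha> + \<bar>t\<bar> ^ 3 * \<beta>" by (simp add: mult.assoc[symmetric] flip: exp_add)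
  finally show ?thesis .
qed

text \<open>Taylor expansion of exp(-isV_i) gives V_i exp(isW) = V_i exp(is(W - V_i)) + is V_i^2
  exp(isW) + a cubic remainder (\<open>r\<close>). Since \<open>W\<close> is half of the sum of the
  V_i, half of the sum of the V_i^2 takes the place of the constant 1 in Stein's equation. The 4 in
  front of \<beta> is the 2 of the Taylor remainder times the 2 of that half.\<close>

lemma (in prob_space) leave_one_out_char:
  fixes V :: "'i \<Rightarrow> 'a \<Rightarrow> real"
  assumes "finite I"
    and V[measurable]: "\<And>i. i \<in> I \<Longrightarrow> V i \<in> borel_measurable M"
    and V4: "\<And>i. i \<in> I \<Longrightarrow> integrable M (\<lambda>x. V i x ^ 4)"
    and W_def: "\<And>x. W x = (\<Sum>i\<in>I. V i x) / 2"
    and ortho: "\<And>i s. i \<in> I \<Longrightarrow> expectation (\<lambda>x. V i x * iexp (s * (W x - V i x))) = 0"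
    and \<alpha>: "expectation (\<lambda>x. \<bar>(\<Sum>i\<in>I. (V i x)\<^sup>2) / 2 - 1\<bar>) \<le> \<alpha>"
    and \<beta>: "(\<Sum>i\<in>I. expectation (\<lambda>x. \<bar>V i x\<bar> ^ 3)) \<le> 4 * \<beta>"
  shows "norm (expectation (\<lambda>x. iexp (t * W x)) - of_real (exp (- t\<^sup>2 / 2))) \<le> t\<^sup>2 * \<alpha> + \<bar>t\<bar> ^ 3 * \<beta>"
proof -
  have [measurable]: "W \<in> borel_measurable M" unfolding W_def[abs_def] by auto
  have pw: "\<bar>y\<bar> ^ k \<le> 1 + y ^ 4" if "k \<le> 4" for y :: real and k :: nat
  proof (cases "\<bar>y\<bar> \<le> 1")
    case True then have "\<bar>y\<bar> ^ k \<le> 1" by (simp add: power_le_one)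
    then show ?thesis by (simp add: add_increasing2)
  next
    case False then have "\<bar>y\<bar> ^ k \<le> \<bar>y\<bar> ^ 4" using that by (intro power_increasing) auto
    then show ?thesis by (simp add: power_even_abs)
  qed
  have iV: "integrable M (\<lambda>x. \<bar>V i x\<bar> ^ k)" if "i \<in> I" "k \<le> 4" for i k
    using that pw[OF that(2)] by (intro Bochner_Integration.integrable_bound[OF Bochner_Integration.integrable_add[OF integrable_const[of 1] V4[OF that(1)]]] AE_I2)
       (auto intro!: order_trans[OF _ abs_ge_self])
  have iV2: "integrable M (\<lambda>x. (V i x)\<^sup>2)" if "i \<in> I" for i using iV[OF that, of 2] by simp
  have iV1: "integrable M (\<lambda>x. V i x)" if "i \<in> I" for i
    using iV[OF that, of 1] integrable_norm_iff[of "V i" M] that by simp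
  have W2: "integrable M (\<lambda>x. (W x)\<^sup>2)"
  proof (rule Bochner_Integration.integrable_bound)
    show "integrable M (\<lambda>x. real (card I) * (\<Sum>i\<in>I. (V i x)\<^sup>2))" using iV2 by auto
    show "AE x in M. norm ((W x)\<^sup>2) \<le> norm (real (card I) * (\<Sum>i\<in>I. (V i x)\<^sup>2))"
    proof (rule AE_I2)
      fix x
      have "(W x)\<^sup>2 \<le> (\<Sum>i\<in>I. V i x)\<^sup>2" unfolding W_def by (simp add: power_divide)
      also have "\<dots> \<le> real (card I) * (\<Sum>i\<in>I. (V i x)\<^sup>2)"
        using Cauchy_Schwarz_ineq_sum[of "\<lambda>_. 1" "\<lambda>i. V i x" I] by simp
      finally show "norm ((W x)\<^sup>2) \<le> norm (real (card I) * (\<Sum>i\<in>I. (V i x)\<^sup>2))" by simp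
    qed
  qed auto
  define A where "A x = (\<Sum>i\<in>I. (V i x)\<^sup>2) / 2 - 1" for x
  have [measurable]: "A \<in> borel_measurable M" unfolding A_def[abs_def] by auto
  have iA: "integrable M A" unfolding A_def[abs_def] using iV2 by auto
  show ?thesis
  proof (rule char_near_normal)
    fix s :: real
    have iVe: "integrable M (\<lambda>x. V i x * iexp (s * f x))" if "i \<in> I" "f \<in> borel_measurable M" for i f
      using that by (intro Bochner_Integration.integrable_bound[OF integrable_norm[OF iV1]]) (auto simp: norm_mult)
    define r where "r i x = V i x * iexp (s * W x) * (1 - \<i> * (s * V i x) - iexp (- s * V i x)) " for i x
    have rb: "norm (r i x) \<le> s\<^sup>2 / 2 * \<bar>V i x\<bar> ^ 3" for i x
    proof -
      have "norm (1 - \<i> * (s * V i x) - iexp (- s * V i x)) \<le> s\<^sup>2 / 2 * \<bar>V i x\<bar>\<^sup>2"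
        using iexp_approx1[of "- s * V i x" 1]
        by (subst norm_minus_commute) (simp add: power2_eq_square algebra_simps)
      then have "\<bar>V i x\<bar> * norm (1 - \<i> * (s * V i x) - iexp (- s * V i x)) \<le> \<bar>V i x\<bar> * (s\<^sup>2 / 2 * \<bar>V i x\<bar>\<^sup>2)"
        by (intro mult_left_mono) auto
      also have "\<dots> = s\<^sup>2 / 2 * \<bar>V i x\<bar> ^ 3" by (simp add: power2_eq_square power3_eq_cube)
      finally show ?thesis by (simp add: r_def norm_mult)
    qed
    have [measurable]: "r i \<in> borel_measurable M" if "i \<in> I" for i
      unfolding r_def[abs_def] using that by measurable
    have ir: "integrable M (r i)" if "i \<in> I" for i
      by (rule Bochner_Integration.integrable_bound[OF integrable_mult_right[OF iV[OF that, of 3], of "s\<^sup>2/2"]])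
         (use rb that in \<open>auto\<close>)
    have iAe: "integrable M (\<lambda>x. A x * iexp (s * W x))"
      by (rule Bochner_Integration.integrable_bound[OF integrable_norm[OF iA]]) (auto simp: norm_mult)
    have iE: "integrable M (\<lambda>x. iexp (s * W x))" by (rule integrable_const_bound[of _ 1]) auto
    have id: "W x * iexp (s * W x) = (\<Sum>i\<in>I. V i x * iexp (s * (W x - V i x))) / 2
       + \<i> * s * iexp (s * W x) + \<i> * s * (A x * iexp (s * W x)) + (\<Sum>i\<in>I. r i x) / 2" for x
    proof -
      have "r i x = V i x * iexp (s * W x) - \<i> * s * (V i x)\<^sup>2 * iexp (s * W x) - V i x * iexp (s * (W x - V i x))" for i
        by (simp add: r_def algebra_simps power2_eq_square flip: exp_add)
      then have "(\<Sum>i\<in>I. r i x) = (\<Sum>i\<in>I. V i x * iexp (s * W x)) - (\<Sum>i\<in>I. \<i> * s * (V i x)\<^sup>2 * iexp (s * W x)) - (\<Sum>i\<in>I. V i x * iexp (s * (W x - V i x)))"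
        by (simp add: sum_subtractf)
      moreover have "(\<Sum>i\<in>I. V i x * iexp (s * W x)) = 2 * W x * iexp (s * W x)"
        by (simp add: W_def sum_distrib_right)
      moreover have "(\<Sum>i\<in>I. \<i> * s * (V i x)\<^sup>2 * iexp (s * W x)) = \<i> * s * (2 * A x + 2) * iexp (s * W x)"
        by (simp add: A_def sum_distrib_right sum_distrib_left mult_ac)
      ultimately have "(\<Sum>i\<in>I. r i x) = 2 * complex_of_real (W x) * iexp (s * W x)
        - (\<i> * s) * (2 * complex_of_real (A x) + 2) * iexp (s * W x) - (\<Sum>i\<in>I. V i x * iexp (s * (W x - V i x)))"
        by (simp only: of_real_mult of_real_add of_real_numeral of_real_1)
      moreover have "w * e = y / 2 + c * e + c * (a * e) + z / 2"
        if "z = 2 * w * e - c * (2 * a + 2) * e - y" for z w e c a y :: complex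
        using that by (simp add: field_simps)
      ultimately show ?thesis by blast
    qed
    have "expectation (\<lambda>x. W x * iexp (s * W x)) = (\<Sum>i\<in>I. expectation (\<lambda>x. V i x * iexp (s * (W x - V i x)))) / 2
       + \<i> * s * expectation (\<lambda>x. iexp (s * W x)) + \<i> * s * expectation (\<lambda>x. A x * iexp (s * W x)) + (\<Sum>i\<in>I. expectation (r i)) / 2"
    proof -
      have lin: "expectation (\<lambda>x. (\<Sum>i\<in>I. f i x) / 2 + c * e x + c * a x + (\<Sum>i\<in>I. r i x) / 2)
        = (\<Sum>i\<in>I. expectation (f i)) / 2 + c * expectation e + c * expectation a + (\<Sum>i\<in>I. expectation (r i)) / 2"
        if "\<And>i. i \<in> I \<Longrightarrow> integrable M (f i)" "integrable M e" "integrable M a" for f e a and c :: complex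
        using that ir by simp
      show ?thesis unfolding id
        by (rule lin[OF iVe iE iAe]) auto
    qed
    then have "norm (expectation (\<lambda>x. W x * iexp (s * W x)) - \<i> * s * expectation (\<lambda>x. iexp (s * W x)))
      = norm (\<i> * s * expectation (\<lambda>x. A x * iexp (s * W x)) + (\<Sum>i\<in>I. expectation (r i)) / 2)"
      using ortho by simp
    also have "\<dots> \<le> \<bar>s\<bar> * norm (expectation (\<lambda>x. A x * iexp (s * W x))) + norm (\<Sum>i\<in>I. expectation (r i)) / 2"
      by (rule order_trans[OF norm_triangle_ineq]) (simp add: norm_mult norm_divide)
    also have "\<dots> \<le> \<bar>s\<bar> * \<alpha> + (\<Sum>i\<in>I. s\<^sup>2 / 2 * expectation (\<lambda>x. \<bar>V i x\<bar> ^ 3)) / 2"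
    proof (intro add_mono mult_left_mono divide_right_mono)
      have "norm (expectation (\<lambda>x. A x * iexp (s * W x))) \<le> expectation (\<lambda>x. \<bar>A x\<bar>)"
        using iA iAe by (intro norm_integral_le_AE) (auto simp: norm_mult)
      also have "\<dots> \<le> \<alpha>" using \<alpha> by (simp add: A_def)
      finally show "norm (expectation (\<lambda>x. A x * iexp (s * W x))) \<le> \<alpha>" .
      show "norm (\<Sum>i\<in>I. expectation (r i)) \<le> (\<Sum>i\<in>I. s\<^sup>2 / 2 * expectation (\<lambda>x. \<bar>V i x\<bar> ^ 3))"
      proof (intro sum_norm_le)
        fix i assume i: "i \<in> I"
        have "norm (expectation (r i)) \<le> expectation (\<lambda>x. s\<^sup>2 / 2 * \<bar>V i x\<bar> ^ 3)"
          using ir[OF i] iV[OF i, of 3] rb by (intro norm_integral_le_AE) auto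
        then show "norm (expectation (r i)) \<le> s\<^sup>2 / 2 * expectation (\<lambda>x. \<bar>V i x\<bar> ^ 3)" by simp
      qed
    qed auto
    also have "\<dots> \<le> \<bar>s\<bar> * \<alpha> + s\<^sup>2 * \<beta>"
      using mult_left_mono[OF \<beta>, of "s\<^sup>2 / 4"] by (simp only: sum_distrib_left[symmetric]) simp
    finally show "norm (expectation (\<lambda>x. W x * iexp (s * W x)) - \<i> * s * expectation (\<lambda>x. iexp (s * W x)))
       \<le> \<bar>s\<bar> * \<alpha> + s\<^sup>2 * \<beta>" .
  next
    show "0 \<le> \<alpha>" by (rule order_trans[OF _ \<alpha>]) simp
    show "0 \<le> \<beta>" using \<beta> by (smt (verit) sum_nonneg integral_nonneg_AE AE_I2 zero_le_power abs_ge_zero Bochner_Integration.integral_nonneg)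
  qed (use W2 in auto)
qed

section \<open>Degenerate U-statistics\<close>

text \<open>Integrability in the second argument is demanded at every point of the space, not almost
  everywhere: partial integrals are then genuine at every point, and sample coordinates can be
  substituted into them without exceptional sets.\<close>

locale degenerate_kernel = prob_space \<mu> for \<mu> :: "'x measure" +
  fixes H :: "'x \<Rightarrow> 'x \<Rightarrow> real" and I :: "'i set"
  assumes I: "finite I"
    and H_meas[measurable]: "(\<lambda>(x, y). H x y) \<in> borel_measurable (\<mu> \<Otimes>\<^sub>M \<mu>)"
    and H_sym: "H x y = H y x"
    and H_int: "x \<in> space \<mu> \<Longrightarrow> integrable \<mu> (H x)"
    and H_deg: "x \<in> space \<mu> \<Longrightarrow> (\<integral>y. H x y \<partial>\<mu>) = 0"
    and H4x: "x \<in> space \<mu> \<Longrightarrow> integrable \<mu> (\<lambda>y. H x y ^ 4)"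
    and H4: "integrable (\<mu> \<Otimes>\<^sub>M \<mu>) (\<lambda>(x, y). H x y ^ 4)"
begin

section \<open>Resampling one coordinate of the product measure\<close>

definition P :: "('i \<Rightarrow> 'x) measure" where "P = PiM I (\<lambda>_. \<mu>)"

lemma prob_P: "prob_space P"
  unfolding P_def by (intro prob_space_PiM prob_space_axioms)

sublocale P: prob_space P by (rule prob_P)
sublocale PX: pair_sigma_finite P \<mu> ..
sublocale XX: pair_sigma_finite \<mu> \<mu> ..
sublocale prod: product_sigma_finite "\<lambda>_::'i. \<mu>" ..

lemma space_P: "x \<in> space P \<Longrightarrow> i \<in> I \<Longrightarrow> x i \<in> space \<mu>"
  by (auto simp: P_def space_PiM PiE_def)

lemma component_P: "i \<in> I \<Longrightarrow> (\<lambda>x. x i) \<in> measurable P \<mu>"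
  unfolding P_def by (rule measurable_component_singleton)

lemma upd_measurable[measurable]:
  assumes "i \<in> I" shows "(\<lambda>(x, y). x(i := y)) \<in> measurable (P \<Otimes>\<^sub>M \<mu>) P"
proof -
  have I_eq: "I = insert i (I - {i})" using assms by auto
  have "(\<lambda>z. fst z) \<in> measurable (P \<Otimes>\<^sub>M \<mu>) (PiM (insert i (I - {i})) (\<lambda>_. \<mu>))"
    using I_eq by (auto simp: P_def)
  then show ?thesis
    using assms unfolding split_beta' P_def
    by (intro measurable_PiM_single') (auto simp: space_pair_measure space_PiM PiE_def extensional_def)
qed

text \<open>Overwriting one coordinate by a fresh draw preserves the product law, as can be checked
  on rectangles. This takes the place of splitting the product into one coordinate and the rest:
  integrating out coordinate \<open>i\<close> keeps \<open>P\<close> as the outer measure, so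
  coordinates can be integrated out one after another.\<close>

lemma distr_upd:
  assumes i: "i \<in> I"
  shows "distr (P \<Otimes>\<^sub>M \<mu>) P (\<lambda>(x, y). x(i := y)) = P"
proof -
  have "PiM I (\<lambda>_. \<mu>) = distr (P \<Otimes>\<^sub>M \<mu>) P (\<lambda>(x, y). x(i := y))"
  proof (rule sym, rule prod.PiM_eqI[OF I])
    show "sets (distr (P \<Otimes>\<^sub>M \<mu>) P (\<lambda>(x, y). x(i := y))) = sets (PiM I (\<lambda>_. \<mu>))"
      by (simp add: P_def)
    fix A assume A: "\<And>i. i \<in> I \<Longrightarrow> A i \<in> sets \<mu>"
    \<comment> \<open>The old value of coordinate \<open>i\<close> is discarded, so it is left
      unconstrained.\<close>
    let ?B = "\<lambda>j. if j = i then space \<mu> else A j"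
    have B: "Pi\<^sub>E I ?B \<in> sets P" unfolding P_def using A by (intro sets_PiM_I_finite[OF I]) auto
    have "Pi\<^sub>E I A \<in> sets P" unfolding P_def using A by (intro sets_PiM_I_finite[OF I])
    then have "emeasure (distr (P \<Otimes>\<^sub>M \<mu>) P (\<lambda>(x, y). x(i := y))) (Pi\<^sub>E I A)
      = emeasure (P \<Otimes>\<^sub>M \<mu>) ((\<lambda>(x, y). x(i := y)) -` Pi\<^sub>E I A \<inter> space (P \<Otimes>\<^sub>M \<mu>))"
      using i by (intro emeasure_distr) auto
    also have "(\<lambda>(x, y). x(i := y)) -` Pi\<^sub>E I A \<inter> space (P \<Otimes>\<^sub>M \<mu>) = Pi\<^sub>E I ?B \<times> A i"
      using i sets.sets_into_space[OF A] 
      by (fastforce simp: space_pair_measure P_def space_PiM PiE_def extensional_def Pi_def split: if_splits)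
    also have "emeasure (P \<Otimes>\<^sub>M \<mu>) (Pi\<^sub>E I ?B \<times> A i) = emeasure P (Pi\<^sub>E I ?B) * emeasure \<mu> (A i)"
      using B A i by (intro emeasure_pair_measure_Times) auto
    also have "emeasure P (Pi\<^sub>E I ?B) = (\<Prod>j\<in>I. emeasure \<mu> (?B j))"
      unfolding P_def using A by (intro prod.emeasure_PiM[OF I]) auto
    also have "\<dots> * emeasure \<mu> (A i) = (\<Prod>j\<in>I. emeasure \<mu> (A j))"
      using i I by (simp add: prod.remove[of I i] emeasure_space_1 mult.commute)
    finally show "emeasure (distr (P \<Otimes>\<^sub>M \<mu>) P (\<lambda>(x, y). x(i := y))) (Pi\<^sub>E I A) = (\<Prod>j\<in>I. emeasure \<mu> (A j))" .
  qed
  then show ?thesis by (simp add: P_def)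
qed

lemma nn_resample:
  assumes "i \<in> I" and [measurable]: "f \<in> borel_measurable P"
  shows "(\<integral>\<^sup>+x. f x \<partial>P) = (\<integral>\<^sup>+x. (\<integral>\<^sup>+y. f (x(i := y)) \<partial>\<mu>) \<partial>P)"
proof -
  note [measurable] = upd_measurable[OF assms(1)]
  have "(\<integral>\<^sup>+x. f x \<partial>P) = (\<integral>\<^sup>+x. f x \<partial>distr (P \<Otimes>\<^sub>M \<mu>) P (\<lambda>(x, y). x(i := y)))"
    by (simp add: distr_upd[OF assms(1)])
  also have "\<dots> = (\<integral>\<^sup>+z. (case z of (x, y) \<Rightarrow> f (x(i := y))) \<partial>(P \<Otimes>\<^sub>M \<mu>))"
    by (subst nn_integral_distr) (auto simp: split_beta')
  also have "\<dots> = (\<integral>\<^sup>+x. (\<integral>\<^sup>+y. f (x(i := y)) \<partial>\<mu>) \<partial>P)"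
    using measurable_compose[OF upd_measurable[OF assms(1)] assms(2)]
    by (subst nn_integral_fst[symmetric]) (auto simp: split_beta')
  finally show ?thesis .
qed

lemma resample:
  fixes f :: "_ \<Rightarrow> 'c::{banach, second_countable_topology}"
  assumes "i \<in> I" and f: "integrable P f"
  shows "(\<integral>x. f x \<partial>P) = (\<integral>x. (\<integral>y. f (x(i := y)) \<partial>\<mu>) \<partial>P)"
proof -
  note [measurable] = upd_measurable[OF assms(1)]
  have f': "integrable (distr (P \<Otimes>\<^sub>M \<mu>) P (\<lambda>(x, y). x(i := y))) f"
    by (simp add: distr_upd[OF assms(1)] f)
  have "(\<integral>x. f x \<partial>P) = (\<integral>x. f x \<partial>distr (P \<Otimes>\<^sub>M \<mu>) P (\<lambda>(x, y). x(i := y)))"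
    by (simp add: distr_upd[OF assms(1)])
  also have "\<dots> = (\<integral>z. (case z of (x, y) \<Rightarrow> f (x(i := y))) \<partial>(P \<Otimes>\<^sub>M \<mu>))"
    using f by (subst integral_distr) (auto simp: split_beta')
  also have "\<dots> = (\<integral>x. (\<integral>y. f (x(i := y)) \<partial>\<mu>) \<partial>P)"
    using integrable_distr[OF upd_measurable[OF assms(1)] f']
    by (subst PX.integral_fst'[symmetric]) (auto simp: split_beta')
  finally show ?thesis .
qed

end

lemma (in prob_space) sq_expectation_le:
  fixes f :: "'a \<Rightarrow> real"
  assumes [measurable]: "f \<in> borel_measurable M" and f2: "integrable M (\<lambda>x. (f x)\<^sup>2)"
  shows "(expectation f)\<^sup>2 \<le> expectation (\<lambda>x. (f x)\<^sup>2)"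
proof -
  have "integrable M f" using f2 by (rule square_integrable_imp_integrable[rotated]) simp
  then have "variance f = expectation (\<lambda>x. (f x)\<^sup>2) - (expectation f)\<^sup>2"
    using f2 by (rule variance_eq)
  then show ?thesis using variance_positive[of f] by simp
qed

lemma abs_mult_le_squares:
  fixes u v :: real
  shows "\<bar>u * v\<bar> \<le> (u\<^sup>2 + v\<^sup>2) / 2" and "\<bar>u * v\<bar> \<le> u\<^sup>2 + v\<^sup>2"
proof -
  show 1: "\<bar>u * v\<bar> \<le> (u\<^sup>2 + v\<^sup>2) / 2"
    using sum_squares_bound[of "\<bar>u\<bar>" "\<bar>v\<bar>"] by (simp add: abs_mult)
  have "0 \<le> u\<^sup>2 + v\<^sup>2" by simp
  with 1 show "\<bar>u * v\<bar> \<le> u\<^sup>2 + v\<^sup>2" by argo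
qed

lemma abs_mult4_le:
  fixes a b c d :: real
  shows "\<bar>a * b * c * d\<bar> \<le> a ^ 4 + b ^ 4 + c ^ 4 + d ^ 4"
proof -
  note 1 = abs_mult_le_squares(1)
  have sq: "(u * v)\<^sup>2 \<le> (u ^ 4 + v ^ 4) / 2" for u v :: real
    using 1[of "u\<^sup>2" "v\<^sup>2"] by (simp add: power_mult_distrib abs_mult flip: power_mult)
  have "\<bar>a * b * c * d\<bar> \<le> ((a * b)\<^sup>2 + (c * d)\<^sup>2) / 2" using 1[of "a * b" "c * d"] by (simp add: mult.assoc)
  also have "\<dots> \<le> a ^ 4 + b ^ 4 + c ^ 4 + d ^ 4"
  proof -
    have "(x + y) / 2 \<le> p + q + r + s" if "x \<le> (p + q) / 2" "y \<le> (r + s) / 2" "0 \<le> p" "0 \<le> q" "0 \<le> r" "0 \<le> s"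
      for x y p q r s :: real using that by argo
    from this[OF sq sq] show ?thesis by simp
  qed
  finally show ?thesis .
qed

section \<open>Expectations of products of pair values\<close>

context degenerate_kernel
begin

text \<open>In this locale \<open>h\<close> is the kernel evaluated at two sample coordinates;
  elsewhere the letter denotes the bandwidth.\<close>

definition h :: "'i \<Rightarrow> 'i \<Rightarrow> ('i \<Rightarrow> 'x) \<Rightarrow> real" where "h i j x = H (x i) (x j)"
definition a :: "'x \<Rightarrow> real" where "a x = (\<integral>y. (H x y)\<^sup>2 \<partial>\<mu>)"
definition G :: "'x \<Rightarrow> 'x \<Rightarrow> real" where "G x y = (\<integral>v. H x v * H y v \<partial>\<mu>)"
definition \<tau> :: real where "\<tau> = (\<integral>x. a x \<partial>\<mu>)"
definition b :: real where "b = (\<integral>x. (a x)\<^sup>2 \<partial>\<mu>)"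
definition m4 :: real where "m4 = (\<integral>x. (\<integral>y. H x y ^ 4 \<partial>\<mu>) \<partial>\<mu>)"
definition g4 :: real where "g4 = (\<integral>x. (\<integral>y. (G x y)\<^sup>2 \<partial>\<mu>) \<partial>\<mu>)"

lemma h_sym: "h i j x = h j i x" unfolding h_def by (rule H_sym)

lemma H_comp_meas[measurable]:
  "f \<in> measurable N \<mu> \<Longrightarrow> g \<in> measurable N \<mu> \<Longrightarrow> (\<lambda>x. H (f x) (g x)) \<in> borel_measurable N"
  using measurable_compose[OF measurable_Pair H_meas] by simp

lemma h_meas[measurable]: "i \<in> I \<Longrightarrow> j \<in> I \<Longrightarrow> h i j \<in> borel_measurable P"
  unfolding h_def[abs_def] by (intro H_comp_meas component_P)

lemma a_meas[measurable]: "a \<in> borel_measurable \<mu>"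
  unfolding a_def[abs_def] by measurable

lemma G_meas[measurable]:
  assumes [measurable]: "f \<in> measurable N \<mu>" "g \<in> measurable N \<mu>"
  shows "(\<lambda>x. G (f x) (g x)) \<in> borel_measurable N"
  unfolding G_def[abs_def] by measurable

lemma component:
  fixes f :: "_ \<Rightarrow> 'c::{banach, second_countable_topology}"
  assumes "i \<in> I" and [measurable]: "f \<in> borel_measurable \<mu>"
  shows "(\<integral>x. f (x i) \<partial>P) = (\<integral>y. f y \<partial>\<mu>)"
    and "integrable P (\<lambda>x. f (x i)) \<longleftrightarrow> integrable \<mu> f"
proof -
  have d: "distr P \<mu> (\<lambda>x. x i) = \<mu>"
    unfolding P_def by (rule distr_PiM_component) (use I assms(1) prob_space_axioms in auto)
  note [measurable] = component_P[OF assms(1)]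
  show "(\<integral>x. f (x i) \<partial>P) = (\<integral>y. f y \<partial>\<mu>)"
    by (subst (2) d[symmetric], subst integral_distr) auto
  show "integrable P (\<lambda>x. f (x i)) \<longleftrightarrow> integrable \<mu> f"
    by (subst (2) d[symmetric], subst integrable_distr_eq) auto
qed

lemma H2x: "x \<in> space \<mu> \<Longrightarrow> integrable \<mu> (\<lambda>y. (H x y)\<^sup>2)"
  using square_integrable_imp_integrable[of "\<lambda>y. (H x y)\<^sup>2"] H4x[of x] by (simp flip: power_mult)

lemma H4_int: "integrable \<mu> (\<lambda>x. \<integral>y. H x y ^ 4 \<partial>\<mu>)"
  using XX.integrable_fst'[OF H4] by simp

lemma a2_le: "x \<in> space \<mu> \<Longrightarrow> (a x)\<^sup>2 \<le> (\<integral>y. H x y ^ 4 \<partial>\<mu>)"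
  unfolding a_def using sq_expectation_le[of "\<lambda>y. (H x y)\<^sup>2"] H4x[of x] by (simp flip: power_mult)

lemma a_nonneg: "0 \<le> a x" unfolding a_def by simp

lemma a2_int: "integrable \<mu> (\<lambda>x. (a x)\<^sup>2)"
  by (rule Bochner_Integration.integrable_bound[OF H4_int]) (use a2_le in \<open>auto intro: AE_I2 order_trans[OF _ abs_ge_self]\<close>)

lemma a_int: "integrable \<mu> a"
  using a2_int by (rule square_integrable_imp_integrable[rotated]) simp

lemma G_le: "x \<in> space \<mu> \<Longrightarrow> y \<in> space \<mu> \<Longrightarrow> \<bar>G x y\<bar> \<le> (a x + a y) / 2"
proof -
  assume xy: "x \<in> space \<mu>" "y \<in> space \<mu>"
  have "norm (G x y) \<le> (\<integral>v. ((H x v)\<^sup>2 + (H y v)\<^sup>2) / 2 \<partial>\<mu>)"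
    unfolding G_def
  proof (rule norm_integral_le_AE)
    show "integrable \<mu> (\<lambda>v. ((H x v)\<^sup>2 + (H y v)\<^sup>2) / 2)" using H2x xy by auto
    have "norm (H x v * H y v) \<le> ((H x v)\<^sup>2 + (H y v)\<^sup>2) / 2" for v
      using sum_squares_bound[of "\<bar>H x v\<bar>" "\<bar>H y v\<bar>"] by (simp add: abs_mult)
    then show "AE v in \<mu>. norm (H x v * H y v) \<le> ((H x v)\<^sup>2 + (H y v)\<^sup>2) / 2" by simp
  qed (use xy in auto)
  then show ?thesis using H2x xy by (simp add: a_def)
qed

lemma G2_le:
  assumes "x \<in> space \<mu>" "y \<in> space \<mu>" shows "(G x y)\<^sup>2 \<le> (a x)\<^sup>2 + (a y)\<^sup>2"
proof -
  have "(G x y)\<^sup>2 \<le> ((a x + a y) / 2)\<^sup>2" using power_mono[OF G_le[OF assms], of 2] by simp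
  also have "\<dots> \<le> (a x)\<^sup>2 + (a y)\<^sup>2"
  proof -
    have "((u + v) / 2)\<^sup>2 \<le> u\<^sup>2 + v\<^sup>2" for u v :: real
    proof -
      have "(u + v)\<^sup>2 = u\<^sup>2 + v\<^sup>2 + 2 * (u * v)" by (simp add: power2_sum)
      also have "\<dots> \<le> 3 * (u\<^sup>2 + v\<^sup>2)" using abs_mult_le_squares(2)[of u v] by simp
      also have "\<dots> \<le> 4 * (u\<^sup>2 + v\<^sup>2)" by (intro mult_right_mono) auto
      finally show ?thesis by (simp add: power_divide)
    qed
    then show ?thesis .
  qed
  finally show ?thesis .
qed

text \<open>Integrability comes from resampling the nonnegative integral; only then can the Bochner
  form of resampling be applied to obtain the value.\<close>

lemma h4:
  assumes "i \<in> I" "j \<in> I" "i \<noteq> j"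
  shows "integrable P (\<lambda>x. h i j x ^ 4)" and "(\<integral>x. h i j x ^ 4 \<partial>P) = m4"
proof -
  note [measurable] = h_meas[OF assms(1,2)]  component_P[OF assms(1)] component_P[OF assms(2)]
  have "(\<integral>\<^sup>+x. ennreal (h i j x ^ 4) \<partial>P) = (\<integral>\<^sup>+x. (\<integral>\<^sup>+y. ennreal (H (x i) y ^ 4) \<partial>\<mu>) \<partial>P)"
    using assms(3) by (subst nn_resample[OF assms(2)]) (auto simp: h_def)
  also have "\<dots> = (\<integral>\<^sup>+x. ennreal (\<integral>y. H (x i) y ^ 4 \<partial>\<mu>) \<partial>P)"
    by (intro nn_integral_cong nn_integral_eq_integral H4x) (auto simp: space_P assms)
  also have "\<dots> < \<infinity>"
  proof -
    have "integrable P (\<lambda>x. \<integral>y. H (x i) y ^ 4 \<partial>\<mu>)"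
      using component(2)[OF assms(1), of "\<lambda>x. \<integral>y. H x y ^ 4 \<partial>\<mu>"] H4_int by auto
    then show ?thesis by (simp add: integrable_iff_bounded)
  qed
  finally show i: "integrable P (\<lambda>x. h i j x ^ 4)"
    by (intro integrableI_nonneg) auto
  show "(\<integral>x. h i j x ^ 4 \<partial>P) = m4"
    unfolding m4_def using assms(3) component(1)[OF assms(1), of "\<lambda>x. \<integral>y. H x y ^ 4 \<partial>\<mu>"]
    by (subst resample[OF assms(2) i]) (auto simp: h_def)
qed

text \<open>The expansions below consist of products of four pair values; finite fourth moments
  dominate them all through |abcd| <= a^4 + b^4 + c^4 + d^4.\<close>

lemma integrable_mult4:
  assumes "f1 \<in> borel_measurable P" "f2 \<in> borel_measurable P" "f3 \<in> borel_measurable P" "f4 \<in> borel_measurable P"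
    "integrable P (\<lambda>x. f1 x ^ 4)" "integrable P (\<lambda>x. f2 x ^ 4)" "integrable P (\<lambda>x. f3 x ^ 4)" "integrable P (\<lambda>x. f4 x ^ 4)"
  shows "integrable P (\<lambda>x. f1 x * f2 x * f3 x * f4 x :: real)"
proof (rule Bochner_Integration.integrable_bound)
  show "integrable P (\<lambda>x. f1 x ^ 4 + f2 x ^ 4 + f3 x ^ 4 + f4 x ^ 4)" using assms by simp
  show "AE x in P. norm (f1 x * f2 x * f3 x * f4 x) \<le> norm (f1 x ^ 4 + f2 x ^ 4 + f3 x ^ 4 + f4 x ^ 4)"
    using abs_mult4_le by (intro AE_I2) (simp only: real_norm_def order_trans[OF _ abs_ge_self])
qed (use assms in measurable)

lemma int_h4:
  assumes "i \<in> I" "j \<in> I" "i \<noteq> j" "i' \<in> I" "j' \<in> I" "i' \<noteq> j'" "k \<in> I" "l \<in> I" "k \<noteq> l" "k' \<in> I" "l' \<in> I" "k' \<noteq> l'"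
  shows "integrable P (\<lambda>x. h i j x * h i' j' x * h k l x * h k' l' x)"
  using assms by (intro integrable_mult4 h4 h_meas) auto

lemma int_h2: "i \<in> I \<Longrightarrow> j \<in> I \<Longrightarrow> i \<noteq> j \<Longrightarrow> integrable P (\<lambda>x. (h i j x)\<^sup>2)"
  using P.square_integrable_imp_integrable[of "\<lambda>x. (h i j x)\<^sup>2"] h4(1)[of i j] by (simp flip: power_mult)

lemma E_h2:
  assumes "i \<in> I" "j \<in> I" "i \<noteq> j"
  shows "(\<integral>x. (h i j x)\<^sup>2 \<partial>P) = \<tau>"
  using assms(3) component(1)[OF assms(1), of a]
  by (subst resample[OF assms(2) int_h2[OF assms]]) (auto simp: h_def \<tau>_def simp flip: a_def)

lemma int_hh2:
  assumes "i \<in> I" "j \<in> I" "i \<noteq> j" "k \<in> I" "l \<in> I" "k \<noteq> l"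
  shows "integrable P (\<lambda>x. (h i j x)\<^sup>2 * (h k l x)\<^sup>2)"
  using int_h4[OF assms(1-3) assms(1-3) assms(4-6) assms(4-6)] by (simp add: power2_eq_square mult.assoc)

text \<open>Given coordinate \<open>i\<close>, the two squares are independent with the same
  conditional mean \<open>a\<close>; integrating out \<open>k\<close> and then \<open>j\<close>
  leaves the square of \<open>a\<close>.\<close>

lemma E_hh2:
  assumes "i \<in> I" "j \<in> I" "k \<in> I" "i \<noteq> j" "i \<noteq> k" "j \<noteq> k"
  shows "(\<integral>x. (h i j x)\<^sup>2 * (h i k x)\<^sup>2 \<partial>P) = b"
proof -
  note [measurable] = h_meas component_P assms(1-3)
  have "(\<integral>x. (h i j x)\<^sup>2 * (h i k x)\<^sup>2 \<partial>P) = (\<integral>x. (h i j x)\<^sup>2 * a (x i) \<partial>P)"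
    using assms int_hh2[of i j i k] by (subst resample[OF assms(3)]) (auto simp: h_def a_def)
  also have "\<dots> = (\<integral>x. (a (x i))\<^sup>2 \<partial>P)"
  proof -
    have "integrable P (\<lambda>x. (h i j x)\<^sup>2 * a (x i))"
    proof (rule Bochner_Integration.integrable_bound)
      show "integrable P (\<lambda>x. h i j x ^ 4 + (a (x i))\<^sup>2)"
        using h4[of i j] assms component(2)[OF assms(1), of "\<lambda>x. (a x)\<^sup>2"] a2_int by auto
      have "\<bar>u\<^sup>2 * v\<bar> \<le> u ^ 4 + v\<^sup>2" for u v :: real
        using abs_mult_le_squares(2)[of "u\<^sup>2" v] by (simp flip: power_mult)
      then show "AE x in P. norm ((h i j x)\<^sup>2 * a (x i)) \<le> norm (h i j x ^ 4 + (a (x i))\<^sup>2)"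
        by (auto intro!: AE_I2 order_trans[OF _ abs_ge_self])
    qed measurable
    then show ?thesis
      using assms by (subst resample[OF assms(2)]) (auto simp: h_def power2_eq_square simp flip: a_def[unfolded power2_eq_square])
  qed
  also have "\<dots> = b" unfolding b_def using component(1)[OF assms(1), of "\<lambda>x. (a x)\<^sup>2"] by simp
  finally show ?thesis .
qed

text \<open>Integrating out the index \<open>j\<close>, which \<open>g\<close> does not see, leaves
  the mean of \<open>H\<close> in one argument. By \<open>h_sym\<close> either end of a pair can
  play the role of \<open>j\<close>.\<close>

lemma E_deg:
  assumes "i \<in> I" "j \<in> I" "i \<noteq> j" and g: "\<And>x y. g (x(j := y)) = g x"
    and int: "integrable P (\<lambda>x. h i j x * g x)"
  shows "(\<integral>x. h i j x * g x \<partial>P) = 0"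
proof -
  have "(\<integral>x. h i j x * g x \<partial>P) = (\<integral>x. 0 \<partial>P)"
    using assms(3) H_deg space_P[OF _ assms(1)]
    by (subst resample[OF assms(2) int], intro Bochner_Integration.integral_cong) (auto simp: h_def g)
  then show ?thesis by simp
qed

text \<open>In the cycle i - j - l - k each of \<open>j\<close> and \<open>k\<close> is linked only
  to \<open>i\<close> and \<open>l\<close>, so integrating out both of them produces
  \<open>G\<close> at the coordinates \<open>i\<close>, \<open>l\<close> twice.\<close>

lemma E_cycle:
  assumes "i \<in> I" "j \<in> I" "k \<in> I" "l \<in> I" "distinct [i, j, k, l]"
  shows "(\<integral>x. h i j x * h i k x * h l j x * h l k x \<partial>P) = g4"
proof -
  note [measurable] = h_meas component_P assms(1-4)
  have "(\<integral>x. h i j x * h i k x * h l j x * h l k x \<partial>P) = (\<integral>x. (h i j x * h l j x) * (h i k x * h l k x) \<partial>P)"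
    by (simp add: mult_ac)
  also have "\<dots> = (\<integral>x. G (x i) (x l) * (h i k x * h l k x) \<partial>P)"
  proof (subst resample[OF assms(2)])
    show "integrable P (\<lambda>x. (h i j x * h l j x) * (h i k x * h l k x))"
      using int_h4[of i j l j i k l k] assms by (auto simp: mult.assoc)
    have "(\<integral>y. (h i j (x(j := y)) * h l j (x(j := y))) * (h i k (x(j := y)) * h l k (x(j := y))) \<partial>\<mu>)
      = (\<integral>y. (H (x i) y * H (x l) y) * (h i k x * h l k x) \<partial>\<mu>)" for x
      using assms(5) by (intro Bochner_Integration.integral_cong) (auto simp: h_def)
    then show "(\<integral>x. (\<integral>y. (h i j (x(j := y)) * h l j (x(j := y))) * (h i k (x(j := y)) * h l k (x(j := y))) \<partial>\<mu>) \<partial>P)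
      = (\<integral>x. G (x i) (x l) * (h i k x * h l k x) \<partial>P)"
      unfolding G_def by (simp only: integral_mult_left_zero)
  qed
  also have "\<dots> = (\<integral>x. (G (x i) (x l))\<^sup>2 \<partial>P)"
  proof -
    have "integrable P (\<lambda>x. G (x i) (x l) * (h i k x * h l k x))"
    proof (rule Bochner_Integration.integrable_bound)
      show "integrable P (\<lambda>x. (a (x i))\<^sup>2 + (a (x l))\<^sup>2 + h i k x ^ 4 + h l k x ^ 4)"
        using h4[of i k] h4[of l k] assms component(2)[of _ "\<lambda>x. (a x)\<^sup>2"] a2_int by auto
      show "AE x in P. norm (G (x i) (x l) * (h i k x * h l k x)) \<le> norm ((a (x i))\<^sup>2 + (a (x l))\<^sup>2 + h i k x ^ 4 + h l k x ^ 4)"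
      proof (rule AE_I2)
        fix x assume x: "x \<in> space P"
        have *: "\<bar>c * (u * v)\<bar> \<le> c\<^sup>2 + u ^ 4 + v ^ 4" for c u v :: real
        proof -
          have "\<bar>c * (u * v)\<bar> \<le> (c\<^sup>2 + (u * v)\<^sup>2) / 2" using sum_squares_bound[of "\<bar>c\<bar>" "\<bar>u * v\<bar>"] by (simp add: abs_mult power_mult_distrib)
          moreover have "(u * v)\<^sup>2 \<le> (u ^ 4 + v ^ 4) / 2" using sum_squares_bound[of "u\<^sup>2" "v\<^sup>2"] by (simp add: power_mult_distrib flip: power_mult)
          moreover have "p \<le> x + y + z" if "p \<le> (x + q) / 2" "q \<le> (y + z) / 2" "0 \<le> x" "0 \<le> y" "0 \<le> z" for p q x y z :: real
            using that by argo
          moreover have "0 \<le> c\<^sup>2" "0 \<le> u ^ 4" "0 \<le> v ^ 4" by auto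
          ultimately show ?thesis by metis
        qed
        show "norm (G (x i) (x l) * (h i k x * h l k x)) \<le> norm ((a (x i))\<^sup>2 + (a (x l))\<^sup>2 + h i k x ^ 4 + h l k x ^ 4)"
          using *[of "G (x i) (x l)" "h i k x" "h l k x"] G2_le[of "x i" "x l"] space_P[OF x] assms(1,4) 
          by (auto intro!: order_trans[OF _ abs_ge_self])
      qed
    qed measurable
    then show ?thesis
      using assms by (subst resample[OF assms(3)]) (auto simp: h_def power2_eq_square G_def)
  qed
  also have "\<dots> = (\<integral>x. (\<integral>y. (G (x i) y)\<^sup>2 \<partial>\<mu>) \<partial>P)"
  proof -
    have "integrable P (\<lambda>x. (G (x i) (x l))\<^sup>2)"
    proof (rule Bochner_Integration.integrable_bound)
      show "integrable P (\<lambda>x. (a (x i))\<^sup>2 + (a (x l))\<^sup>2)"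
        using assms component(2)[of _ "\<lambda>x. (a x)\<^sup>2"] a2_int by auto
      show "AE x in P. norm ((G (x i) (x l))\<^sup>2) \<le> norm ((a (x i))\<^sup>2 + (a (x l))\<^sup>2)"
        using G2_le space_P assms(1,4) by (auto intro!: AE_I2)
    qed measurable
    then show ?thesis using assms by (subst resample[OF assms(4)]) auto
  qed
  also have "\<dots> = g4" unfolding g4_def using component(1)[OF assms(1), of "\<lambda>x. \<integral>y. (G x y)\<^sup>2 \<partial>\<mu>"] by simp
  finally show ?thesis .
qed

text \<open>Independence of disjoint pairs, obtained by resampling: integrating out \<open>j\<close>
  replaces the first square by \<open>a\<close> at coordinate \<open>i\<close>, and integrating out
  \<open>i\<close> then makes the centered factor vanish.\<close>

lemma E_disjoint:
  assumes "i \<in> I" "j \<in> I" "k \<in> I" "l \<in> I" "i \<noteq> j" "k \<noteq> l" "i \<notin> {k, l}" "j \<notin> {k, l}"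
  shows "(\<integral>x. ((h i j x)\<^sup>2 - \<tau>) * ((h k l x)\<^sup>2 - \<tau>) \<partial>P) = 0"
proof -
  note [measurable] = h_meas component_P assms(1-4)
  have i4: "integrable P (\<lambda>x. ((h i j x)\<^sup>2 - \<tau>)\<^sup>2)" if "i \<in> I" "j \<in> I" "i \<noteq> j" for i j
    using h4(1)[OF that] int_h2[OF that] by (simp add: power2_diff flip: power_mult)
  have ia: "integrable P (\<lambda>x. (a (x i) - \<tau>)\<^sup>2)"
    using component(2)[OF assms(1), of "\<lambda>x. (a x - \<tau>)\<^sup>2"] a2_int a_int by (simp add: power2_diff)
  have im: "integrable P (\<lambda>x. f x * g x)" if [measurable]: "f \<in> borel_measurable P" "g \<in> borel_measurable P"
     and "integrable P (\<lambda>x. (f x)\<^sup>2)" "integrable P (\<lambda>x. (g x)\<^sup>2)" for f g :: "_ \<Rightarrow> real"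
  proof (rule Bochner_Integration.integrable_bound)
    show "integrable P (\<lambda>x. (f x)\<^sup>2 + (g x)\<^sup>2)" using that by simp
    show "AE x in P. norm (f x * g x) \<le> norm ((f x)\<^sup>2 + (g x)\<^sup>2)"
      using abs_mult_le_squares(2) by simp
  qed measurable
  have "(\<integral>x. ((h i j x)\<^sup>2 - \<tau>) * ((h k l x)\<^sup>2 - \<tau>) \<partial>P) = (\<integral>x. (a (x i) - \<tau>) * ((h k l x)\<^sup>2 - \<tau>) \<partial>P)"
  proof (subst resample[OF assms(2)])
    show "integrable P (\<lambda>x. ((h i j x)\<^sup>2 - \<tau>) * ((h k l x)\<^sup>2 - \<tau>))"
      using assms by (intro im i4) auto
    show "(\<integral>x. (\<integral>y. ((h i j (x(j := y)))\<^sup>2 - \<tau>) * ((h k l (x(j := y)))\<^sup>2 - \<tau>) \<partial>\<mu>) \<partial>P)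
      = (\<integral>x. (a (x i) - \<tau>) * ((h k l x)\<^sup>2 - \<tau>) \<partial>P)"
      using assms H2x space_P[OF _ assms(1)]
      by (intro Bochner_Integration.integral_cong) (auto simp: h_def a_def prob_space)
  qed
  also have "\<dots> = (\<integral>x. 0 \<partial>P)"
  proof (subst resample[OF assms(1)])
    show "integrable P (\<lambda>x. (a (x i) - \<tau>) * ((h k l x)\<^sup>2 - \<tau>))"
      using assms by (intro im i4 ia) auto
    show "(\<integral>x. (\<integral>y. (a ((x(i := y)) i) - \<tau>) * ((h k l (x(i := y)))\<^sup>2 - \<tau>) \<partial>\<mu>) \<partial>P) = (\<integral>x. 0 \<partial>P)"
      using assms a_int 
      by (intro Bochner_Integration.integral_cong) (auto simp: h_def \<tau>_def prob_space)
  qed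
  finally show ?thesis by simp
qed

end

lemma card2_le: "card {u, v} \<le> 2"
  by (simp add: card_insert_if)

lemma card3_le: "card {u, v, w} \<le> 3"
  by (simp add: card_insert_if)

text \<open>Applied with \<open>A\<close> the set of index tuples that interact with a fixed tuple;
  its cardinality is the combinatorial input of the variance bounds.\<close>

lemma sum_if_mem_le:
  fixes c :: real
  assumes "finite S" "finite A" "0 \<le> c" "card A \<le> m"
  shows "(\<Sum>q\<in>S. if q \<in> A then c else 0) \<le> real m * c"
proof -
  have "(\<Sum>q\<in>S. if q \<in> A then c else 0) = real (card (S \<inter> A)) * c"
    using assms(1) by (simp add: sum.inter_restrict[symmetric])
  also have "\<dots> \<le> real m * c"
    using assms card_mono[of A "S \<inter> A"] by (intro mult_right_mono) auto
  finally show ?thesis .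
qed

section \<open>Second moments of the sums over pairs and triples\<close>

context degenerate_kernel
begin

lemma E_square_sum:
  assumes "finite S" and f: "\<And>p q. p \<in> S \<Longrightarrow> q \<in> S \<Longrightarrow> integrable P (\<lambda>x. f p x * f q x :: real)"
  shows "integrable P (\<lambda>x. (\<Sum>p\<in>S. f p x)\<^sup>2)"
    and "(\<integral>x. (\<Sum>p\<in>S. f p x)\<^sup>2 \<partial>P) = (\<Sum>p\<in>S. \<Sum>q\<in>S. \<integral>x. f p x * f q x \<partial>P)"
  using f by (auto simp: power2_eq_square sum_product)

text \<open>Number of rows times the largest row sum. This is efficient because dependence is
  sparse: for a fixed tuple most of the mixed expectations vanish.\<close>

lemma E_square_sum_le:
  assumes "finite S" and f: "\<And>p q. p \<in> S \<Longrightarrow> q \<in> S \<Longrightarrow> integrable P (\<lambda>x. f p x * f q x :: real)"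
    and le: "\<And>p. p \<in> S \<Longrightarrow> (\<Sum>q\<in>S. \<integral>x. f p x * f q x \<partial>P) \<le> c" and "0 \<le> c" "card S \<le> m"
  shows "(\<integral>x. (\<Sum>p\<in>S. f p x)\<^sup>2 \<partial>P) \<le> real m * c"
proof -
  have "(\<integral>x. (\<Sum>p\<in>S. f p x)\<^sup>2 \<partial>P) = (\<Sum>p\<in>S. \<Sum>q\<in>S. \<integral>x. f p x * f q x \<partial>P)"
    by (rule E_square_sum(2)[OF assms(1) f])
  also have "\<dots> \<le> (\<Sum>p\<in>S. c)" using le by (intro sum_mono) auto
  also have "\<dots> \<le> real m * c" using assms(4,5) by (auto intro: mult_right_mono)
  finally show ?thesis .
qed

definition V :: "'i \<Rightarrow> ('i \<Rightarrow> 'x) \<Rightarrow> real" where "V i x = (\<Sum>j\<in>I - {i}. h i j x)"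
text \<open>The sums run over ordered pairs, hence the halves in \<open>W\<close> and
  \<open>Q\<close>. With them the square of \<open>W\<close> and \<open>Q\<close> both have
  expectation n (n - 1) \<tau> / 2, so \<open>W\<close> divided by the root of \<open>Q\<close> is
  self-normalized.\<close>

definition W :: "('i \<Rightarrow> 'x) \<Rightarrow> real" where "W x = (\<Sum>i\<in>I. V i x) / 2"
definition Q :: "('i \<Rightarrow> 'x) \<Rightarrow> real" where "Q x = (\<Sum>i\<in>I. \<Sum>j\<in>I - {i}. (h i j x)\<^sup>2) / 2"
definition S2 :: "('i \<times> 'i) set" where "S2 = {(i, j). i \<in> I \<and> j \<in> I \<and> i \<noteq> j}"
definition S3 :: "('i \<times> 'i \<times> 'i) set" where "S3 = {(i, j, k). i \<in> I \<and> j \<in> I \<and> k \<in> I \<and> i \<noteq> j \<and> i \<noteq> k \<and> j \<noteq> k}"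
text \<open>A cross term in the square of \<open>V i\<close>: the first index is the hub that both
  factors share.\<close>

definition t3 :: "'i \<times> 'i \<times> 'i \<Rightarrow> ('i \<Rightarrow> 'x) \<Rightarrow> real" where "t3 p x = (case p of (i, j, k) \<Rightarrow> h i j x * h i k x)"
abbreviation n :: nat where "n \<equiv> card I"

lemma V_meas[measurable]: "i \<in> I \<Longrightarrow> V i \<in> borel_measurable P"
  unfolding V_def[abs_def] by measurable
lemma W_meas[measurable]: "W \<in> borel_measurable P"
  unfolding W_def[abs_def] by measurable
lemma Q_meas[measurable]: "Q \<in> borel_measurable P"
  unfolding Q_def[abs_def] by measurable

lemma b_nonneg: "0 \<le> b" and m4_nonneg: "0 \<le> m4" and g4_nonneg: "0 \<le> g4" and \<tau>_nonneg: "0 \<le> \<tau>"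
  unfolding b_def m4_def g4_def \<tau>_def by (auto intro!: Bochner_Integration.integral_nonneg a_nonneg)

lemma S2_bounds: "finite S2" "card S2 \<le> n\<^sup>2" "card S2 = n * (n - 1)"
proof -
  have S2: "S2 = (SIGMA i:I. I - {i})" by (auto simp: S2_def)
  show "finite S2" unfolding S2 using I by auto
  show "card S2 = n * (n - 1)" unfolding S2 using I by (simp add: card_SigmaI)
  then show "card S2 \<le> n\<^sup>2" by (simp add: power2_eq_square)
qed

lemma S3_bounds: "finite S3" "card S3 \<le> n ^ 3"
proof -
  have S3: "S3 \<subseteq> I \<times> I \<times> I" by (auto simp: S3_def)
  then show "finite S3" using I by (auto intro: finite_subset)
  have "card S3 \<le> card (I \<times> I \<times> I)" using S3 I by (intro card_mono) auto
  then show "card S3 \<le> n ^ 3" by (simp add: card_cartesian_product power3_eq_cube mult.assoc)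
qed

lemma int_h2_centered:
  assumes "p \<in> S2" "q \<in> S2"
  shows "integrable P (\<lambda>x. ((h (fst p) (snd p) x)\<^sup>2 - \<tau>) * ((h (fst q) (snd q) x)\<^sup>2 - \<tau>))"
  using assms int_hh2 int_h2 by (auto simp: S2_def algebra_simps)

text \<open>Disjoint pairs are uncorrelated, and for the others centering only lowers the
  expectation by \<tau>^2. The same pair in either orientation gives \<open>m4\<close>, a single
  common index gives \<open>b\<close>. The second indicator also covers the first pattern, where it
  adds a nonnegative \<open>b\<close> that does no harm.\<close>

lemma E_h2_centered:
  assumes "p \<in> S2" "q \<in> S2"
  shows "(\<integral>x. ((h (fst p) (snd p) x)\<^sup>2 - \<tau>) * ((h (fst q) (snd q) x)\<^sup>2 - \<tau>) \<partial>P)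
    \<le> (if q \<in> {p, (snd p, fst p)} then m4 else 0) +
      (if q \<in> {fst p, snd p} \<times> I \<union> I \<times> {fst p, snd p} then b else 0)"
proof -
  obtain i j k l where pq: "p = (i, j)" "q = (k, l)" by (metis surj_pair)
  have ijkl: "i \<in> I" "j \<in> I" "i \<noteq> j" "k \<in> I" "l \<in> I" "k \<noteq> l" using assms by (auto simp: pq S2_def)
  have le: "(\<integral>x. ((h i j x)\<^sup>2 - \<tau>) * ((h k l x)\<^sup>2 - \<tau>) \<partial>P) \<le> (\<integral>x. (h i j x)\<^sup>2 * (h k l x)\<^sup>2 \<partial>P)"
  proof -
    have "(\<integral>x. ((h i j x)\<^sup>2 - \<tau>) * ((h k l x)\<^sup>2 - \<tau>) \<partial>P) =
      (\<integral>x. (h i j x)\<^sup>2 * (h k l x)\<^sup>2 - \<tau> * (h i j x)\<^sup>2 - \<tau> * (h k l x)\<^sup>2 + \<tau> * \<tau> \<partial>P)"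
      by (intro Bochner_Integration.integral_cong) (auto simp: algebra_simps)
    also have "\<dots> = (\<integral>x. (h i j x)\<^sup>2 * (h k l x)\<^sup>2 \<partial>P) - \<tau> * \<tau> - \<tau> * \<tau> + \<tau> * \<tau>"
      using ijkl int_hh2[of i j k l] int_h2[of i j] int_h2[of k l]
      by (simp add: E_h2 P.prob_space)
    finally show ?thesis using zero_le_square[of \<tau>] by simp
  qed
  consider "i \<notin> {k, l}" "j \<notin> {k, l}" | "(k, l) = (i, j) \<or> (k, l) = (j, i)"
    | "(i \<in> {k, l} \<or> j \<in> {k, l})" "(k, l) \<noteq> (i, j)" "(k, l) \<noteq> (j, i)" by auto
  then show ?thesis
  proof cases
    case 1
    with E_disjoint[of i j k l] ijkl show ?thesis
      using m4_nonneg b_nonneg by (auto simp: pq)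
  next
    case 2
    then have "(\<integral>x. (h i j x)\<^sup>2 * (h k l x)\<^sup>2 \<partial>P) = (\<integral>x. h i j x ^ 4 \<partial>P)"
      by (intro Bochner_Integration.integral_cong) (auto simp: h_sym[of j i] simp flip: power_add)
    also have "\<dots> = m4" using h4(2)[of i j] ijkl by simp
    finally show ?thesis using le 2 b_nonneg by (auto simp: pq)
  next
    case 3
    have "(\<integral>x. (h i j x)\<^sup>2 * (h k l x)\<^sup>2 \<partial>P) = b"
    proof -
      consider "k = i" "j \<noteq> l" | "k = j" "i \<noteq> l" | "l = i" "j \<noteq> k" | "l = j" "i \<noteq> k" using 3 ijkl by auto
      then show ?thesis
        using E_hh2[of i j l] E_hh2[of j i l] E_hh2[of i j k] E_hh2[of j i k] ijkl
        by cases (simp_all add: h_sym[of j i] h_sym[of k i] h_sym[of k j] )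
    qed
    with le 3 ijkl show ?thesis using m4_nonneg by (auto simp: pq)
  qed
qed

text \<open>A fixed pair meets itself in 2 orientations, and at most 4n ordered pairs share an index
  with it: two indices, two positions, n partners.\<close>

lemma E_Q_centered:
  "(\<integral>x. (\<Sum>p\<in>S2. (h (fst p) (snd p) x)\<^sup>2 - \<tau>)\<^sup>2 \<partial>P) \<le> real (n\<^sup>2) * (2 * m4 + 4 * real n * b)"
proof (rule E_square_sum_le)
  fix p assume p: "p \<in> S2"
  have "(\<Sum>q\<in>S2. \<integral>x. ((h (fst p) (snd p) x)\<^sup>2 - \<tau>) * ((h (fst q) (snd q) x)\<^sup>2 - \<tau>) \<partial>P)
    \<le> (\<Sum>q\<in>S2. if q \<in> {p, (snd p, fst p)} then m4 else 0) +
      (\<Sum>q\<in>S2. if q \<in> {fst p, snd p} \<times> I \<union> I \<times> {fst p, snd p} then b else 0)"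
    unfolding sum.distrib[symmetric] using p E_h2_centered by (intro sum_mono) auto
  also have "\<dots> \<le> real 2 * m4 + real (4 * n) * b"
  proof (intro add_mono sum_if_mem_le S2_bounds m4_nonneg b_nonneg)
    show "card {p, (snd p, fst p)} \<le> 2" by (rule card2_le)
    have "card ({fst p, snd p} \<times> I \<union> I \<times> {fst p, snd p}) \<le> card {fst p, snd p} * n + n * card {fst p, snd p}"
      by (rule order_trans[OF card_Un_le]) (simp add: card_cartesian_product)
    also have "\<dots> \<le> 2 * n + n * 2" by (intro add_mono mult_mono card2_le) auto
    finally show "card ({fst p, snd p} \<times> I \<union> I \<times> {fst p, snd p}) \<le> 4 * n" by simp
  qed (use I in auto)
  finally show "(\<Sum>q\<in>S2. \<integral>x. ((h (fst p) (snd p) x)\<^sup>2 - \<tau>) * ((h (fst q) (snd q) x)\<^sup>2 - \<tau>) \<partial>P)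
    \<le> 2 * m4 + 4 * real n * b" by simp
qed (use S2_bounds int_h2_centered m4_nonneg b_nonneg in auto)

lemma int_t3: "p \<in> S3 \<Longrightarrow> q \<in> S3 \<Longrightarrow> integrable P (\<lambda>x. t3 p x * t3 q x)"
  using int_h4 by (auto simp: S3_def t3_def simp flip: mult.assoc)

lemma E_t3_sq: "p \<in> S3 \<Longrightarrow> (\<integral>x. (t3 p x)\<^sup>2 \<partial>P) = b"
  using E_hh2 by (auto simp: S3_def t3_def power_mult_distrib)

lemma E_t3_abs_le:
  assumes "p \<in> S3" "q \<in> S3" shows "\<bar>\<integral>x. t3 p x * t3 q x \<partial>P\<bar> \<le> b"
proof -
  have "norm (\<integral>x. t3 p x * t3 q x \<partial>P) \<le> (\<integral>x. ((t3 p x)\<^sup>2 + (t3 q x)\<^sup>2) / 2 \<partial>P)"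
    using int_t3[OF assms] int_t3[OF assms(1,1)] int_t3[OF assms(2,2)] abs_mult_le_squares(1)
    by (intro norm_integral_le_AE) (auto simp: power2_eq_square)
  also have "\<dots> = b"
    using E_t3_sq assms int_t3[OF assms(1,1)] int_t3[OF assms(2,2)] by (simp add: power2_eq_square)
  finally show ?thesis by simp
qed

text \<open>An index that occurs in only one of the four factors makes the expectation vanish; the remaining
  index patterns are the triples inside \<open>{i, j, k}\<close> and the four-cycles \<open>i - j - i' - k\<close>.\<close>

lemma E_t3_le:
  assumes "(i, j, k) \<in> S3" "(i', j', k') \<in> S3"
  shows "(\<integral>x. t3 (i, j, k) x * t3 (i', j', k') x \<partial>P)
    \<le> (if (i', j', k') \<in> {i, j, k} \<times> {i, j, k} \<times> {i, j, k} then b else 0) +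
      (if (i', j', k') \<in> I \<times> {(j, k), (k, j)} then g4 else 0)"
proof (cases "(i', j', k') \<in> {i, j, k} \<times> {i, j, k} \<times> {i, j, k}")
  case True
  then show ?thesis using E_t3_abs_le[OF assms] g4_nonneg by auto
next
  case False
  note S = assms[unfolded S3_def, simplified]
  have z: "(\<integral>x. t3 (i, j, k) x * t3 (i', j', k') x \<partial>P) = 0"
    if "(\<lambda>x. t3 (i, j, k) x * t3 (i', j', k') x) = (\<lambda>x. h u v x * g x)"
      "u \<in> I" "v \<in> I" "u \<noteq> v" "\<And>x y. g (x(v := y)) = g x" for u v g
    using int_t3[OF assms] E_deg[of u v g] that by simp
  \<comment> \<open>Once \<open>j'\<close> and \<open>k'\<close> lie in {i, j, k} and
    \<open>i'\<close> does not, the index \<open>j\<close> can recur only as \<open>j'\<close> or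
    \<open>k'\<close>; otherwise it is the isolated one, and likewise for \<open>k\<close>.\<close>
  consider "j' \<notin> {i, j, k}" | "k' \<notin> {i, j, k}" | "j' \<in> {i, j, k}" "k' \<in> {i, j, k}" "i' \<notin> {i, j, k}" "j \<notin> {j', k'}"
    | "j' \<in> {i, j, k}" "k' \<in> {i, j, k}" "i' \<notin> {i, j, k}" "k \<notin> {j', k'}" | "i' \<notin> {i, j, k}" "(j', k') \<in> {(j, k), (k, j)}"
  proof -
    have "i' \<notin> {i, j, k}" if "j' \<in> {i, j, k}" "k' \<in> {i, j, k}" using False that by blast
    moreover have "(j', k') \<in> {(j, k), (k, j)}" if "j \<in> {j', k'}" "k \<in> {j', k'}" using that S by auto
    ultimately show ?thesis using that by blast
  qed
  then show ?thesis
  proof cases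
    case 1
    have "(\<integral>x. t3 (i, j, k) x * t3 (i', j', k') x \<partial>P) = 0"
      by (rule z[of i' j' "\<lambda>x. h i j x * h i k x * h i' k' x"]) (use 1 S in \<open>auto simp: t3_def h_def fun_eq_iff mult_ac\<close>)
    then show ?thesis using g4_nonneg b_nonneg by auto
  next
    case 2
    have "(\<integral>x. t3 (i, j, k) x * t3 (i', j', k') x \<partial>P) = 0"
      by (rule z[of i' k' "\<lambda>x. h i j x * h i k x * h i' j' x"]) (use 2 S in \<open>auto simp: t3_def h_def fun_eq_iff mult_ac\<close>)
    then show ?thesis using g4_nonneg b_nonneg by auto
  next
    case 3
    have "(\<integral>x. t3 (i, j, k) x * t3 (i', j', k') x \<partial>P) = 0"
      by (rule z[of i j "\<lambda>x. h i k x * h i' j' x * h i' k' x"]) (use 3 S in \<open>auto simp: t3_def h_def fun_eq_iff mult_ac\<close>)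
    then show ?thesis using g4_nonneg b_nonneg by auto
  next
    case 4
    have "(\<integral>x. t3 (i, j, k) x * t3 (i', j', k') x \<partial>P) = 0"
      by (rule z[of i k "\<lambda>x. h i j x * h i' j' x * h i' k' x"]) (use 4 S in \<open>auto simp: t3_def h_def fun_eq_iff mult_ac\<close>)
    then show ?thesis using g4_nonneg b_nonneg by auto
  next
    case 5
    have "(\<integral>x. t3 (i, j, k) x * t3 (i', j', k') x \<partial>P) = (\<integral>x. h i j x * h i k x * h i' j x * h i' k x \<partial>P)"
      using 5(2) by (intro Bochner_Integration.integral_cong) (auto simp: t3_def mult_ac)
    also have "\<dots> = g4" using E_cycle[of i j k i'] S 5 by auto
    finally show ?thesis using 5 S b_nonneg by auto
  qed
qed

text \<open>27 = 3^3 counts the triples inside {i, j, k}; a four-cycle leaves the hub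
  \<open>i'\<close> free and allows two orders of \<open>j\<close>, \<open>k\<close>, hence the 2n.
  Degeneracy thus reduces each row from about n^3 terms to order n.\<close>

lemma E_t3_sum: "(\<integral>x. (\<Sum>p\<in>S3. t3 p x)\<^sup>2 \<partial>P) \<le> real (n ^ 3) * (27 * b + 2 * real n * g4)"
proof (rule E_square_sum_le)
  fix p assume p: "p \<in> S3"
  obtain i j k where pe: "p = (i, j, k)" by (metis surj_pair)
  let ?A = "{i, j, k} \<times> {i, j, k} \<times> {i, j, k}" and ?B = "I \<times> {(j, k), (k, j)}"
  have "(\<Sum>q\<in>S3. \<integral>x. t3 p x * t3 q x \<partial>P)
    \<le> (\<Sum>q\<in>S3. if q \<in> ?A then b else 0) + (\<Sum>q\<in>S3. if q \<in> ?B then g4 else 0)"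
    unfolding sum.distrib[symmetric]
  proof (intro sum_mono)
    fix q assume "q \<in> S3"
    then show "(\<integral>x. t3 p x * t3 q x \<partial>P) \<le> (if q \<in> ?A then b else 0) + (if q \<in> ?B then g4 else 0)"
      using E_t3_le[of i j k "fst q" "fst (snd q)" "snd (snd q)"] p unfolding pe by simp
  qed
  also have "\<dots> \<le> real 27 * b + real (2 * n) * g4"
  proof -
    have "card ?A \<le> 3 * (3 * 3)" unfolding card_cartesian_product by (intro mult_mono card3_le) auto
    then have A: "card ?A \<le> 27" by (simp only: mult_numeral_1 semiring_norm mult_num_simps arith_simps)
    have "card ?B = n * card {(j, k), (k, j)}" by (rule card_cartesian_product)
    also have "\<dots> \<le> n * 2" by (intro mult_le_mono2 card2_le)
    also have "\<dots> = 2 * n" by (rule mult.commute)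
    finally have B: "card ?B \<le> 2 * n" .
    have "finite ?A" "finite ?B" using I by (intro finite_cartesian_product finite.intros)+
    then show ?thesis
      using add_mono[OF sum_if_mem_le[OF S3_bounds(1) _ b_nonneg A] sum_if_mem_le[OF S3_bounds(1) _ g4_nonneg B]] by blast
  qed
  finally show "(\<Sum>q\<in>S3. \<integral>x. t3 p x * t3 q x \<partial>P) \<le> 27 * b + 2 * real n * g4" by simp
qed (use S3_bounds int_t3 g4_nonneg b_nonneg in auto)

end

lemma (in prob_space) abs_expectation_le_sqrt:
  fixes f :: "'a \<Rightarrow> real"
  assumes [measurable]: "f \<in> borel_measurable M" and f2: "integrable M (\<lambda>x. (f x)\<^sup>2)"
    and le: "expectation (\<lambda>x. (f x)\<^sup>2) \<le> c"
  shows "expectation (\<lambda>x. \<bar>f x\<bar>) \<le> sqrt c"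
proof -
  have "(expectation (\<lambda>x. \<bar>f x\<bar>))\<^sup>2 \<le> expectation (\<lambda>x. \<bar>f x\<bar>\<^sup>2)"
    using f2 by (intro sq_expectation_le) auto
  also have "\<dots> \<le> c" using le by simp
  finally show ?thesis by (rule real_le_rsqrt)
qed

section \<open>Expansion of the leave-one-out sums and normal approximation of W\<close>

context degenerate_kernel
begin

lemma sum_S2: "(\<Sum>i\<in>I. \<Sum>j\<in>I - {i}. f i j) = (\<Sum>p\<in>S2. f (fst p) (snd p))" for f :: "_ \<Rightarrow> _ \<Rightarrow> real"
proof -
  have S2: "S2 = (SIGMA i:I. I - {i})" by (auto simp: S2_def)
  show ?thesis unfolding S2 using I by (subst sum.Sigma) (auto simp: split_beta')
qed

text \<open>Separates squares from products over two distinct neighbours of \<open>i\<close>. Both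
  the sum of all squares and the fourth moment of \<open>V i\<close> are computed from this
  form.\<close>

lemma V_sq: "(V i x)\<^sup>2 = (\<Sum>j\<in>I - {i}. (h i j x)\<^sup>2) + (\<Sum>q\<in>{q \<in> S2. fst q \<noteq> i \<and> snd q \<noteq> i}. t3 (i, q) x)"
proof -
  have fin: "finite (I - {i})" using I by simp
  have "(V i x)\<^sup>2 = (\<Sum>j\<in>I - {i}. \<Sum>k\<in>I - {i}. h i j x * h i k x)"
    by (simp add: V_def power2_eq_square sum_product)
  also have "\<dots> = (\<Sum>j\<in>I - {i}. (h i j x)\<^sup>2 + (\<Sum>k\<in>I - {i} - {j}. h i j x * h i k x))"
    using fin by (intro sum.cong) (auto simp: sum.remove[of "I - {i}"] power2_eq_square)
  also have "\<dots> = (\<Sum>j\<in>I - {i}. (h i j x)\<^sup>2) + (\<Sum>j\<in>I - {i}. \<Sum>k\<in>I - {i} - {j}. h i j x * h i k x)"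
    by (rule sum.distrib)
  also have "(\<Sum>j\<in>I - {i}. \<Sum>k\<in>I - {i} - {j}. h i j x * h i k x) = (\<Sum>q\<in>(SIGMA j:I - {i}. I - {i} - {j}). t3 (i, q) x)"
    using fin by (subst sum.Sigma) (auto simp: t3_def split_beta')
  also have "(SIGMA j:I - {i}. I - {i} - {j}) = {q \<in> S2. fst q \<noteq> i \<and> snd q \<noteq> i}"
    by (auto simp: S2_def)
  finally show ?thesis .
qed

lemma sum_V_sq: "(\<Sum>i\<in>I. (V i x)\<^sup>2) = (\<Sum>p\<in>S2. (h (fst p) (snd p) x)\<^sup>2) + (\<Sum>p\<in>S3. t3 p x)"
proof -
  have S3: "S3 = (SIGMA i:I. {q \<in> S2. fst q \<noteq> i \<and> snd q \<noteq> i})" by (auto simp: S3_def S2_def)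
  have "(\<Sum>i\<in>I. \<Sum>q\<in>{q \<in> S2. fst q \<noteq> i \<and> snd q \<noteq> i}. t3 (i, q) x) = (\<Sum>p\<in>S3. t3 p x)"
    unfolding S3 using I S2_bounds by (subst sum.Sigma) (auto simp: split_beta')
  then show ?thesis unfolding V_sq sum.distrib sum_S2 by simp
qed

lemma int_V2: "i \<in> I \<Longrightarrow> integrable P (\<lambda>x. (V i x)\<^sup>2)"
  and E_V2: "i \<in> I \<Longrightarrow> (\<integral>x. (V i x)\<^sup>2 \<partial>P) = real (n - 1) * \<tau>"
proof -
  assume i: "i \<in> I"
  have int: "integrable P (\<lambda>x. h i j x * h i k x)" if "j \<in> I - {i}" "k \<in> I - {i}" for j k
  proof (rule Bochner_Integration.integrable_bound)
    show "integrable P (\<lambda>x. (h i j x)\<^sup>2 + (h i k x)\<^sup>2)" using that i int_h2 by auto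
    show "AE x in P. norm (h i j x * h i k x) \<le> norm ((h i j x)\<^sup>2 + (h i k x)\<^sup>2)"
      using abs_mult_le_squares(2) by simp
  qed (use that i in auto)
  have fin: "finite (I - {i})" using I by simp
  show "integrable P (\<lambda>x. (V i x)\<^sup>2)" unfolding V_def using E_square_sum(1)[OF fin int] by simp
  have "(\<integral>x. (V i x)\<^sup>2 \<partial>P) = (\<Sum>j\<in>I - {i}. \<Sum>k\<in>I - {i}. \<integral>x. h i j x * h i k x \<partial>P)"
    unfolding V_def by (rule E_square_sum(2)[OF fin int])
  also have "\<dots> = (\<Sum>j\<in>I - {i}. \<Sum>k\<in>I - {i}. if k = j then \<tau> else 0)"
  proof (intro sum.cong refl)
    fix j k assume jk: "j \<in> I - {i}" "k \<in> I - {i}"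
    show "(\<integral>x. h i j x * h i k x \<partial>P) = (if k = j then \<tau> else 0)"
    proof (cases "k = j")
      case True
      then show ?thesis using E_h2[of i j] i jk by (auto simp: power2_eq_square)
    next
      case False
      have "(\<integral>x. h i j x * h i k x \<partial>P) = 0"
        using i jk False int[OF jk] by (intro E_deg) (auto simp: h_def)
      then show ?thesis using False by simp
    qed
  qed
  also have "\<dots> = real (n - 1) * \<tau>" using I i by simp
  finally show "(\<integral>x. (V i x)\<^sup>2 \<partial>P) = real (n - 1) * \<tau>" .
qed

text \<open>Degeneracy makes distinct pairs orthogonal, so an ordered pair meets only itself and its
  reversal; this 2 and the squared half in \<open>W\<close> combine to the factor 1/2.\<close>

lemma E_W2:
  shows "integrable P (\<lambda>x. (W x)\<^sup>2)" and "(\<integral>x. (W x)\<^sup>2 \<partial>P) \<le> real n * real (n - 1) * \<tau> / 2"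
proof -
  have int: "integrable P (\<lambda>x. h (fst p) (snd p) x * h (fst q) (snd q) x)" if "p \<in> S2" "q \<in> S2" for p q
  proof (rule Bochner_Integration.integrable_bound)
    show "integrable P (\<lambda>x. (h (fst p) (snd p) x)\<^sup>2 + (h (fst q) (snd q) x)\<^sup>2)" using that int_h2 by (auto simp: S2_def)
    show "AE x in P. norm (h (fst p) (snd p) x * h (fst q) (snd q) x) \<le> norm ((h (fst p) (snd p) x)\<^sup>2 + (h (fst q) (snd q) x)\<^sup>2)"
      using abs_mult_le_squares(2) by simp
  qed (use that in \<open>auto simp: S2_def\<close>)
  have W: "(W x)\<^sup>2 = (\<Sum>p\<in>S2. h (fst p) (snd p) x)\<^sup>2 / 4" for x
    unfolding W_def V_def sum_S2 by (simp add: power_divide)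
  show "integrable P (\<lambda>x. (W x)\<^sup>2)"
    unfolding W using E_square_sum(1)[OF S2_bounds(1) int] by simp
  have "(\<integral>x. (\<Sum>p\<in>S2. h (fst p) (snd p) x)\<^sup>2 \<partial>P) \<le> real (n * (n - 1)) * (real 2 * \<tau>)"
  proof (rule E_square_sum_le[OF S2_bounds(1) int])
    fix p assume p: "p \<in> S2"
    have "(\<Sum>q\<in>S2. \<integral>x. h (fst p) (snd p) x * h (fst q) (snd q) x \<partial>P) \<le> (\<Sum>q\<in>S2. if q \<in> {p, (snd p, fst p)} then \<tau> else 0)"
    proof (intro sum_mono)
      fix q assume q: "q \<in> S2"
      obtain i j k l where pq: "p = (i, j)" "q = (k, l)" by (metis surj_pair)
      have ijkl: "i \<in> I" "j \<in> I" "i \<noteq> j" "k \<in> I" "l \<in> I" "k \<noteq> l" using p q by (auto simp: pq S2_def)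
      have int': "integrable P (\<lambda>x. h i j x * h k l x)" using int[OF p q] by (simp add: pq)
      consider "k \<notin> {i, j}" | "l \<notin> {i, j}" | "(k, l) = (i, j) \<or> (k, l) = (j, i)" using ijkl by auto
      then show "(\<integral>x. h (fst p) (snd p) x * h (fst q) (snd q) x \<partial>P) \<le> (if q \<in> {p, (snd p, fst p)} then \<tau> else 0)"
      proof cases
        case 1
        then have "(\<integral>x. h l k x * h i j x \<partial>P) = 0"
          using ijkl int' by (intro E_deg) (auto simp: h_def H_sym mult.commute)
        then show ?thesis using \<tau>_nonneg by (auto simp: pq mult.commute h_sym[of k l])
      next
        case 2
        then have "(\<integral>x. h k l x * h i j x \<partial>P) = 0"
          using ijkl int' by (intro E_deg) (auto simp: h_def mult.commute)
        then show ?thesis using \<tau>_nonneg by (auto simp: pq mult.commute)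
      next
        case 3
        then have "(\<integral>x. h i j x * h k l x \<partial>P) = \<tau>"
          using E_h2[of i j] ijkl by (auto simp: h_sym[of j i] power2_eq_square)
        then show ?thesis using 3 by (auto simp: pq)
      qed
    qed
    also have "\<dots> \<le> real 2 * \<tau>"
      by (intro sum_if_mem_le S2_bounds \<tau>_nonneg card2_le) auto
    finally show "(\<Sum>q\<in>S2. \<integral>x. h (fst p) (snd p) x * h (fst q) (snd q) x \<partial>P) \<le> real 2 * \<tau>" .
  qed (use \<tau>_nonneg S2_bounds in auto)
  then show "(\<integral>x. (W x)\<^sup>2 \<partial>P) \<le> real n * real (n - 1) * \<tau> / 2"
    unfolding W by simp
qed

text \<open>With the same hub \<open>i\<close> on both sides, a four-cycle with a new hub cannot
  occur, so the cross terms are governed by \<open>b\<close> alone, with at most 9 = 3^2 partners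
  each. From V^4 <= 2 A^2 + 2 B^2 the coefficient of n^2 b is 2 (1 + 9) = 20.\<close>

lemma E_V4:
  assumes i: "i \<in> I"
  shows "integrable P (\<lambda>x. V i x ^ 4)" and "(\<integral>x. V i x ^ 4 \<partial>P) \<le> 2 * real n * m4 + 20 * (real n)\<^sup>2 * b"
proof -
  let ?J = "I - {i}" and ?R = "{q \<in> S2. fst q \<noteq> i \<and> snd q \<noteq> i}"
  define A where "A x = (\<Sum>j\<in>?J. (h i j x)\<^sup>2)" for x
  define B where "B x = (\<Sum>q\<in>?R. t3 (i, q) x)" for x
  have fin: "finite ?J" "finite ?R" using I S2_bounds by auto
  have R: "(i, q) \<in> S3" if "q \<in> ?R" for q using that i by (cases q) (auto simp: S2_def S3_def)
  have [measurable]: "A \<in> borel_measurable P" "B \<in> borel_measurable P"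
  proof -
    show "A \<in> borel_measurable P" unfolding A_def[abs_def] using i by auto
    show "B \<in> borel_measurable P" unfolding B_def[abs_def] using i
      by (intro borel_measurable_sum) (auto simp: S2_def t3_def split_beta')
  qed
  have intA: "integrable P (\<lambda>x. (h i j x)\<^sup>2 * (h i k x)\<^sup>2)" if "j \<in> ?J" "k \<in> ?J" for j k
    using int_hh2 i that by auto
  have intB: "integrable P (\<lambda>x. t3 (i, p) x * t3 (i, q) x)" if "p \<in> ?R" "q \<in> ?R" for p q
    using int_t3[OF R[OF that(1)] R[OF that(2)]] .
  have A2: "integrable P (\<lambda>x. (A x)\<^sup>2)"
    unfolding A_def by (rule E_square_sum(1)[OF fin(1) intA])
  have B2: "integrable P (\<lambda>x. (B x)\<^sup>2)"
    unfolding B_def by (rule E_square_sum(1)[OF fin(2) intB])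
  have V: "V i x ^ 4 = (A x + B x)\<^sup>2" for x
    proof -
    have "V i x ^ 4 = ((V i x)\<^sup>2)\<^sup>2" by simp
    then show ?thesis unfolding V_sq A_def B_def .
  qed
  have le: "V i x ^ 4 \<le> 2 * (A x)\<^sup>2 + 2 * (B x)\<^sup>2" for x
  proof -
    have "(A x + B x)\<^sup>2 = (A x)\<^sup>2 + (B x)\<^sup>2 + 2 * (A x * B x)" by (simp add: power2_sum)
    moreover have "\<bar>A x * B x\<bar> \<le> ((A x)\<^sup>2 + (B x)\<^sup>2) / 2" by (rule abs_mult_le_squares(1))
    ultimately show ?thesis unfolding V by argo
  qed
  show int: "integrable P (\<lambda>x. V i x ^ 4)"
    by (rule Bochner_Integration.integrable_bound[of _ "\<lambda>x. 2 * (A x)\<^sup>2 + 2 * (B x)\<^sup>2"])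
       (use A2 B2 le i in \<open>auto intro: order_trans[OF _ abs_ge_self]\<close>)
  have cJ: "card ?J \<le> n" using I by (auto intro: card_mono)
  have "(\<integral>x. (A x)\<^sup>2 \<partial>P) \<le> real n * (m4 + real n * b)"
    unfolding A_def
  proof (rule E_square_sum_le[OF fin(1) intA])
    fix j assume j: "j \<in> ?J"
    have "(\<Sum>k\<in>?J. \<integral>x. (h i j x)\<^sup>2 * (h i k x)\<^sup>2 \<partial>P) \<le> (\<Sum>k\<in>?J. (if k \<in> {j} then m4 else 0) + b)"
    proof (intro sum_mono)
      fix k assume k: "k \<in> ?J"
      have "(\<integral>x. (h i j x)\<^sup>2 * (h i j x)\<^sup>2 \<partial>P) = m4"
        using h4(2)[of i j] i j by (auto simp flip: power_add)
      then show "(\<integral>x. (h i j x)\<^sup>2 * (h i k x)\<^sup>2 \<partial>P) \<le> (if k \<in> {j} then m4 else 0) + b"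
        using E_hh2[of i j k] i j k b_nonneg by auto
    qed
    also have "\<dots> = (\<Sum>k\<in>?J. if k \<in> {j} then m4 else 0) + real (card ?J) * b"
      by (simp add: sum.distrib)
    also have "\<dots> \<le> real 1 * m4 + real n * b"
      using cJ b_nonneg by (intro add_mono sum_if_mem_le mult_right_mono fin m4_nonneg) auto
    finally show "(\<Sum>k\<in>?J. \<integral>x. (h i j x)\<^sup>2 * (h i k x)\<^sup>2 \<partial>P) \<le> m4 + real n * b" by simp
  qed (use cJ m4_nonneg b_nonneg in auto)
  moreover have "(\<integral>x. (B x)\<^sup>2 \<partial>P) \<le> real (n\<^sup>2) * (real 9 * b)"
    unfolding B_def
  proof (rule E_square_sum_le[OF fin(2) intB])
    fix p assume p: "p \<in> ?R"
    obtain j k where pe: "p = (j, k)" by (metis surj_pair)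
    let ?T = "{i, j, k}"
    have "(\<Sum>q\<in>?R. \<integral>x. t3 (i, p) x * t3 (i, q) x \<partial>P) \<le> (\<Sum>q\<in>?R. if q \<in> ?T \<times> ?T then b else 0)"
    proof (intro sum_mono)
      fix q assume q: "q \<in> ?R"
      obtain j' k' where qe: "q = (j', k')" by (metis surj_pair)
      have 1: "(i, j, k) \<in> S3" "(i, j', k') \<in> S3" using R[OF p] R[OF q] by (simp_all add: pe qe)
      show "(\<integral>x. t3 (i, p) x * t3 (i, q) x \<partial>P) \<le> (if q \<in> ?T \<times> ?T then b else 0)"
      proof (cases "q \<in> ?T \<times> ?T")
        case True
        then show ?thesis using E_t3_abs_le[OF 1] by (simp add: pe qe)
      next
        case False
        then have "(i, j', k') \<notin> ?T \<times> ?T \<times> ?T" "(i, j', k') \<notin> I \<times> {(j, k), (k, j)}"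
          by (auto simp: qe)
        then show ?thesis using E_t3_le[OF 1] False by (simp only: pe if_False)
            (metis add.right_neutral qe)
      qed
    qed
    also have "\<dots> \<le> real 9 * b"
    proof (intro sum_if_mem_le fin b_nonneg)
      have "card (?T \<times> ?T) \<le> 3 * 3" unfolding card_cartesian_product by (intro mult_mono card3_le) auto
      also have "3 * 3 = (9::nat)" by simp
      finally show "card (?T \<times> ?T) \<le> 9" .
    qed auto
    finally show "(\<Sum>q\<in>?R. \<integral>x. t3 (i, p) x * t3 (i, q) x \<partial>P) \<le> real 9 * b" .
  next
    have "card ?R \<le> card S2" using S2_bounds by (intro card_mono) auto
    then show "card ?R \<le> n\<^sup>2" using S2_bounds by simp
  qed (use b_nonneg in auto)
  moreover have "(\<integral>x. V i x ^ 4 \<partial>P) \<le> 2 * (\<integral>x. (A x)\<^sup>2 \<partial>P) + 2 * (\<integral>x. (B x)\<^sup>2 \<partial>P)"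
    using integral_mono[OF int _ le] A2 B2 by simp
  ultimately show "(\<integral>x. V i x ^ 4 \<partial>P) \<le> 2 * real n * m4 + 20 * (real n)\<^sup>2 * b"
    by (simp add: algebra_simps power2_eq_square)
qed

lemma Q_eq: "2 * Q x = (\<Sum>p\<in>S2. (h (fst p) (snd p) x)\<^sup>2)"
  unfolding Q_def sum_S2 by simp

text \<open>Pairs containing \<open>i\<close> occur once inside \<open>V i\<close> and once spread
  over the other \<open>V k\<close>; after halving they add up to exactly \<open>V i\<close>, so the
  difference involves the remaining indices only.\<close>

lemma W_minus_V: "i \<in> I \<Longrightarrow> W x - V i x = (\<Sum>k\<in>I - {i}. \<Sum>l\<in>I - {i} - {k}. h k l x) / 2"
proof -
  assume i: "i \<in> I"
  have fin: "finite (I - {i})" using I by simp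
  have "2 * W x = V i x + (\<Sum>k\<in>I - {i}. V k x)" unfolding W_def using I i by (simp add: sum.remove)
  also have "(\<Sum>k\<in>I - {i}. V k x) = (\<Sum>k\<in>I - {i}. h k i x + (\<Sum>l\<in>I - {i} - {k}. h k l x))"
  proof (intro sum.cong refl)
    fix k assume k: "k \<in> I - {i}"
    have "I - {k} = insert i (I - {i} - {k})" using k i by auto
    then show "V k x = h k i x + (\<Sum>l\<in>I - {i} - {k}. h k l x)"
      unfolding V_def using I by (simp add: sum.insert)
  qed
  also have "\<dots> = V i x + (\<Sum>k\<in>I - {i}. \<Sum>l\<in>I - {i} - {k}. h k l x)"
    unfolding sum.distrib V_def using h_sym by simp
  finally show ?thesis by simp
qed

lemma leave_one_out_orthogonal:
  assumes i: "i \<in> I"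
  shows "(\<integral>x. V i x * iexp (s * (W x - V i x)) \<partial>P) = 0"
proof -
  note [measurable] = V_meas[OF i]
  have V1: "integrable P (V i)"
    using P.square_integrable_imp_integrable[of "V i"] int_V2[OF i] by simp
  have int: "integrable P (\<lambda>x. V i x * iexp (s * (W x - V i x)))"
    by (rule Bochner_Integration.integrable_bound[OF integrable_norm[OF V1]]) (auto simp: norm_mult)
  have "(\<integral>x. V i x * iexp (s * (W x - V i x)) \<partial>P) = (\<integral>x. 0 \<partial>P)"
  proof (subst resample[OF i int], intro Bochner_Integration.integral_cong refl)
    fix x assume x: "x \<in> space P"
    have W: "W (x(i := y)) - V i (x(i := y)) = W x - V i x" for y
      unfolding W_minus_V[OF i] by (auto simp: h_def intro!: sum.cong)
    have V: "V i (x(i := y)) = (\<Sum>j\<in>I - {i}. H (x j) y)" for y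
      unfolding V_def by (auto simp: h_def H_sym intro!: sum.cong)
    have "(\<integral>y. (\<Sum>j\<in>I - {i}. H (x j) y) \<partial>\<mu>) = 0"
      using H_int H_deg space_P[OF x] by (subst Bochner_Integration.integral_sum) auto
    then have "(\<integral>y. complex_of_real (\<Sum>j\<in>I - {i}. H (x j) y) \<partial>\<mu>) = 0"
      by (subst integral_complex_of_real) simp
    then show "(\<integral>y. V i (x(i := y)) * iexp (s * (W (x(i := y)) - V i (x(i := y)))) \<partial>\<mu>) = 0"
      unfolding W unfolding V by simp
  qed
  then show ?thesis by simp
qed

text \<open>The premise \<open>norm\<close> says that \<open>Q\<close> has mean 1. The sum of the
  V_i^2 is 2 Q plus the cross terms, so \<open>D\<close> and \<open>E\<close> are the two sources of
  deviation from 2. Their second moments are at most 4 \<epsilon> and 36 \<epsilon>, and (2 + 6) / 2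
  is the constant 4 of the conclusion.\<close>

lemma char_U_statistic:
  assumes norm: "real n * real (n - 1) * \<tau> = 2"
    and \<epsilon>: "real n ^ 2 * m4 + real n ^ 3 * b + real n ^ 4 * g4 \<le> \<epsilon>" "0 < \<epsilon>"
  shows "norm ((\<integral>x. iexp (t * W x) \<partial>P) - of_real (exp (- t\<^sup>2 / 2))) \<le> 4 * (t\<^sup>2 + \<bar>t\<bar> ^ 3) * sqrt \<epsilon>"
    and "(\<integral>x. \<bar>Q x - 1\<bar> \<partial>P) \<le> sqrt \<epsilon>"
    and "(\<integral>x. (W x)\<^sup>2 \<partial>P) \<le> 1"
proof -
  have n1: "real (card S2) * \<tau> = 2" using norm unfolding S2_bounds(3) of_nat_mult .
  define D where "D x = (\<Sum>p\<in>S2. (h (fst p) (snd p) x)\<^sup>2 - \<tau>)" for x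
  define E where "E x = (\<Sum>p\<in>S3. t3 p x)" for x
  have nn: "0 \<le> real n ^ 2 * m4" "0 \<le> real n ^ 3 * b" "0 \<le> real n ^ 4 * g4"
    using m4_nonneg b_nonneg g4_nonneg by auto
  have D: "D x = 2 * Q x - 2" for x
    unfolding D_def Q_eq using n1 by (simp add: sum_subtractf)
  have [measurable]: "D \<in> borel_measurable P" "E \<in> borel_measurable P"
  proof -
    show "D \<in> borel_measurable P" unfolding D[abs_def] by measurable
    show "E \<in> borel_measurable P" unfolding E_def[abs_def]
      by (intro borel_measurable_sum) (auto simp: S3_def t3_def split_beta')
  qed
  have D2: "integrable P (\<lambda>x. (D x)\<^sup>2)"
    unfolding D_def by (rule E_square_sum(1)[OF S2_bounds(1) int_h2_centered])
  have E2: "integrable P (\<lambda>x. (E x)\<^sup>2)"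
    unfolding E_def by (rule E_square_sum(1)[OF S3_bounds(1) int_t3])
  have "(\<integral>x. (D x)\<^sup>2 \<partial>P) \<le> 2 * (real n ^ 2 * m4) + 4 * (real n ^ 3 * b)"
    using E_Q_centered unfolding D_def by (simp add: algebra_simps power2_eq_square power3_eq_cube)
  also have "\<dots> \<le> 2\<^sup>2 * \<epsilon>" using \<epsilon> nn by simp
  finally have "(\<integral>x. \<bar>D x\<bar> \<partial>P) \<le> sqrt (2\<^sup>2 * \<epsilon>)"
    by (rule P.abs_expectation_le_sqrt[OF _ D2, rotated]) simp
  then have ED: "(\<integral>x. \<bar>D x\<bar> \<partial>P) \<le> 2 * sqrt \<epsilon>" by (simp add: real_sqrt_mult)
  have "(\<integral>x. (E x)\<^sup>2 \<partial>P) \<le> 27 * (real n ^ 3 * b) + 2 * (real n ^ 4 * g4)"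
    using E_t3_sum unfolding E_def by (simp add: algebra_simps eval_nat_numeral)
  also have "\<dots> \<le> 6\<^sup>2 * \<epsilon>" using \<epsilon> nn by simp
  finally have "(\<integral>x. \<bar>E x\<bar> \<partial>P) \<le> sqrt (6\<^sup>2 * \<epsilon>)"
    by (rule P.abs_expectation_le_sqrt[OF _ E2, rotated]) simp
  then have EE: "(\<integral>x. \<bar>E x\<bar> \<partial>P) \<le> 6 * sqrt \<epsilon>" by (simp add: real_sqrt_mult)
  have iD: "integrable P D" and iE: "integrable P E"
    using D2 E2 by (auto intro: P.square_integrable_imp_integrable)
  show "(\<integral>x. \<bar>Q x - 1\<bar> \<partial>P) \<le> sqrt \<epsilon>"
  proof -
    have "\<bar>Q x - 1\<bar> = \<bar>D x\<bar> / 2" for x unfolding D by (simp add: abs_if)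
    then have "(\<integral>x. \<bar>Q x - 1\<bar> \<partial>P) = (\<integral>x. \<bar>D x\<bar> / 2 \<partial>P)" by presburger
    then show ?thesis using ED by simp
  qed
  show "(\<integral>x. (W x)\<^sup>2 \<partial>P) \<le> 1" using E_W2(2) unfolding norm by simp
  \<comment> \<open>Weight in |v|^3 <= (lam v^2 + v^4 / lam) / 2. The second moments of the V_i sum
    to 2 and the fourth moments to at most 20 \<epsilon>, so with lam^2 = 20 \<epsilon> the third
    moments sum to at most 3/2 lam.\<close>
  define lam where "lam = sqrt (20 * \<epsilon>)"
  have lam: "0 < lam" "lam * lam = 20 * \<epsilon>" unfolding lam_def using \<epsilon> by auto
  have "norm ((\<integral>x. iexp (t * W x) \<partial>P) - of_real (exp (- t\<^sup>2 / 2))) \<le> t\<^sup>2 * (4 * sqrt \<epsilon>) + \<bar>t\<bar> ^ 3 * (4 * sqrt \<epsilon>)"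
  proof (rule P.leave_one_out_char[OF I V_meas E_V4(1) _ leave_one_out_orthogonal])
    show "W x = (\<Sum>i\<in>I. V i x) / 2" for x by (rule W_def)
    have "(\<integral>x. \<bar>(\<Sum>i\<in>I. (V i x)\<^sup>2) / 2 - 1\<bar> \<partial>P) = (\<integral>x. \<bar>(D x + E x) / 2\<bar> \<partial>P)"
      unfolding sum_V_sq D E_def Q_eq[symmetric] by (intro Bochner_Integration.integral_cong) (auto simp: field_simps)
    also have "\<dots> \<le> (\<integral>x. (\<bar>D x\<bar> + \<bar>E x\<bar>) / 2 \<partial>P)"
      using iD iE by (intro integral_mono) auto
    also have "\<dots> \<le> 4 * sqrt \<epsilon>" using iD iE ED EE by simp
    finally show "(\<integral>x. \<bar>(\<Sum>i\<in>I. (V i x)\<^sup>2) / 2 - 1\<bar> \<partial>P) \<le> 4 * sqrt \<epsilon>" .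
    have V3: "(\<integral>x. \<bar>V i x\<bar> ^ 3 \<partial>P) \<le> lam / 2 * (real (n - 1) * \<tau>) + 1 / (2 * lam) * (2 * real n * m4 + 20 * (real n)\<^sup>2 * b)"
      if i: "i \<in> I" for i
    proof -
      note [measurable] = V_meas[OF i]
      have pw: "\<bar>v\<bar> ^ 3 \<le> lam / 2 * v\<^sup>2 + 1 / (2 * lam) * v ^ 4" for v
      proof -
        have "\<bar>v\<bar> ^ 3 * (2 * lam) \<le> lam\<^sup>2 * v\<^sup>2 + v ^ 4"
          using abs_mult_le_squares(1)[of "lam * v" "v\<^sup>2"] lam(1)
          by (simp add: abs_mult power_mult_distrib mult_ac power3_eq_cube power2_eq_square eval_nat_numeral)
        then show ?thesis using lam(1) by (simp add: field_simps power2_eq_square)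
      qed
      have "norm (\<integral>x. \<bar>V i x\<bar> ^ 3 \<partial>P) \<le> (\<integral>x. lam / 2 * (V i x)\<^sup>2 + 1 / (2 * lam) * V i x ^ 4 \<partial>P)"
        using pw int_V2[OF i] E_V4(1)[OF i] by (intro norm_integral_le_AE) auto
      also have "\<dots> = lam / 2 * (\<integral>x. (V i x)\<^sup>2 \<partial>P) + 1 / (2 * lam) * (\<integral>x. V i x ^ 4 \<partial>P)"
        using int_V2[OF i] E_V4(1)[OF i] by simp
      also have "\<dots> \<le> lam / 2 * (real (n - 1) * \<tau>) + 1 / (2 * lam) * (2 * real n * m4 + 20 * (real n)\<^sup>2 * b)"
        unfolding E_V2[OF i] using E_V4(2)[OF i] lam(1) by (intro add_left_mono mult_left_mono) auto
      finally show ?thesis by simp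
    qed
    have "(\<Sum>i\<in>I. \<integral>x. \<bar>V i x\<bar> ^ 3 \<partial>P) \<le> (\<Sum>i\<in>I. lam / 2 * (real (n - 1) * \<tau>) + 1 / (2 * lam) * (2 * real n * m4 + 20 * (real n)\<^sup>2 * b))"
      by (intro sum_mono V3)
    also have "\<dots> = lam / 2 * (real n * real (n - 1) * \<tau>) + 1 / (2 * lam) * (2 * (real n ^ 2 * m4) + 20 * (real n ^ 3 * b))"
      by (simp add: algebra_simps eval_nat_numeral)
    also have "\<dots> \<le> lam / 2 * 2 + 1 / (2 * lam) * (20 * \<epsilon>)"
      using \<epsilon> nn lam unfolding norm by (intro add_left_mono mult_left_mono) auto
    also have "\<dots> = 3 / 2 * lam" using lam by (simp add: field_simps flip: lam(2))
    also have "\<dots> \<le> 4 * (4 * sqrt \<epsilon>)"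
    proof -
      have "lam \<le> sqrt (5\<^sup>2 * \<epsilon>)" unfolding lam_def using \<epsilon>(2) by (intro real_sqrt_le_mono) simp
      also have "\<dots> = 5 * sqrt \<epsilon>" by (simp add: real_sqrt_mult)
      finally have "lam \<le> 5 * sqrt \<epsilon>" .
      moreover have "0 < sqrt \<epsilon>" using \<epsilon>(2) by simp
      ultimately show ?thesis by argo
    qed
    finally show "(\<Sum>i\<in>I. \<integral>x. \<bar>V i x\<bar> ^ 3 \<partial>P) \<le> 4 * (4 * sqrt \<epsilon>)" .
  qed
  then show "norm ((\<integral>x. iexp (t * W x) \<partial>P) - of_real (exp (- t\<^sup>2 / 2))) \<le> 4 * (t\<^sup>2 + \<bar>t\<bar> ^ 3) * sqrt \<epsilon>"
    by (simp add: algebra_simps)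
qed

end

text \<open>A pointwise dichotomy. Where |Q - 1| > \<delta>, the two exponentials differ by at most
  2, which 2 |Q - 1| / \<delta> absorbs, whatever the value of \<open>T\<close>. Elsewhere Q >= 1/2,
  and |1 - sqrt Q| <= |1 - Q| gives |T - W| <= 2 \<delta> |W|.\<close>

lemma (in prob_space) char_self_normalized:
  fixes W Q T :: "'a \<Rightarrow> real"
  assumes [measurable]: "W \<in> borel_measurable M" "Q \<in> borel_measurable M" "T \<in> borel_measurable M"
    and T: "\<And>x. x \<in> space M \<Longrightarrow> Q x > 0 \<Longrightarrow> T x = W x / sqrt (Q x)"
    and Q: "integrable M Q" "expectation (\<lambda>x. \<bar>Q x - 1\<bar>) \<le> \<eta>"
    and W2: "integrable M (\<lambda>x. (W x)\<^sup>2)" "expectation (\<lambda>x. (W x)\<^sup>2) \<le> 1"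
    and \<delta>: "0 < \<delta>" "\<delta> \<le> 1/2"
  shows "norm (expectation (\<lambda>x. iexp (t * T x)) - expectation (\<lambda>x. iexp (t * W x))) \<le> 2 * \<eta> / \<delta> + 2 * \<bar>t\<bar> * \<delta>"
proof -
  have W1: "integrable M W" using W2(1) by (rule square_integrable_imp_integrable[rotated]) simp
  have EW: "expectation (\<lambda>x. \<bar>W x\<bar>) \<le> 1" using abs_expectation_le_sqrt[OF _ W2] by simp
  have iT: "integrable M (\<lambda>x. iexp (t * f x))" if [measurable]: "f \<in> borel_measurable M" for f
    by (rule integrable_const_bound[of _ 1]) auto
  have pw: "norm (iexp (t * T x) - iexp (t * W x)) \<le> 2 / \<delta> * \<bar>Q x - 1\<bar> + 2 * \<bar>t\<bar> * \<delta> * \<bar>W x\<bar>"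
    if x: "x \<in> space M" for x
  proof (cases "\<bar>Q x - 1\<bar> \<le> \<delta>")
    case False
    have "norm (iexp (t * T x) - iexp (t * W x)) \<le> 1 + 1"
      by (rule order_trans[OF norm_triangle_ineq4]) simp
    also have "\<dots> \<le> 2 / \<delta> * \<bar>Q x - 1\<bar>" using False \<delta> by (simp add: field_simps)
    also have "\<dots> \<le> 2 / \<delta> * \<bar>Q x - 1\<bar> + 2 * \<bar>t\<bar> * \<delta> * \<bar>W x\<bar>" using \<delta> by simp
    finally show ?thesis .
  next
    case True
    have q: "1/2 \<le> Q x" using True \<delta>(2) by argo
    then have s: "1/2 \<le> sqrt (Q x)" by (intro real_le_rsqrt) (simp add: power2_eq_square)
    have "\<bar>1 - sqrt (Q x)\<bar> \<le> \<bar>1 - sqrt (Q x)\<bar> * (1 + sqrt (Q x))"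
      using q by (simp add: mult_le_cancel_left1)
    also have "\<dots> = \<bar>(1 - sqrt (Q x)) * (1 + sqrt (Q x))\<bar>" using s by (simp add: abs_mult)
    also have "(1 - sqrt (Q x)) * (1 + sqrt (Q x)) = 1 - Q x" using q by (simp add: algebra_simps)
    also have "\<bar>1 - Q x\<bar> \<le> \<delta>" using True by simp
    finally have d: "\<bar>1 - sqrt (Q x)\<bar> \<le> \<delta>" .
    have Tx: "T x = W x / sqrt (Q x)" using T[OF x] q by simp
    have "norm (iexp (t * T x) - iexp (t * W x)) = norm (iexp (t * W x) * (iexp (t * (T x - W x)) - 1))"
      by (simp add: algebra_simps flip: exp_add)
    also have "\<dots> \<le> \<bar>t * (T x - W x)\<bar>"
      using iexp_approx1[of "t * (T x - W x)" 0] by (simp add: norm_mult)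
    also have "T x - W x = W x * (1 - sqrt (Q x)) * (1 / sqrt (Q x))"
      proof -
      have "sqrt (Q x) \<noteq> 0" using s by auto
      then show ?thesis unfolding Tx by (simp add: field_simps)
    qed
    also have "\<bar>t * (W x * (1 - sqrt (Q x)) * (1 / sqrt (Q x)))\<bar> = \<bar>t\<bar> * (\<bar>W x\<bar> * \<bar>1 - sqrt (Q x)\<bar> * (1 / sqrt (Q x)))"
      using q by (simp add: abs_mult)
    also have "\<dots> \<le> \<bar>t\<bar> * (\<bar>W x\<bar> * \<delta> * 2)"
    proof -
      have "1 / sqrt (Q x) \<le> 2" using divide_left_mono[OF s, of 1] q by simp
      then show ?thesis using d q \<delta> by (intro mult_left_mono mult_mono) auto
    qed
    also have "\<dots> \<le> 2 / \<delta> * \<bar>Q x - 1\<bar> + 2 * \<bar>t\<bar> * \<delta> * \<bar>W x\<bar>" using \<delta> by simp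
    finally show ?thesis .
  qed
  have "norm (expectation (\<lambda>x. iexp (t * T x)) - expectation (\<lambda>x. iexp (t * W x)))
    = norm (expectation (\<lambda>x. iexp (t * T x) - iexp (t * W x)))"
    using iT by simp
  also have "\<dots> \<le> expectation (\<lambda>x. 2 / \<delta> * \<bar>Q x - 1\<bar> + 2 * \<bar>t\<bar> * \<delta> * \<bar>W x\<bar>)"
    using pw Q(1) W1 by (intro norm_integral_le_AE) auto
  also have "\<dots> = 2 / \<delta> * expectation (\<lambda>x. \<bar>Q x - 1\<bar>) + 2 * \<bar>t\<bar> * \<delta> * expectation (\<lambda>x. \<bar>W x\<bar>)"
    using Q(1) W1 by simp
  also have "\<dots> \<le> 2 / \<delta> * \<eta> + 2 * \<bar>t\<bar> * \<delta> * 1"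
    using Q(2) EW \<delta> by (intro add_mono mult_left_mono) auto
  finally show ?thesis by simp
qed

section \<open>Self-normalization and weak convergence\<close>

context degenerate_kernel
begin

lemma scaled_kernel: "degenerate_kernel \<mu> (\<lambda>x y. c * H x y) I"
proof unfold_locales
  show "finite I" by (rule I)
  show "(\<lambda>(x, y). c * H x y) \<in> borel_measurable (\<mu> \<Otimes>\<^sub>M \<mu>)"
    using H_meas by (simp add: split_beta')
  show "c * H x y = c * H y x" for x y using H_sym[of x y] by simp
  show "integrable \<mu> (\<lambda>y. c * H x y)" if "x \<in> space \<mu>" for x using H_int[OF that] by simp
  show "(\<integral>y. c * H x y \<partial>\<mu>) = 0" if "x \<in> space \<mu>" for x using H_deg[OF that] by simp
  show "integrable \<mu> (\<lambda>y. (c * H x y) ^ 4)" if "x \<in> space \<mu>" for x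
    using H4x[OF that] by (simp add: power_mult_distrib)
  show "integrable (\<mu> \<Otimes>\<^sub>M \<mu>) (\<lambda>(x, y). (c * H x y) ^ 4)"
    using H4 by (simp add: power_mult_distrib split_beta')
qed

text \<open>The ratio \<open>W\<close> / sqrt \<open>Q\<close> is invariant under scaling of the
  kernel, so the kernel is divided by the root of v = n (n - 1) \<tau> / 2, the mean of
  \<open>Q\<close>, to reach the normalized case. \<open>m4\<close>, \<open>b\<close> and
  \<open>g4\<close> scale with the fourth power, which is why the error condition is relative to
  v^2.\<close>

lemma char_self_normalized_U_statistic:
  fixes T :: "'s \<Rightarrow> real"
  assumes M: "prob_space M" and X: "X \<in> measurable M P" "distr M P X = P"
    and T[measurable]: "T \<in> borel_measurable M"
    and T_eq: "\<And>s. s \<in> space M \<Longrightarrow> 0 < Q (X s) \<Longrightarrow> T s = W (X s) / sqrt (Q (X s))"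
    and n: "2 \<le> n" and \<tau>: "0 < \<tau>"
    and \<epsilon>: "real n ^ 2 * m4 + real n ^ 3 * b + real n ^ 4 * g4 \<le> \<epsilon> * (real n * real (n - 1) * \<tau> / 2)\<^sup>2" "0 < \<epsilon>"
    and \<delta>: "0 < \<delta>" "\<delta> \<le> 1/2"
  shows "norm ((\<integral>s. iexp (t * T s) \<partial>M) - of_real (exp (- t\<^sup>2 / 2)))
    \<le> 4 * (t\<^sup>2 + \<bar>t\<bar> ^ 3) * sqrt \<epsilon> + 2 * sqrt \<epsilon> / \<delta> + 2 * \<bar>t\<bar> * \<delta>"
proof -
  define v where "v = real n * real (n - 1) * \<tau> / 2"
  have v: "0 < v" unfolding v_def using n \<tau> by simp
  define c where "c = 1 / sqrt v"
  have c: "0 < c" "c\<^sup>2 = 1 / v" "c ^ 4 = 1 / v\<^sup>2"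
  proof -
    show "0 < c" unfolding c_def using v by simp
    show c2: "c\<^sup>2 = 1 / v" unfolding c_def using v by (simp add: power_divide)
    have "c ^ 4 = (c\<^sup>2)\<^sup>2" by simp
    then show "c ^ 4 = 1 / v\<^sup>2" unfolding c2 by (simp add: power_divide)
  qed
  interpret S: degenerate_kernel \<mu> "\<lambda>x y. c * H x y" I by (rule scaled_kernel)
  interpret M: prob_space M by (rule M)
  note [measurable] = X(1)
  have Sa: "S.a x = c\<^sup>2 * a x" for x unfolding S.a_def a_def by (simp add: power_mult_distrib)
  have SG: "S.G x y = c\<^sup>2 * G x y" for x y unfolding S.G_def G_def
    by (simp add: power2_eq_square mult_ac flip: integral_mult_right_zero)
  have S\<tau>: "S.\<tau> = c\<^sup>2 * \<tau>" unfolding S.\<tau>_def \<tau>_def Sa by simp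
  have Sb: "S.b = c ^ 4 * b" unfolding S.b_def b_def Sa by (simp add: power_mult_distrib)
  have Sm4: "S.m4 = c ^ 4 * m4" unfolding S.m4_def m4_def by (simp add: power_mult_distrib)
  have Sg4: "S.g4 = c ^ 4 * g4" unfolding S.g4_def g4_def SG by (simp add: power_mult_distrib)
  have Sh: "S.h i j x = c * h i j x" for i j x unfolding S.h_def h_def ..
  have SW: "S.W x = c * W x" for x
    unfolding S.W_def W_def S.V_def V_def Sh by (simp add: sum_distrib_left)
  have SQ: "S.Q x = c\<^sup>2 * Q x" for x
    unfolding S.Q_def Q_def Sh by (simp add: sum_distrib_left power_mult_distrib)
  have norm: "real n * real (n - 1) * S.\<tau> = 2"
  proof -
    have "real n * real (n - 1) * (c\<^sup>2 * \<tau>) = c\<^sup>2 * (2 * v)" unfolding v_def by (simp add: mult_ac)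
    also have "\<dots> = 2" unfolding c using v by simp
    finally show ?thesis unfolding S\<tau> .
  qed
  have eps: "real n ^ 2 * S.m4 + real n ^ 3 * S.b + real n ^ 4 * S.g4 \<le> \<epsilon>"
  proof -
    have "real n ^ 2 * S.m4 + real n ^ 3 * S.b + real n ^ 4 * S.g4
      = (real n ^ 2 * m4 + real n ^ 3 * b + real n ^ 4 * g4) / v\<^sup>2"
      unfolding Sm4 Sb Sg4 c by (simp add: add_divide_distrib)
    also have "\<dots> \<le> \<epsilon>" using \<epsilon>(1) v unfolding v_def[symmetric] by (simp add: divide_le_eq)
    finally show ?thesis .
  qed
  note main = S.char_U_statistic[OF norm eps \<epsilon>(2)]
  note [measurable] = S.W_meas S.Q_meas
  have D: "(\<integral>x. f x \<partial>P) = (\<integral>s. f (X s) \<partial>M)" if f: "f \<in> borel_measurable P"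
    for f :: "_ \<Rightarrow> 'z::{banach, second_countable_topology}"
    using integral_distr[OF X(1) f] unfolding X(2) .
  have Di: "integrable M (\<lambda>s. f (X s))" if "integrable P f" for f :: "_ \<Rightarrow> real"
    by (rule integrable_distr[OF X(1)]) (simp only: X(2) that)
  have iQ: "integrable P S.Q"
    unfolding S.Q_def[abs_def]
    by (intro integrable_divide Bochner_Integration.integrable_sum S.int_h2) auto
  have char_W: "norm ((\<integral>s. iexp (t * S.W (X s)) \<partial>M) - of_real (exp (- t\<^sup>2 / 2))) \<le> 4 * (t\<^sup>2 + \<bar>t\<bar> ^ 3) * sqrt \<epsilon>"
    using main(1)[of t] D[of "\<lambda>x. iexp (t * S.W x)"] by simp
  have "norm ((\<integral>s. iexp (t * T s) \<partial>M) - (\<integral>s. iexp (t * S.W (X s)) \<partial>M)) \<le> 2 * sqrt \<epsilon> / \<delta> + 2 * \<bar>t\<bar> * \<delta>"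
  proof (rule M.char_self_normalized)
    fix s assume s: "s \<in> space M" "0 < S.Q (X s)"
    then have q: "0 < Q (X s)" unfolding SQ using v c(2) by (simp add: zero_less_divide_iff)
    then show "T s = S.W (X s) / sqrt (S.Q (X s))"
      unfolding SQ SW real_sqrt_mult using T_eq[OF s(1)] c(1) by simp
  next
    show "integrable M (\<lambda>s. S.Q (X s))" by (rule Di[OF iQ])
    show "(\<integral>s. \<bar>S.Q (X s) - 1\<bar> \<partial>M) \<le> sqrt \<epsilon>" using main(2) D[of "\<lambda>x. \<bar>S.Q x - 1\<bar>"] by simp
    show "integrable M (\<lambda>s. (S.W (X s))\<^sup>2)" using S.E_W2(1) by (rule Di)
    show "(\<integral>s. (S.W (X s))\<^sup>2 \<partial>M) \<le> 1" using main(3) D[of "\<lambda>x. (S.W x)\<^sup>2"] by simp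
  qed (use \<delta> in auto)
  with char_W show ?thesis
    using norm_triangle_ineq[of "(\<integral>s. iexp (t * T s) \<partial>M) - (\<integral>s. iexp (t * S.W (X s)) \<partial>M)"
       "(\<integral>s. iexp (t * S.W (X s)) \<partial>M) - of_real (exp (- t\<^sup>2 / 2))"] by simp
qed

end

section \<open>From characteristic functions to the limit law and the asymptotic level\<close>

lemma (in prob_space) weak_conv_std_normal_of_char_bound:
  fixes T :: "nat \<Rightarrow> 'a \<Rightarrow> real"
  assumes T[measurable]: "\<And>n. T n \<in> borel_measurable M"
    and \<epsilon>: "\<epsilon> \<longlonglongrightarrow> 0"
    and bound: "\<forall>\<^sub>F n in sequentially. \<forall>t \<delta>. 0 < \<delta> \<longrightarrow> \<delta> \<le> 1/2 \<longrightarrow>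
      norm (expectation (\<lambda>s. iexp (t * T n s)) - of_real (exp (- t\<^sup>2 / 2)))
        \<le> 4 * (t\<^sup>2 + \<bar>t\<bar> ^ 3) * sqrt (\<epsilon> n) + 2 * sqrt (\<epsilon> n) / \<delta> + 2 * \<bar>t\<bar> * \<delta>"
  shows "weak_conv_m (\<lambda>n. distr M borel (T n)) std_normal_distribution"
proof (rule levy_continuity)
  show "real_distribution (distr M borel (T n))" for n by (rule real_distribution_distr) simp
  show "real_distribution std_normal_distribution" by (rule real_dist_normal_dist)
  fix t :: real
  have ch: "char (distr M borel (T n)) t = expectation (\<lambda>s. iexp (t * T n s))" for n
    unfolding char_def by (subst integral_distr) auto
  show "(\<lambda>n. char (distr M borel (T n)) t) \<longlonglongrightarrow> char std_normal_distribution t"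
    unfolding ch char_std_normal_distribution
  proof (rule LIMSEQ_I)
    fix e :: real assume e: "0 < e"
    \<comment> \<open>For the given \<open>t\<close> the last term is brought below e/2 first (the
      +1 covers t = 0); only then does \<open>n\<close> grow, because the middle term divides by
      \<delta>.\<close>
    define \<delta> where "\<delta> = min (1/2) (e / (8 * (\<bar>t\<bar> + 1)))"
    have "0 < \<delta>" unfolding \<delta>_def using e by (auto intro!: divide_pos_pos add_nonneg_pos)
    moreover have "\<delta> \<le> 1/2" unfolding \<delta>_def by (rule min.cobounded1)
    ultimately have \<delta>: "0 < \<delta>" "\<delta> \<le> 1/2" by auto
    have "\<delta> \<le> e / (8 * (\<bar>t\<bar> + 1))" unfolding \<delta>_def by (rule min.cobounded2)
    then have "\<delta> * (8 * (\<bar>t\<bar> + 1)) \<le> e" by (subst (asm) pos_le_divide_eq) auto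
    then have "8 * (\<bar>t\<bar> * \<delta>) + 8 * \<delta> \<le> e" by (simp add: algebra_simps)
    moreover have "0 \<le> \<bar>t\<bar> * \<delta>" using \<delta> by simp
    ultimately have "4 * (\<bar>t\<bar> * \<delta>) \<le> e" using \<delta>(1) by argo
    then have td: "2 * \<bar>t\<bar> * \<delta> \<le> e / 2" by simp
    have "(\<lambda>n. 4 * (t\<^sup>2 + \<bar>t\<bar> ^ 3) * sqrt (\<epsilon> n) + 2 * sqrt (\<epsilon> n) / \<delta>) \<longlonglongrightarrow> 4 * (t\<^sup>2 + \<bar>t\<bar> ^ 3) * sqrt 0 + 2 * sqrt 0 / \<delta>"
      using \<delta> by (intro tendsto_intros \<epsilon>) auto
    then have "\<forall>\<^sub>F n in sequentially. 4 * (t\<^sup>2 + \<bar>t\<bar> ^ 3) * sqrt (\<epsilon> n) + 2 * sqrt (\<epsilon> n) / \<delta> < e / 2"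
      using e by (intro order_tendstoD(2)) auto
    with bound have "\<forall>\<^sub>F n in sequentially. norm (expectation (\<lambda>s. iexp (t * T n s)) - of_real (exp (- t\<^sup>2 / 2))) < e"
    proof eventually_elim
      case (elim n)
      from elim(1)[rule_format, OF \<delta>, of t] elim(2) td show ?case by linarith
    qed
    then show "\<exists>no. \<forall>n\<ge>no. norm (expectation (\<lambda>s. iexp (t * T n s)) - of_real (exp (- t\<^sup>2 / 2))) < e"
      by (simp add: eventually_sequentially)
  qed
qed

lemma std_normal_singleton: "measure std_normal_distribution {x} = 0"
proof -
  have "emeasure std_normal_distribution {x} = (\<integral>\<^sup>+y. ennreal (std_normal_density y) * indicator {x} y \<partial>lborel)"
    by (rule emeasure_density) auto
  also have "\<dots> = 0"
    by (subst nn_integral_0_iff_AE) (auto intro!: AE_I[where N = "{x}"])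
  finally show ?thesis by (simp add: measure_def)
qed

text \<open>The cdf is continuous, so the set whose infimum is the quantile is closed and contains
  it. The intermediate value theorem supplies a point with cdf exactly \<open>p\<close>, which
  bounds the infimum from above.\<close>

lemma cdf_quantile_std_normal:
  assumes p: "0 < p" "p < 1"
  shows "cdf std_normal_distribution (quantile std_normal_distribution p) = p"
proof -
  interpret real_distribution std_normal_distribution by (rule real_dist_normal_dist)
  let ?F = "cdf std_normal_distribution"
  have cont: "isCont ?F x" for x by (subst isCont_cdf) (rule std_normal_singleton)
  have 1: "\<forall>\<^sub>F x in at_top. p < ?F x" by (rule order_tendstoD(1)[OF cdf_lim_at_top_prob p(2)])
  have 0: "\<forall>\<^sub>F x in at_bot. ?F x < p" by (rule order_tendstoD(2)[OF cdf_lim_at_bot p(1)])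
  obtain u where u: "p < ?F u" using eventually_happens[OF 1] by auto
  obtain l where l: "?F l < p" using eventually_happens[OF 0] by auto
  have lu: "l \<le> u" using cdf_nondecreasing[of u l] u l by (cases "l \<le> u") auto
  obtain x where x: "?F x = p" using IVT[of ?F l p u] u l lu cont by auto
  let ?S = "{x. p \<le> ?F x}"
  have bdd: "bdd_below ?S"
  proof (rule bdd_belowI[of _ l])
    fix y assume "y \<in> ?S"
    then have "\<not> y \<le> l" using cdf_nondecreasing[of y l] l by auto
    then show "l \<le> y" by simp
  qed
  have q: "quantile std_normal_distribution p = Inf ?S" unfolding quantile_def ..
  have "Inf ?S \<le> x" using x bdd by (intro cInf_lower) auto
  then have "?F (Inf ?S) \<le> p" using cdf_nondecreasing[of "Inf ?S" x] x by simp
  moreover have "p \<le> ?F (Inf ?S)"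
  proof -
    have "closed ?S" using cont by (intro closed_Collect_le continuous_on_const continuous_at_imp_continuous_on) auto
    then have "Inf ?S \<in> ?S" using x bdd by (intro closed_contains_Inf) auto
    then show ?thesis by simp
  qed
  ultimately show ?thesis unfolding q by simp
qed

text \<open>The closed half-line from the quantile on is a continuity set, because the limit law has
  no atom at its endpoint.\<close>

lemma (in prob_space) level_of_weak_conv:
  fixes T :: "nat \<Rightarrow> 'a \<Rightarrow> real"
  assumes T[measurable]: "\<And>n. T n \<in> borel_measurable M"
    and w: "weak_conv_m (\<lambda>n. distr M borel (T n)) std_normal_distribution"
    and \<alpha>: "0 < \<alpha>" "\<alpha> < 1"
  shows "(\<lambda>n. measure M {s \<in> space M. quantile std_normal_distribution (1 - \<alpha>) \<le> T n s}) \<longlonglongrightarrow> \<alpha>"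
proof -
  interpret N: real_distribution std_normal_distribution by (rule real_dist_normal_dist)
  let ?q = "quantile std_normal_distribution (1 - \<alpha>)"
  have "(\<lambda>n. measure (distr M borel (T n)) {?q..}) \<longlonglongrightarrow> measure std_normal_distribution {?q..}"
  proof (rule weak_conv_imp_continuity_set_conv)
    show "real_distribution (distr M borel (T n))" for n by (rule real_distribution_distr) simp
    show "real_distribution std_normal_distribution" by (rule real_dist_normal_dist)
    show "emeasure std_normal_distribution (frontier {?q..}) = 0"
      using std_normal_singleton[of ?q] by (simp add: frontier_real_atLeast N.emeasure_eq_measure)
  qed (use w in auto)
  moreover have "measure (distr M borel (T n)) {?q..} = measure M {s \<in> space M. ?q \<le> T n s}" for n
    by (subst measure_distr) (auto intro!: arg_cong[where f = "measure M"])
  moreover have "measure std_normal_distribution {?q..} = \<alpha>"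
  proof -
    have "measure std_normal_distribution ({..?q} \<union> {?q<..}) = measure std_normal_distribution {..?q} + measure std_normal_distribution {?q<..}"
      by (rule N.finite_measure_Union) auto
    moreover have "measure std_normal_distribution ({?q} \<union> {?q<..}) = measure std_normal_distribution {?q} + measure std_normal_distribution {?q<..}"
      by (rule N.finite_measure_Union) auto
    moreover have "{..?q} \<union> {?q<..} = space std_normal_distribution" "{?q} \<union> {?q<..} = {?q..}" by auto
    ultimately have "1 = cdf std_normal_distribution ?q + measure std_normal_distribution {?q..}"
      using N.prob_space by (simp add: cdf_def std_normal_singleton)
    then show ?thesis using cdf_quantile_std_normal[of "1 - \<alpha>"] \<alpha> by simp
  qed
  ultimately show ?thesis by simp
qed

section \<open>Densities with positive integrable Fourier transform\<close>

lemma fourier_real: "fourier f t = (LINT x|lborel. f x *\<^sub>R cis (- (t * x)))" for t :: real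
  unfolding fourier_def by (simp add: inner_real_def)

lemma set_integral_iexp:
  fixes a b t :: real
  assumes "a \<le> b" "t \<noteq> 0"
  shows "(LINT x|lborel. indicator {a<..b} x *\<^sub>R iexp (- (t * x))) = (iexp (- (t * a)) - iexp (- (t * b))) / (\<i> * t)"
proof -
  have "(LBINT x=a..b. iexp (- (t * x))) = (\<i> / t) * iexp (- (t * b)) - (\<i> / t) * iexp (- (t * a))"
    using assms
    by (subst interval_integral_FTC_finite [where F = "\<lambda>x. (\<i> / t) * iexp (- (t * x))"])
       (auto intro!: continuous_intros derivative_eq_intros simp: has_vector_derivative_complex_iff Re_exp Im_exp field_simps Re_divide Im_divide power2_eq_square)
  also have "\<dots> = (iexp (- (t * a)) - iexp (- (t * b))) / (\<i> * t)"
    using assms(2) by (simp add: field_simps)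
  finally show ?thesis
    using assms(1) by (subst (asm) interval_integral_Ioc) (auto simp: set_lebesgue_integral_def)
qed

locale positive_fourier_density =
  fixes k :: "real \<Rightarrow> real"
  assumes k_sym: "\<And>x. k (- x) = k x"
    and k_nonneg: "\<And>x. 0 \<le> k x"
    and k_int: "integrable lborel k"
    and k_one: "(LINT x|lborel. k x) = 1"
    and F_pos: "\<And>t. Im (fourier k t) = 0 \<and> 0 < Re (fourier k t)"
    and F_int: "integrable lborel (fourier k)"
begin

definition \<kappa> :: "real \<Rightarrow> real" where "\<kappa> t = Re (fourier k t)"
text \<open>The Fourier inversion integral of \<open>\<kappa>\<close>, which turns out to be the
  continuous representative of \<open>k\<close>. Since \<open>k\<close> is determined only up to a
  null set, its size near 0 and its inversion formula are obtained through \<open>g\<close>.\<close>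

definition g :: "real \<Rightarrow> real" where "g x = (LINT t|lborel. \<kappa> t * cos (t * x)) / (2 * pi)"

lemma fourier_eq: "fourier k t = of_real (\<kappa> t)"
  using F_pos[of t] unfolding \<kappa>_def by (simp add: complex_eq_iff)

lemma \<kappa>_pos: "0 < \<kappa> t" using F_pos[of t] unfolding \<kappa>_def by simp

lemma k_meas[measurable]: "k \<in> borel_measurable borel"
  using k_int by simp

lemma \<kappa>_int: "integrable lborel \<kappa>"
  unfolding \<kappa>_def[abs_def] using F_int by (rule integrable_Re)

lemma \<kappa>_meas[measurable]: "\<kappa> \<in> borel_measurable borel"
  using \<kappa>_int by simp

lemma \<kappa>_le_1: "\<kappa> t \<le> 1"
proof -
  have "\<kappa> t \<le> norm (fourier k t)" unfolding fourier_eq by simp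
  also have "\<dots> \<le> (LINT x|lborel. k x)"
    unfolding fourier_real using k_int k_nonneg
    by (intro norm_integral_le_AE) (auto simp: cis_conv_exp)
  finally show ?thesis by (simp add: k_one)
qed

lemma fourier_minus: "fourier k (- t) = fourier k t"
proof -
  have "fourier k (- t) = cnj (fourier k t)"
    unfolding fourier_real by (subst Bochner_Integration.integral_cnj[symmetric]) (simp add: cis_cnj del: Bochner_Integration.integral_cnj)
  then show ?thesis by (simp add: fourier_eq)
qed

lemma \<kappa>_even: "\<kappa> (- t) = \<kappa> t" unfolding \<kappa>_def fourier_minus ..

lemma \<kappa>_cis_int: "integrable lborel (\<lambda>t. \<kappa> t *\<^sub>R cis (t * x))"
  by (rule Bochner_Integration.integrable_bound[OF \<kappa>_int]) (auto simp: cis_conv_exp)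

text \<open>As \<open>\<kappa>\<close> is even, the substitution of -t for t shows that the integral
  equals its own conjugate.\<close>

lemma g_cis: "(LINT t|lborel. \<kappa> t *\<^sub>R cis (t * x)) = of_real (2 * pi * g x)"
proof -
  have "(LINT t|lborel. \<kappa> t *\<^sub>R cis (t * x)) = (LINT t|lborel. \<kappa> (- t) *\<^sub>R cis (- t * x))"
    using lborel_integral_real_affine[of "-1" "\<lambda>t. \<kappa> t *\<^sub>R cis (t * x)" 0] by simp
  also have "\<dots> = cnj (LINT t|lborel. \<kappa> t *\<^sub>R cis (t * x))"
    by (subst Bochner_Integration.integral_cnj[symmetric]) (simp add: \<kappa>_even cis_cnj del: Bochner_Integration.integral_cnj)
  finally have im: "Im (LINT t|lborel. \<kappa> t *\<^sub>R cis (t * x)) = 0"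
    by (simp add: complex_eq_iff)
  have "Re (LINT t|lborel. \<kappa> t *\<^sub>R cis (t * x)) = (LINT t|lborel. \<kappa> t * cos (t * x))"
    using integral_Re[OF \<kappa>_cis_int] by simp
  then show ?thesis using im by (simp add: g_def complex_eq_iff)
qed

lemma g_cont: "isCont g x"
proof -
  have "isCont (\<lambda>x. LINT t|lborel. \<kappa> t * cos (t * x)) x"
    unfolding isCont_def
  proof (rule tendsto_at_iff_sequentially[THEN iffD2], intro allI impI)
    fix X :: "nat \<Rightarrow> real" assume X: "\<forall>i. X i \<in> UNIV - {x}" "X \<longlonglongrightarrow> x"
    have "(\<lambda>i. LINT t|lborel. \<kappa> t * cos (t * X i)) \<longlonglongrightarrow> (LINT t|lborel. \<kappa> t * cos (t * x))"
    proof (rule integral_dominated_convergence[where w = \<kappa>])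
      show "AE t in lborel. (\<lambda>i. \<kappa> t * cos (t * X i)) \<longlonglongrightarrow> \<kappa> t * cos (t * x)"
        by (intro AE_I2 tendsto_intros X)
      show "AE t in lborel. norm (\<kappa> t * cos (t * X i)) \<le> \<kappa> t" for i
        using \<kappa>_pos by (intro AE_I2) (auto simp: abs_mult mult_left_le less_imp_le)
    qed (use \<kappa>_int in auto)
    then show "((\<lambda>x. LINT t|lborel. \<kappa> t * cos (t * x)) \<circ> X) \<longlonglongrightarrow> (LINT t|lborel. \<kappa> t * cos (t * x))"
      by (simp add: comp_def)
  qed
  then show ?thesis unfolding g_def[abs_def] by (intro continuous_intros) auto
qed

lemma g_meas[measurable]: "g \<in> borel_measurable borel"
  by (intro borel_measurable_continuous_onI continuous_at_imp_continuous_on) (auto simp: g_cont)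

lemma g_0_pos: "0 < g 0"
proof -
  have "0 \<le> (LINT t|lborel. \<kappa> t)" using \<kappa>_pos by (intro Bochner_Integration.integral_nonneg) (auto simp: less_imp_le)
  moreover have "(LINT t|lborel. \<kappa> t) \<noteq> 0"
  proof
    assume "(LINT t|lborel. \<kappa> t) = 0"
    then have "AE t in lborel. \<kappa> t = 0"
      using \<kappa>_pos by (subst (asm) integral_nonneg_eq_0_iff_AE) (auto simp: less_imp_le \<kappa>_int)
    then have "AE t::real in lborel. False" by eventually_elim (metis \<kappa>_pos less_irrefl)
    then show False by (simp add: ae_filter_eq_bot_iff)
  qed
  ultimately show ?thesis unfolding g_def by simp
qed

definition N :: "real measure" where "N = density lborel (\<lambda>x. ennreal (k x))"

lemma N_distr: "real_distribution N"
proof -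
  have "emeasure N UNIV = ennreal (LINT x|lborel. k x)"
    unfolding N_def using k_int k_nonneg by (simp add: emeasure_density nn_integral_eq_integral)
  then have "prob_space N" by (intro prob_spaceI) (simp add: N_def k_one)
  then show ?thesis unfolding real_distribution_def real_distribution_axioms_def by (simp add: N_def)
qed

lemma char_N: "char N t = of_real (\<kappa> t)"
proof -
  have "char N t = (LINT x|lborel. k x *\<^sub>R cis (t * x))"
    unfolding char_def N_def using k_nonneg
    by (subst integral_density) (auto simp: cis_conv_exp)
  also have "\<dots> = fourier k (- t)" unfolding fourier_real by simp
  finally show ?thesis by (simp only: fourier_eq \<kappa>_even)
qed

lemma N_singleton: "measure N {x} = 0"
proof -
  have "emeasure N {x} = (\<integral>\<^sup>+y. ennreal (k y) * indicator {x} y \<partial>lborel)"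
    unfolding N_def by (rule emeasure_density) auto
  also have "\<dots> = 0" by (subst nn_integral_0_iff_AE) (auto intro!: AE_I[where N = "{x}"])
  finally show ?thesis by (simp add: measure_def)
qed

text \<open>Levy's inversion gives the mass of (a, b] as a limit of truncated integrals.
  Integrability of \<open>\<kappa>\<close> turns the limit into one absolutely convergent integral,
  and Fubini then moves the transform from the indicator of (a, b] to
  \<open>\<kappa>\<close>.\<close>

lemma N_Ioc:
  assumes ab: "a \<le> b"
  shows "measure N {a<..b} = (LINT x|lborel. indicator {a<..b} x * g x)" (is ?eq)
    and "integrable lborel (\<lambda>x. indicator {a<..b} x * g x)" (is ?int)
proof -
  interpret N: real_distribution N by (rule N_distr)
  \<comment> \<open>For t \<noteq> 0 this is the integral of exp(-itx) over (a, b], whence the bound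
    b - a that dominates the integrand.\<close>
  define F where "F t = (iexp (- (t * a)) - iexp (- (t * b))) / (\<i> * t)" for t :: real
  define f where "f x t = indicator {a<..b} x *\<^sub>R (\<kappa> t *\<^sub>R iexp (- (t * x)))" for x t :: real
  have [measurable]: "F \<in> borel_measurable borel" unfolding F_def[abs_def] by measurable
  have F_le: "norm (F t) \<le> b - a" if "t \<noteq> 0" for t
    using Levy_Inversion_aux2[of "-b" "-a" t] ab that unfolding F_def by simp
  have Fk_int: "integrable lborel (\<lambda>t. F t * \<kappa> t)"
  proof (rule Bochner_Integration.integrable_bound)
    show "integrable lborel (\<lambda>t. (b - a) * \<kappa> t)" using \<kappa>_int by simp
    have "AE t::real in lborel. t \<noteq> 0" by (rule AE_lborel_singleton)
    then show "AE t in lborel. norm (F t * \<kappa> t) \<le> norm ((b - a) * \<kappa> t)"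
      by eventually_elim (use F_le ab \<kappa>_pos in \<open>auto simp: norm_mult abs_mult intro!: mult_right_mono\<close>)
  qed auto
  define L where "L T = (CLBINT t=-T..T. F t * char N t)" for T :: nat
  have "(\<lambda>T. 1 / (2 * pi) * L T) \<longlonglongrightarrow> of_real (measure N {a<..b})"
    unfolding F_def L_def using N.Levy_Inversion[OF ab] N_singleton by simp
  moreover have "(\<lambda>T. 1 / (2 * pi) * L T) \<longlonglongrightarrow> 1 / (2 * pi) * (LINT t|lborel. F t * \<kappa> t)"
  proof (rule tendsto_mult_left)
    have "(\<lambda>T::nat. LINT t|lborel. indicator {-real T<..<real T} t *\<^sub>R (F t * \<kappa> t)) \<longlonglongrightarrow> (LINT t|lborel. F t * \<kappa> t)"
    proof (rule integral_dominated_convergence[where w = "\<lambda>t. norm (F t * \<kappa> t)"])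
      show "AE t in lborel. (\<lambda>T::nat. indicator {-real T<..<real T} t *\<^sub>R (F t * \<kappa> t)) \<longlonglongrightarrow> F t * \<kappa> t"
      proof (rule AE_I2)
        fix t :: real
        obtain n where n: "\<bar>t\<bar> < real n" using reals_Archimedean2 by blast
        have "\<forall>\<^sub>F T in sequentially. indicator {-real T<..<real T} t *\<^sub>R (F t * \<kappa> t) = F t * \<kappa> t"
          using eventually_ge_at_top[of n] by eventually_elim (use n in \<open>auto simp: indicator_def abs_less_iff\<close>)
        then show "(\<lambda>T::nat. indicator {-real T<..<real T} t *\<^sub>R (F t * \<kappa> t)) \<longlonglongrightarrow> F t * \<kappa> t"
          by (rule tendsto_eventually)
      qed
      show "AE t in lborel. norm (indicator {-real T<..<real T} t *\<^sub>R (F t * \<kappa> t)) \<le> norm (F t * \<kappa> t)" for T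
        by (intro AE_I2) (auto simp: indicator_def)
    qed (use Fk_int in auto)
    moreover have "L = (\<lambda>T. LINT t|lborel. indicator {-real T<..<real T} t *\<^sub>R (F t * \<kappa> t))"
      unfolding L_def[abs_def] char_N interval_lebesgue_integral_def set_lebesgue_integral_def
      by (auto simp: einterval_eq)
    ultimately show "L \<longlonglongrightarrow> (LINT t|lborel. F t * \<kappa> t)" by simp
  qed
  ultimately have m: "of_real (measure N {a<..b}) = 1 / (2 * pi) * (LINT t|lborel. F t * \<kappa> t)"
    by (rule LIMSEQ_unique)
  have f_int: "integrable (lborel \<Otimes>\<^sub>M lborel) (\<lambda>(x, t). f x t)"
  proof (rule lborel_pair.Fubini_integrable)
    show "(\<lambda>(x, t). f x t) \<in> borel_measurable (lborel \<Otimes>\<^sub>M lborel)"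
      unfolding f_def[abs_def] by measurable
    have "(LINT t|lborel. norm (case (x, t) of (x, t) \<Rightarrow> f x t)) = indicator {a<..b} x * (LINT t|lborel. \<kappa> t)" for x
      unfolding f_def using \<kappa>_pos by (simp add: less_imp_le norm_mult)
    then show "integrable lborel (\<lambda>x. LINT t|lborel. norm (case (x, t) of (x, t) \<Rightarrow> f x t))"
      using ab by simp
    show "AE x in lborel. integrable lborel (\<lambda>t. case (x, t) of (x, t) \<Rightarrow> f x t)"
    proof (rule AE_I2)
      fix x :: real
      show "integrable lborel (\<lambda>t. case (x, t) of (x, t) \<Rightarrow> f x t)"
        unfolding f_def prod.case using \<kappa>_cis_int[of "- x"]
        by (intro integrable_scaleR_right) (simp add: cis_conv_exp)
    qed
  qed
  have inner_t: "(LINT t|lborel. f x t) = of_real (2 * pi * (indicator {a<..b} x * g x))" for x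
  proof -
    have "(LINT t|lborel. f x t) = indicator {a<..b} x *\<^sub>R (LINT t|lborel. \<kappa> t *\<^sub>R cis (t * (- x)))"
      unfolding f_def integral_scaleR_right by (simp add: cis_conv_exp)
    also have "\<dots> = of_real (2 * pi * (indicator {a<..b} x * g (- x)))"
      unfolding g_cis by (simp add: scaleR_conv_of_real)
    also have "g (- x) = g x" unfolding g_def by simp
    finally show ?thesis .
  qed
  have inner_x: "AE t in lborel. (LINT x|lborel. f x t) = F t * \<kappa> t"
    using AE_lborel_singleton[of 0]
  proof eventually_elim
    case (elim t)
    have "(LINT x|lborel. f x t) = (LINT x|lborel. (indicator {a<..b} x *\<^sub>R iexp (- (t * x))) * \<kappa> t)"
      unfolding f_def by (intro Bochner_Integration.integral_cong) (auto simp: indicator_def scaleR_conv_of_real)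
    also have "\<dots> = F t * \<kappa> t"
      unfolding integral_mult_left_zero set_integral_iexp[OF ab elim] F_def ..
    finally show ?case .
  qed
  have int1: "integrable lborel (\<lambda>x. LINT t|lborel. f x t)"
    using lborel_pair.integrable_fst'[OF f_int] by simp
  then have "integrable lborel (\<lambda>x. 2 * pi * (indicator {a<..b} x * g x))"
    unfolding inner_t complex_of_real_integrable_eq .
  then show ?int by simp
  have "(LINT t|lborel. F t * \<kappa> t) = (LINT t|lborel. LINT x|lborel. f x t)"
    using inner_x by (intro integral_cong_AE) (auto simp: f_def)
  also have "\<dots> = (LINT x|lborel. LINT t|lborel. f x t)"
    using lborel_pair.Fubini_integral[of "\<lambda>x t. f x t"] f_int by simp
  also have "\<dots> = of_real (2 * pi * (LINT x|lborel. indicator {a<..b} x * g x))"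
    unfolding inner_t integral_complex_of_real by simp
  finally have "of_real (measure N {a<..b}) = complex_of_real (LINT x|lborel. indicator {a<..b} x * g x)"
    unfolding m by simp
  then show ?eq by (simp only: of_real_eq_iff)
qed

text \<open>By continuity a negative value would persist on an interval to the right of
  \<open>x\<close>, and by \<open>N_Ioc\<close> that interval would have negative mass.\<close>

lemma g_nonneg: "0 \<le> g x"
proof (rule ccontr)
  assume "\<not> 0 \<le> g x"
  then have neg: "g x < 0" by simp
  have "\<forall>\<^sub>F y in at x. g y < 0"
    using g_cont[of x] neg unfolding isCont_def by (rule order_tendstoD(2))
  then obtain d where d: "0 < d" "\<And>y. y \<noteq> x \<Longrightarrow> dist y x < d \<Longrightarrow> g y < 0"
    unfolding eventually_at by auto
  have neg': "g y < 0" if "y \<in> {x<..x + d/2}" for y using d that by (auto simp: dist_real_def)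
  let ?A = "{x<..x + d/2}"
  have A: "x \<le> x + d/2" using d by simp
  note N = N_Ioc[OF A]
  have "(LINT y|lborel. indicator ?A y * - g y) \<le> 0"
    using N(1) measure_nonneg[of N ?A] by simp
  moreover have nn: "0 \<le> indicator ?A y * - g y" for y using neg' by (auto simp: indicator_def less_imp_le)
  ultimately have "(LINT y|lborel. indicator ?A y * - g y) = 0"
    using Bochner_Integration.integral_nonneg[of lborel "\<lambda>y. indicator ?A y * - g y"] by simp
  then have "AE y in lborel. indicator ?A y * - g y = 0"
    using N(2) nn by (subst (asm) integral_nonneg_eq_0_iff_AE) auto
  then have "AE y in lborel. y \<notin> ?A" by eventually_elim (use neg' in \<open>force simp: indicator_def\<close>)
  then have "?A \<in> null_sets lborel" by (subst AE_iff_null_sets) auto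
  then show False using d by (simp add: null_sets_def)
qed

text \<open>Half-open intervals are stable under intersection and generate the Borel sets, so
  \<open>N\<close> has both \<open>k\<close> and \<open>g\<close> as densities; nonnegativity of
  \<open>g\<close> is what allows it to be one.\<close>

lemma k_eq_g: "AE x in lborel. k x = g x"
proof -
  interpret N: real_distribution N by (rule N_distr)
  have "N = density lborel (\<lambda>x. ennreal (g x))"
  proof (rule measure_eqI_generator_eq[where E = "range (\<lambda>(a, b). {a<..b::real})" and \<Omega> = UNIV and A = "\<lambda>n. {- real n<..real n}"])
    show "Int_stable (range (\<lambda>(a, b). {a<..b::real}))"
      by (auto simp: Int_stable_def Int_greaterThanAtMost)
    show "sets N = sigma_sets UNIV (range (\<lambda>(a, b). {a<..b::real}))"
      unfolding N_def by (simp add: borel_sigma_sets_Ioc)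
    show "sets (density lborel (\<lambda>x. ennreal (g x))) = sigma_sets UNIV (range (\<lambda>(a, b). {a<..b::real}))"
      by (simp add: borel_sigma_sets_Ioc)
    fix X :: "real set" assume "X \<in> range (\<lambda>(a, b). {a<..b})"
    then obtain a b where X: "X = {a<..b}" by auto
    show "emeasure N X = emeasure (density lborel (\<lambda>x. ennreal (g x))) X"
    proof (cases "a \<le> b")
      case True
      have "emeasure (density lborel (\<lambda>x. ennreal (g x))) X = (\<integral>\<^sup>+x. ennreal (indicator X x * g x) \<partial>lborel)"
        unfolding X by (subst emeasure_density) (auto intro!: nn_integral_cong simp: indicator_def)
      also have "\<dots> = ennreal (LINT x|lborel. indicator X x * g x)"
        unfolding X using N_Ioc(2)[OF True] g_nonneg by (intro nn_integral_eq_integral) auto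
      also have "\<dots> = emeasure N X" unfolding X N_Ioc(1)[OF True, symmetric] N.emeasure_eq_measure ..
      finally show ?thesis ..
    qed (simp add: X)
  next
    show "(\<Union>i. {- real i<..real i}) = UNIV"
    proof safe
      fix x :: real
      obtain n where "\<bar>x\<bar> < real n" using reals_Archimedean2 by blast
      then show "x \<in> (\<Union>i. {- real i<..real i})" by (auto intro!: exI[of _ n])
    qed auto
  qed (auto simp: N.emeasure_eq_measure)
  then have "AE x in lborel. ennreal (k x) = ennreal (g x)"
    unfolding N_def by (intro sigma_finite_measure.density_unique[OF sigma_finite_lborel]) auto
  then show ?thesis by eventually_elim (use k_nonneg g_nonneg in auto)
qed

end

section \<open>Product kernels on Euclidean space\<close>

lemma integrable_lborel_prod:
  fixes F :: "'e::euclidean_space \<Rightarrow> real \<Rightarrow> 'c::{real_normed_field, banach, second_countable_topology}"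
  assumes F: "\<And>b. b \<in> Basis \<Longrightarrow> integrable lborel (F b)"
  shows "integrable lborel (\<lambda>t::'e. \<Prod>b\<in>Basis. F b (t \<bullet> b))"
    and "(LINT t|lborel. (\<Prod>b\<in>Basis. F b (t \<bullet> b))) = (\<Prod>b\<in>Basis. LINT x|lborel. F b x)"
proof -
  interpret product_sigma_finite "\<lambda>_::'e. lborel :: real measure" ..
  have [measurable]: "F b \<in> borel_measurable borel" if "b \<in> Basis" for b using F[OF that] by simp
  have m: "(\<lambda>f. \<Sum>b\<in>Basis. f b *\<^sub>R b) \<in> measurable (\<Pi>\<^sub>M b\<in>(Basis::'e set). lborel) borel" by measurable
  have m2: "(\<lambda>t::'e. \<Prod>b\<in>Basis. F b (t \<bullet> b)) \<in> borel_measurable borel"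
    by (intro borel_measurable_prod) measurable
  have eq: "(\<Prod>b\<in>Basis. F b ((\<Sum>b'\<in>Basis. f b' *\<^sub>R b') \<bullet> b)) = (\<Prod>b\<in>Basis. F b (f b))" for f :: "'e \<Rightarrow> real"
    by (intro prod.cong) auto
  have "integrable (\<Pi>\<^sub>M b\<in>(Basis::'e set). lborel) (\<lambda>f. \<Prod>b\<in>Basis. F b (f b))"
    by (rule product_integrable_prod) (use F in auto)
  then show "integrable lborel (\<lambda>t::'e. \<Prod>b\<in>Basis. F b (t \<bullet> b))"
    unfolding lborel_eq[where 'a = 'e] by (subst integrable_distr_eq[OF m m2]) (simp add: eq)
  show "(LINT t|lborel. (\<Prod>b\<in>Basis. F b ((t::'e) \<bullet> b))) = (\<Prod>b\<in>Basis. LINT x|lborel. F b x)"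
    unfolding lborel_eq[where 'a = 'e] integral_distr[OF m m2] eq
    by (rule product_integral_prod) (use F in auto)
qed

text \<open>A cylinder over a null set is null, since its measure is a product of one-dimensional
  integrals with one factor zero.\<close>

lemma AE_lborel_coordinate:
  fixes b :: "'e::euclidean_space"
  assumes b: "b \<in> Basis" and P: "AE x in lborel. P (x::real)"
  shows "AE z in lborel. P (z \<bullet> b)"
proof -
  from P obtain N where N: "N \<in> null_sets lborel" "{x \<in> space lborel. \<not> P x} \<subseteq> N"
    by (auto elim!: AE_E3 simp: null_sets_def eventually_ae_filter)
  then have [measurable]: "N \<in> sets borel" by auto
  let ?f = "\<lambda>b' x. if b' = b then indicator N x else 1 :: ennreal"
  have "(\<integral>\<^sup>+z. (\<Prod>b'\<in>Basis. ?f b' (z \<bullet> b')) \<partial>lborel) = (\<Prod>b'\<in>Basis. \<integral>\<^sup>+x. ?f b' x \<partial>lborel)"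
    by (rule nn_integral_lborel_prod) auto
  also have "\<dots> = 0"
    using b N(1) by (intro prod_zero) (auto intro!: bexI[of _ b] simp: null_sets_def)
  finally have "AE z in lborel. (\<Prod>b'\<in>Basis. ?f b' ((z::'e) \<bullet> b')) = 0"
    by (subst (asm) nn_integral_0_iff_AE) (auto intro!: borel_measurable_prod)
  then show ?thesis
  proof eventually_elim
    case (elim z)
    then have "z \<bullet> b \<notin> N" by (auto simp: indicator_def split: if_splits)
    then show ?case using N(2) by auto
  qed
qed

lemma AE_lborel_affine:
  fixes t :: "'e::euclidean_space"
  assumes "c \<noteq> 0" and [measurable]: "Measurable.pred borel P" and "AE x in lborel. P x"
  shows "AE x in lborel. P (t + c *\<^sub>R x)"
proof -
  have "AE x in density (distr lborel borel (\<lambda>x. t + c *\<^sub>R x)) (\<lambda>_. \<bar>c\<bar> ^ DIM('e)). P x"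
    by (simp only: lborel_affine[OF assms(1), of t, symmetric] assms(3))
  then show ?thesis
    using assms(1) by (simp add: AE_density AE_distr_iff)
qed

lemma lborel_integral_scale:
  fixes \<phi> :: "'e::euclidean_space \<Rightarrow> real"
  assumes h: "0 < h" and \<phi>: "integrable lborel \<phi>"
  shows "integrable lborel (\<lambda>t. \<phi> (t /\<^sub>R h))" and "(LINT t|lborel. \<phi> (t /\<^sub>R h)) = h ^ DIM('e) * (LINT t|lborel. \<phi> t)"
proof -
  have [measurable]: "\<phi> \<in> borel_measurable borel" using \<phi> by simp
  have l: "lborel = density (distr lborel borel (\<lambda>x::'e. h *\<^sub>R x)) (\<lambda>_. ennreal (h ^ DIM('e)))"
    using lborel_affine[of h "0::'e"] h by (simp add: ennreal_power)
  show "integrable lborel (\<lambda>t. \<phi> (t /\<^sub>R h))"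
    using h \<phi> by (subst l, subst integrable_density) (auto simp: integrable_distr_eq)
  show "(LINT t|lborel. \<phi> (t /\<^sub>R h)) = h ^ DIM('e) * (LINT t|lborel. \<phi> t)"
    using h by (subst l, subst integral_density) (auto simp: integral_distr)
qed

lemma cis_inner: "cis (t \<bullet> z) = (\<Prod>b\<in>Basis. cis ((t \<bullet> b) * (z \<bullet> b)))"
  unfolding euclidean_inner[of t z] cis_conv_exp by (simp add: exp_sum sum_distrib_left)

context positive_fourier_density
begin

definition kE :: "'e::euclidean_space \<Rightarrow> real" where "kE z = (\<Prod>b\<in>Basis. k (z \<bullet> b))"
definition gE :: "'e::euclidean_space \<Rightarrow> real" where "gE z = (\<Prod>b\<in>Basis. g (z \<bullet> b))"
definition \<kappa>E :: "'e::euclidean_space \<Rightarrow> real" where "\<kappa>E t = (\<Prod>b\<in>Basis. \<kappa> (t \<bullet> b))"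

lemma kE_meas[measurable]: "kE \<in> borel_measurable borel"
  unfolding kE_def[abs_def] by measurable
lemma gE_meas[measurable]: "gE \<in> borel_measurable borel"
  unfolding gE_def[abs_def] by measurable
lemma \<kappa>E_meas[measurable]: "\<kappa>E \<in> borel_measurable borel"
  unfolding \<kappa>E_def[abs_def] by measurable

lemma kE_nonneg: "0 \<le> kE z" unfolding kE_def by (intro prod_nonneg) (auto simp: k_nonneg)
lemma \<kappa>E_nonneg: "0 \<le> \<kappa>E z" unfolding \<kappa>E_def by (intro prod_nonneg) (auto simp: \<kappa>_pos less_imp_le)
lemma \<kappa>E_le_1: "\<kappa>E z \<le> 1" unfolding \<kappa>E_def by (intro prod_le_1) (auto simp: \<kappa>_pos less_imp_le \<kappa>_le_1)
lemma kE_minus: "kE (- z) = kE z" unfolding kE_def by (simp add: k_sym)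

lemma kE_int: "integrable lborel kE" and kE_one: "(LINT z|lborel. kE z) = 1"
  unfolding kE_def[abs_def] using integrable_lborel_prod[of "\<lambda>_. k"] k_int k_one by auto

lemma \<kappa>E_int: "integrable lborel \<kappa>E"
  unfolding \<kappa>E_def[abs_def] by (rule integrable_lborel_prod(1)[of "\<lambda>_. \<kappa>"]) (rule \<kappa>_int)

lemma gE_cis: "(LINT t|lborel. \<kappa>E t *\<^sub>R cis (t \<bullet> z)) = of_real ((2 * pi) ^ DIM('e) * gE z)" for z :: "'e::euclidean_space"
proof -
  have "(LINT t|lborel. \<kappa>E t *\<^sub>R cis (t \<bullet> z)) = (LINT t|lborel. (\<Prod>b\<in>Basis. \<kappa> (t \<bullet> b) *\<^sub>R cis ((t \<bullet> b) * (z \<bullet> b))))"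
    unfolding \<kappa>E_def cis_inner by (simp add: scaleR_conv_of_real prod.distrib)
  also have "\<dots> = (\<Prod>b\<in>Basis. LINT t|lborel. \<kappa> t *\<^sub>R cis (t * (z \<bullet> b)))"
    by (rule integrable_lborel_prod(2)) (rule \<kappa>_cis_int)
  also have "\<dots> = of_real (\<Prod>b\<in>Basis. (2 * pi) * g (z \<bullet> b))"
    unfolding g_cis by simp
  also have "(\<Prod>b\<in>Basis. (2 * pi) * g (z \<bullet> b)) = (2 * pi) ^ DIM('e) * gE z"
    unfolding gE_def prod.distrib by simp
  finally show ?thesis .
qed

lemma kE_eq_gE: "AE z in lborel. kE (z::'e::euclidean_space) = gE z"
proof -
  have "AE z in lborel. \<forall>b\<in>Basis. k ((z::'e) \<bullet> b) = g (z \<bullet> b)"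
    using AE_lborel_coordinate[OF _ k_eq_g] by (intro AE_finite_allI) auto
  then show ?thesis by eventually_elim (simp add: kE_def gE_def)
qed

text \<open>Continuity keeps \<open>g\<close> above half of its positive value at 0, and every
  coordinate of a point is bounded by its norm, so each factor of the product is bounded below. The
  bound reaches \<open>kE\<close> almost everywhere through \<open>gE\<close>.\<close>

lemma kE_ge_near_0:
  obtains r \<delta> where "0 < r" "0 < \<delta>" "AE z in lborel. norm (z::'e::euclidean_space) \<le> r \<longrightarrow> \<delta> \<le> kE z"
proof -
  have "\<forall>\<^sub>F x in at 0. g 0 / 2 < g x"
    using g_cont[of 0] g_0_pos unfolding isCont_def by (intro order_tendstoD(1)) auto
  then obtain d where d: "0 < d" "\<And>y. y \<noteq> 0 \<Longrightarrow> dist y 0 < d \<Longrightarrow> g 0 / 2 < g y"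
    unfolding eventually_at by auto
  have g: "g 0 / 2 \<le> g y" if "\<bar>y\<bar> \<le> d / 2" for y
    using d that g_0_pos by (cases "y = 0") (auto intro!: less_imp_le)
  have "AE z in lborel. norm (z::'e) \<le> d / 2 \<longrightarrow> (g 0 / 2) ^ DIM('e) \<le> kE z"
    using kE_eq_gE
  proof eventually_elim
    case (elim z)
    show ?case
    proof
      assume z: "norm z \<le> d / 2"
      have "(\<Prod>b\<in>(Basis :: 'e set). g 0 / 2) \<le> gE z"
        unfolding gE_def
      proof (intro prod_mono conjI)
        fix b :: 'e assume b: "b \<in> Basis"
        show "0 \<le> g 0 / 2" using g_0_pos by simp
        have "\<bar>z \<bullet> b\<bar> \<le> norm z" using Basis_le_norm[OF b] .
        then show "g 0 / 2 \<le> g (z \<bullet> b)" using z by (intro g) simp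
      qed
      then show "(g 0 / 2) ^ DIM('e) \<le> kE z" using elim by simp
    qed
  qed
  then show thesis using that[of "d / 2" "(g 0 / 2) ^ DIM('e)"] d(1) g_0_pos by simp
qed

end

section \<open>Fourier representation of a smoothed density\<close>

locale smoothed_density = positive_fourier_density +
  fixes f :: "'e::euclidean_space \<Rightarrow> real"
  assumes f_nonneg: "\<And>x. 0 \<le> f x" and f_int: "integrable lborel f" and f_one: "(LINT x|lborel. f x) = 1"
begin

lemma f_meas[measurable]: "f \<in> borel_measurable borel" using f_int by simp

lemma fourier_meas[measurable]: "fourier f \<in> borel_measurable borel"
  unfolding fourier_def[abs_def] cis_conv_exp by measurable

lemma fourier_le_1: "norm (fourier f t) \<le> 1"
proof -
  have "norm (fourier f t) \<le> (LINT x|lborel. f x)"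
    unfolding fourier_def using f_int f_nonneg
    by (intro norm_integral_le_AE) (auto simp: cis_conv_exp)
  then show ?thesis by (simp add: f_one)
qed

text \<open>The mean of K((z - Z) / h), without the factor h^-q; for a bounded density it is of
  order h^q.\<close>

definition conv :: "real \<Rightarrow> 'e \<Rightarrow> real" where
  "conv h z = (LINT x|lborel. f x * kE ((z - x) /\<^sub>R h))"

lemma conv_nonneg: "0 \<le> conv h z"
  unfolding conv_def by (intro Bochner_Integration.integral_nonneg) (auto simp: f_nonneg kE_nonneg)

lemma conv_meas[measurable]: "conv h \<in> borel_measurable borel"
  unfolding conv_def[abs_def] by measurable

text \<open>Under the integral \<open>kE\<close> may be replaced by \<open>gE\<close>, because null
  sets survive affine maps. Inserting the inversion formula and exchanging the integrals leaves the
  transform of \<open>f\<close> at t / h.\<close>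

lemma conv_fourier:
  assumes h: "0 < h"
  shows "of_real ((2 * pi) ^ DIM('e) * conv h z) = (LINT t|lborel. \<kappa>E t *\<^sub>R (cis (t \<bullet> (z /\<^sub>R h)) * fourier f (t /\<^sub>R h)))"
proof -
  have ae: "AE x in lborel. kE ((z - x) /\<^sub>R h) = gE ((z - x) /\<^sub>R h)"
    using AE_lborel_affine[of "- 1 / h" "\<lambda>x. kE x = gE x" "z /\<^sub>R h"] kE_eq_gE h
    by (simp add: scaleR_diff_right divide_inverse)
  let ?F = "\<lambda>x t. f x *\<^sub>R (\<kappa>E t *\<^sub>R cis (t \<bullet> ((z - x) /\<^sub>R h)))"
  have F_int: "integrable (lborel \<Otimes>\<^sub>M lborel) (\<lambda>(x, t). ?F x t)"
  proof (rule lborel_pair.Fubini_integrable)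
    show "(\<lambda>(x, t). ?F x t) \<in> borel_measurable (lborel \<Otimes>\<^sub>M lborel)"
      unfolding cis_conv_exp by measurable
    show "integrable lborel (\<lambda>x. LINT t|lborel. norm (case (x, t) of (x, t) \<Rightarrow> ?F x t))"
      using f_int f_nonneg \<kappa>E_nonneg by (simp add: cis_conv_exp abs_mult)
    show "AE x in lborel. integrable lborel (\<lambda>t. case (x, t) of (x, t) \<Rightarrow> ?F x t)"
    proof (rule AE_I2)
      fix x :: 'e
      have "integrable lborel (\<lambda>t. \<kappa>E t *\<^sub>R cis (t \<bullet> ((z - x) /\<^sub>R h)))"
        by (rule Bochner_Integration.integrable_bound[OF \<kappa>E_int]) (auto simp: cis_conv_exp)
      then show "integrable lborel (\<lambda>t. case (x, t) of (x, t) \<Rightarrow> ?F x t)"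
        unfolding prod.case by (rule integrable_scaleR_right)
    qed
  qed
  have "conv h z = (LINT x|lborel. f x * gE ((z - x) /\<^sub>R h))"
    unfolding conv_def using ae by (intro integral_cong_AE) auto
  then have "complex_of_real ((2 * pi) ^ DIM('e) * conv h z) = of_real (LINT x|lborel. (2 * pi) ^ DIM('e) * (f x * gE ((z - x) /\<^sub>R h)))"
    by simp
  also have "\<dots> = (LINT x|lborel. of_real ((2 * pi) ^ DIM('e) * (f x * gE ((z - x) /\<^sub>R h))))"
    by (rule integral_complex_of_real[symmetric])
  also have "\<dots> = (LINT x|lborel. LINT t|lborel. ?F x t)"
    unfolding integral_scaleR_right gE_cis by (simp add: scaleR_conv_of_real mult_ac)
  also have "\<dots> = (LINT t|lborel. LINT x|lborel. ?F x t)"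
    using lborel_pair.Fubini_integral[of ?F] F_int by simp
  also have "\<dots> = (LINT t|lborel. \<kappa>E t *\<^sub>R (cis (t \<bullet> (z /\<^sub>R h)) * fourier f (t /\<^sub>R h)))"
  proof (intro Bochner_Integration.integral_cong refl)
    fix t :: 'e
    have "?F x t = \<kappa>E t *\<^sub>R (cis (t \<bullet> (z /\<^sub>R h)) * (f x *\<^sub>R cis (- ((t /\<^sub>R h) \<bullet> x))))" for x
      by (simp add: scaleR_conv_of_real cis_mult inner_diff_right scaleR_diff_right)
    then show "(LINT x|lborel. ?F x t) = \<kappa>E t *\<^sub>R (cis (t \<bullet> (z /\<^sub>R h)) * fourier f (t /\<^sub>R h))"
      unfolding fourier_def by (simp only: integral_scaleR_right integral_mult_right_zero)
  qed
  finally show ?thesis .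
qed

lemma conv_le_fourier:
  assumes h: "0 < h"
  shows "conv h z \<le> (LINT t|lborel. \<kappa>E t * norm (fourier f (t /\<^sub>R h)))"
proof -
  have "integrable lborel (\<lambda>t. \<kappa>E t * norm (fourier f (t /\<^sub>R h)))"
    by (rule Bochner_Integration.integrable_bound[OF \<kappa>E_int])
       (auto simp: abs_mult \<kappa>E_nonneg mult_left_le fourier_le_1)
  then have le: "norm (LINT t|lborel. \<kappa>E t *\<^sub>R (cis (t \<bullet> (z /\<^sub>R h)) * fourier f (t /\<^sub>R h)))
    \<le> (LINT t|lborel. \<kappa>E t * norm (fourier f (t /\<^sub>R h)))"
    by (intro norm_integral_le_AE) (auto simp: norm_mult \<kappa>E_nonneg cis_conv_exp)
  have "1 * conv h z \<le> (2 * pi) ^ DIM('e) * conv h z"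
    using conv_nonneg pi_ge_two by (intro mult_right_mono one_le_power) auto
  also have "\<dots> \<le> norm (complex_of_real ((2 * pi) ^ DIM('e) * conv h z))"
    by (simp only: norm_of_real abs_ge_self)
  also have "\<dots> \<le> (LINT t|lborel. \<kappa>E t * norm (fourier f (t /\<^sub>R h)))"
    unfolding conv_fourier[OF h] by (rule le)
  finally show ?thesis by simp
qed

text \<open>A Plancherel identity up to the constant (2 pi)^d: integrating the phase in
  \<open>z\<close> against \<open>f\<close> gives the conjugate of the transform already present,
  hence its squared modulus.\<close>

lemma double_conv_le_fourier:
  assumes h: "0 < h"
  shows "(LINT z|lborel. f z * conv h z) \<le> (LINT t|lborel. \<kappa>E t * (norm (fourier f (t /\<^sub>R h)))\<^sup>2)"
proof -
  let ?F = "\<lambda>z t. f z *\<^sub>R (\<kappa>E t *\<^sub>R (cis (t \<bullet> (z /\<^sub>R h)) * fourier f (t /\<^sub>R h)))"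
  have i: "integrable lborel (\<lambda>t. \<kappa>E t * norm (fourier f (t /\<^sub>R h)))"
    by (rule Bochner_Integration.integrable_bound[OF \<kappa>E_int])
       (auto simp: abs_mult \<kappa>E_nonneg mult_left_le fourier_le_1)
  have F_int: "integrable (lborel \<Otimes>\<^sub>M lborel) (\<lambda>(z, t). ?F z t)"
  proof (rule lborel_pair.Fubini_integrable)
    show "(\<lambda>(x, t). ?F x t) \<in> borel_measurable (lborel \<Otimes>\<^sub>M lborel)"
      unfolding cis_conv_exp by measurable
    show "integrable lborel (\<lambda>x. LINT t|lborel. norm (case (x, t) of (x, t) \<Rightarrow> ?F x t))"
      using f_int f_nonneg \<kappa>E_nonneg by (simp add: cis_conv_exp norm_mult abs_mult mult.assoc)
    show "AE x in lborel. integrable lborel (\<lambda>t. case (x, t) of (x, t) \<Rightarrow> ?F x t)"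
    proof (rule AE_I2)
      fix x :: 'e
      have "integrable lborel (\<lambda>t. \<kappa>E t *\<^sub>R (cis (t \<bullet> (x /\<^sub>R h)) * fourier f (t /\<^sub>R h)))"
        by (rule Bochner_Integration.integrable_bound[OF i]) (auto simp: cis_conv_exp norm_mult)
      then show "integrable lborel (\<lambda>t. case (x, t) of (x, t) \<Rightarrow> ?F x t)"
        unfolding prod.case by (rule integrable_scaleR_right)
    qed
  qed
  have "complex_of_real ((2 * pi) ^ DIM('e) * (LINT z|lborel. f z * conv h z))
    = of_real (LINT z|lborel. f z * ((2 * pi) ^ DIM('e) * conv h z))"
    by (subst integral_mult_right_zero[symmetric]) (simp add: mult_ac)
  also have "\<dots> = (LINT z|lborel. of_real (f z * ((2 * pi) ^ DIM('e) * conv h z)))"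
    by (rule integral_complex_of_real[symmetric])
  also have "\<dots> = (LINT z|lborel. LINT t|lborel. ?F z t)"
    unfolding integral_scaleR_right conv_fourier[OF h, symmetric] by (simp add: scaleR_conv_of_real)
  also have "\<dots> = (LINT t|lborel. LINT z|lborel. ?F z t)"
    using lborel_pair.Fubini_integral[of ?F] F_int by simp
  also have "\<dots> = (LINT t|lborel. of_real (\<kappa>E t * (norm (fourier f (t /\<^sub>R h)))\<^sup>2))"
  proof (intro Bochner_Integration.integral_cong refl)
    fix t :: 'e
    have "?F z t = \<kappa>E t *\<^sub>R (fourier f (t /\<^sub>R h) * cnj (f z *\<^sub>R cis (- ((t /\<^sub>R h) \<bullet> z))))" for z
      by (simp add: scaleR_conv_of_real cis_cnj mult_ac)
    then have "(LINT z|lborel. ?F z t) = \<kappa>E t *\<^sub>R (fourier f (t /\<^sub>R h) * cnj (fourier f (t /\<^sub>R h)))"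
      unfolding fourier_def by (simp only: integral_scaleR_right integral_mult_right_zero Bochner_Integration.integral_cnj)
    then show "(LINT z|lborel. ?F z t) = of_real (\<kappa>E t * (norm (fourier f (t /\<^sub>R h)))\<^sup>2)"
      by (simp only: complex_norm_square[symmetric] scaleR_conv_of_real of_real_mult)
  qed
  also have "\<dots> = of_real (LINT t|lborel. \<kappa>E t * (norm (fourier f (t /\<^sub>R h)))\<^sup>2)"
    by (rule integral_complex_of_real)
  finally have eq: "(2 * pi) ^ DIM('e) * (LINT z|lborel. f z * conv h z) = (LINT t|lborel. \<kappa>E t * (norm (fourier f (t /\<^sub>R h)))\<^sup>2)"
    by (simp only: of_real_eq_iff)
  have "0 \<le> (LINT z|lborel. f z * conv h z)"
    by (intro Bochner_Integration.integral_nonneg) (auto simp: f_nonneg conv_nonneg)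
  then have "1 * (LINT z|lborel. f z * conv h z) \<le> (2 * pi) ^ DIM('e) * (LINT z|lborel. f z * conv h z)"
    using pi_ge_two by (intro mult_right_mono one_le_power) auto
  then show ?thesis unfolding eq by simp
qed

end

section \<open>Smoothing bounds\<close>

text \<open>Above the threshold \<open>c\<close> one has x^(r - 1) <= c^(r - 1), because r <= 1.
  This is how integrability of |F f|^(2 - r) controls an integral of the first power of |F f|
  against the integrable weight \<open>\<kappa>E\<close>.\<close>

lemma le_powr_interpolation:
  fixes x c r :: real
  assumes "0 \<le> x" "0 < c" "r \<le> 1"
  shows "x \<le> c + c powr (r - 1) * x powr (2 - r)"
proof (cases "x \<le> c")
  case True
  have "0 \<le> c powr (r - 1) * x powr (2 - r)" by simp
  with True show ?thesis by linarith
next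
  case False
  then have x: "c < x" "0 < x" using assms by auto
  have "x = x powr (r - 1) * x powr (2 - r)" using x by (simp flip: powr_add)
  also have "\<dots> \<le> c powr (r - 1) * x powr (2 - r)"
    using x assms by (intro mult_right_mono powr_mono2') auto
  finally show ?thesis using assms by linarith
qed

context smoothed_density
begin

lemma conv_bounds_bounded:
  assumes B: "\<And>x. f x \<le> B" and h: "0 < h"
  shows "conv h z \<le> B * h ^ DIM('e)"
proof -
  have kE': "integrable lborel (\<lambda>x. kE ((z - x) /\<^sub>R h))" "(LINT x|lborel. kE ((z - x) /\<^sub>R h)) = h ^ DIM('e)"
  proof -
    have i: "integrable lborel (\<lambda>t::'e. kE (t /\<^sub>R h))" "(LINT t|lborel. kE ((t::'e) /\<^sub>R h)) = h ^ DIM('e)"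
      using lborel_integral_scale[OF h kE_int] by (auto simp: kE_one)
    have l: "(lborel :: 'e measure) = distr lborel borel (\<lambda>x. z + (- 1) *\<^sub>R x)"
      using lborel_affine[of "-1" z] by (simp add: density_1)
    have m: "(\<lambda>x. kE (x /\<^sub>R h)) \<in> borel_measurable borel" by measurable
    have "integrable (distr lborel borel (\<lambda>x. z + (- 1) *\<^sub>R x)) (\<lambda>t::'e. kE (t /\<^sub>R h))"
      using i(1) by (simp only: l[symmetric])
    then show "integrable lborel (\<lambda>x. kE ((z - x) /\<^sub>R h))"
      by (subst (asm) integrable_distr_eq) auto
    have "(LINT t|distr lborel borel (\<lambda>x. z + (- 1) *\<^sub>R x). kE ((t::'e) /\<^sub>R h)) = h ^ DIM('e)"
      using i(2) by (simp only: l[symmetric])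
    then show "(LINT x|lborel. kE ((z - x) /\<^sub>R h)) = h ^ DIM('e)"
      by (subst (asm) integral_distr) auto
  qed
  have le: "norm (f x * kE ((z - x) /\<^sub>R h)) \<le> B * kE ((z - x) /\<^sub>R h)" for x
    using f_nonneg[of x] B[of x] kE_nonneg[of "(z - x) /\<^sub>R h"] by (simp add: abs_mult mult_right_mono)
  have "norm (conv h z) \<le> (LINT x|lborel. B * kE ((z - x) /\<^sub>R h))"
    unfolding conv_def using le kE'(1) by (intro norm_integral_le_AE) auto
  then show ?thesis using kE' by simp
qed

lemma f_conv_int:
  assumes h: "0 < h" and S: "\<And>z. conv h z \<le> S"
  shows "integrable lborel (\<lambda>z. f z * conv h z)" and "(LINT z|lborel. f z * conv h z) \<le> S"
proof -
  have i: "integrable lborel (\<lambda>z. f z * S)" using f_int by simp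
  show *: "integrable lborel (\<lambda>z. f z * conv h z)"
    by (rule Bochner_Integration.integrable_bound[OF i])
       (use S conv_nonneg f_nonneg in \<open>auto simp: abs_mult intro!: mult_left_mono order_trans[OF S abs_ge_self]\<close>)
  have "(LINT z|lborel. f z * conv h z) \<le> (LINT z|lborel. f z * S)"
    using * i S f_nonneg by (intro integral_mono mult_left_mono) auto
  then show "(LINT z|lborel. f z * conv h z) \<le> S" using f_one by simp
qed

theorem conv_bounds:
  assumes f: "bounded (range f) \<or> (\<exists>r. 0 < r \<and> r \<le> 1 \<and> integrable lborel (\<lambda>t. cmod (fourier f t) powr (2 - r)))"
  obtains C S where
    "\<And>h z. 0 < h \<Longrightarrow> conv h z \<le> S h"
    "\<And>h. 0 < h \<Longrightarrow> (LINT z|lborel. f z * conv h z) \<le> C * h ^ DIM('e)"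
    "((\<lambda>h. (S h)\<^sup>2 / h ^ DIM('e)) \<longlongrightarrow> 0) (at_right 0)"
  using f
proof
  assume "bounded (range f)"
  then obtain B where B: "\<And>x. f x \<le> B" unfolding bounded_iff by (metis abs_le_D1 range_eqI real_norm_def)
  show thesis
  proof (rule that[of "\<lambda>h. B * h ^ DIM('e)" B])
    show "conv h z \<le> B * h ^ DIM('e)" if "0 < h" for h z by (rule conv_bounds_bounded[OF B that])
    then show "(LINT z|lborel. f z * conv h z) \<le> B * h ^ DIM('e)" if "0 < h" for h
      using f_conv_int(2)[OF that] that by blast
    have "((\<lambda>h::real. B\<^sup>2 * h ^ DIM('e)) \<longlongrightarrow> B\<^sup>2 * 0 ^ DIM('e)) (at_right 0)"
      by (intro tendsto_intros)
    then have "((\<lambda>h::real. B\<^sup>2 * h ^ DIM('e)) \<longlongrightarrow> 0) (at_right 0)"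
      by (simp add: power_0_left)
    then show "((\<lambda>h. (B * h ^ DIM('e))\<^sup>2 / h ^ DIM('e)) \<longlongrightarrow> 0) (at_right 0)"
    proof (rule Lim_transform_eventually)
      show "\<forall>\<^sub>F h in at_right 0. B\<^sup>2 * h ^ DIM('e) = (B * h ^ DIM('e))\<^sup>2 / h ^ DIM('e)"
        using eventually_at_right_less[of "0::real"]
        by eventually_elim (simp add: power2_eq_square field_simps)
    qed
  qed
next
  assume "\<exists>r. 0 < r \<and> r \<le> 1 \<and> integrable lborel (\<lambda>t. cmod (fourier f t) powr (2 - r))"
  then obtain r where r: "0 < r" "r \<le> 1" "integrable lborel (\<lambda>t. cmod (fourier f t) powr (2 - r))" by auto
  define d where "d = real DIM('e)"
  define J where "J = (LINT t|lborel. cmod (fourier f t) powr (2 - r))"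
  define L where "L = (LINT t|lborel. \<kappa>E (t::'e))"
  \<comment> \<open>The exponent solves e (r - 1) + d = e, so both terms of the interpolation are of
    order h^e. Moreover 2 e - d = d r / (2 - r) is positive because r > 0, which makes the square of
    the bound negligible against h^d.\<close>
  define e where "e = d / (2 - r)"
  have d: "0 < d" unfolding d_def by simp
  have L: "0 \<le> L" unfolding L_def by (intro Bochner_Integration.integral_nonneg) (rule \<kappa>E_nonneg)
  have J: "0 \<le> J" unfolding J_def by (intro Bochner_Integration.integral_nonneg) simp
  have hd: "h ^ DIM('e) = h powr d" if "0 < h" for h :: real
    unfolding d_def using that by (simp add: powr_realpow)
  have sc: "integrable lborel (\<lambda>t. cmod (fourier f (t /\<^sub>R h)) powr (2 - r))"
      "(LINT t|lborel. cmod (fourier f (t /\<^sub>R h)) powr (2 - r)) = h ^ DIM('e) * J" if "0 < h" for h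
    using lborel_integral_scale[OF that r(3)] unfolding J_def by auto
  show thesis
  proof (rule that[of "\<lambda>h. (L + J) * h powr e" J])
    fix h z assume h: "(0::real) < h"
    define c where "c = h powr e" \<comment> \<open>balances the two terms of \<open>le_powr_interpolation\<close>\<close>
    have c: "0 < c" unfolding c_def using h by simp
    have "conv h z \<le> (LINT t|lborel. \<kappa>E t * norm (fourier f (t /\<^sub>R h)))"
      by (rule conv_le_fourier[OF h])
    also have "\<dots> \<le> (LINT t|lborel. c * \<kappa>E t + c powr (r - 1) * cmod (fourier f (t /\<^sub>R h)) powr (2 - r))"
    proof (intro integral_mono)
      show "integrable lborel (\<lambda>t. \<kappa>E t * norm (fourier f (t /\<^sub>R h)))"
        by (rule Bochner_Integration.integrable_bound[OF \<kappa>E_int])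
           (auto simp: abs_mult \<kappa>E_nonneg mult_left_le fourier_le_1)
      show "integrable lborel (\<lambda>t. c * \<kappa>E t + c powr (r - 1) * cmod (fourier f (t /\<^sub>R h)) powr (2 - r))"
        using \<kappa>E_int sc(1)[OF h] by auto
      fix t :: 'e
      let ?x = "norm (fourier f (t /\<^sub>R h))"
      have "\<kappa>E t * ?x \<le> \<kappa>E t * (c + c powr (r - 1) * ?x powr (2 - r))"
        using le_powr_interpolation[of ?x c r] c r \<kappa>E_nonneg by (intro mult_left_mono) auto
      also have "\<dots> = c * \<kappa>E t + \<kappa>E t * (c powr (r - 1) * ?x powr (2 - r))" by (simp add: algebra_simps)
      also have "\<dots> \<le> c * \<kappa>E t + 1 * (c powr (r - 1) * ?x powr (2 - r))"
        using \<kappa>E_le_1 by (intro add_left_mono mult_right_mono) auto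
      finally show "\<kappa>E t * ?x \<le> c * \<kappa>E t + c powr (r - 1) * ?x powr (2 - r)" by simp
    qed
    also have "\<dots> = c * L + c powr (r - 1) * (h ^ DIM('e) * J)"
      using sc[OF h] by (subst Bochner_Integration.integral_add) (auto simp: L_def \<kappa>E_int)
    also have "c powr (r - 1) * (h ^ DIM('e) * J) = c * J"
    proof -
      have "c powr (r - 1) * h ^ DIM('e) = h powr (e * (r - 1) + d)"
        unfolding c_def hd[OF h] powr_powr by (simp add: powr_add)
      also have "e * (r - 1) + d = e" unfolding e_def using r by (simp add: field_simps)
      finally show ?thesis by (simp add: c_def)
    qed
    finally show "conv h z \<le> (L + J) * h powr e" by (simp add: c_def algebra_simps)
  next
    fix h :: real assume h: "0 < h"
    have "(LINT z|lborel. f z * conv h z) \<le> (LINT t|lborel. \<kappa>E t * (norm (fourier f (t /\<^sub>R h)))\<^sup>2)"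
      by (rule double_conv_le_fourier[OF h])
    \<comment> \<open>Both \<open>\<kappa>E\<close> and the modulus of the transform are at most 1,
      so the square is bounded by the power 2 - r; rescaling its integral produces h^d.\<close>
    also have "\<dots> \<le> (LINT t|lborel. cmod (fourier f (t /\<^sub>R h)) powr (2 - r))"
    proof (intro integral_mono)
      show "integrable lborel (\<lambda>t. \<kappa>E t * (norm (fourier f (t /\<^sub>R h)))\<^sup>2)"
        by (rule Bochner_Integration.integrable_bound[OF \<kappa>E_int])
           (auto simp: abs_mult \<kappa>E_nonneg mult_left_le fourier_le_1 power_le_one)
      show "integrable lborel (\<lambda>t. cmod (fourier f (t /\<^sub>R h)) powr (2 - r))" by (rule sc(1)[OF h])
      fix t :: 'e
      let ?x = "norm (fourier f (t /\<^sub>R h))"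
      have "\<kappa>E t * ?x\<^sup>2 \<le> 1 * ?x\<^sup>2" using \<kappa>E_le_1 by (intro mult_right_mono) auto
      also have "?x\<^sup>2 \<le> ?x powr (2 - r)"
      proof (cases "?x = 0")
        case False
        then have "?x\<^sup>2 = ?x powr 2" by simp
        also have "\<dots> \<le> ?x powr (2 - r)" using False r fourier_le_1 by (intro powr_mono') auto
        finally show ?thesis .
      qed simp
      finally show "\<kappa>E t * ?x\<^sup>2 \<le> ?x powr (2 - r)" by simp
    qed
    also have "\<dots> = J * h ^ DIM('e)" unfolding sc(2)[OF h] by simp
    finally show "(LINT z|lborel. f z * conv h z) \<le> J * h ^ DIM('e)" .
  next
    have ep: "0 < 2 * e - d"
    proof -
      have "2 * e - d = d * r / (2 - r)" unfolding e_def using r by (simp add: field_simps)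
      then show ?thesis using d r by simp
    qed
    have "((\<lambda>h::real. h powr (2 * e - d)) \<longlongrightarrow> 0) (at_right 0)"
      using ep by (intro tendsto_zero_powrI[where b = "2 * e - d"] tendsto_ident_at tendsto_const)
        (auto simp: eventually_at_right_less intro: eventually_mono[OF eventually_at_right_less[of "0::real"]])
    then have "((\<lambda>h::real. (L + J)\<^sup>2 * h powr (2 * e - d)) \<longlongrightarrow> 0) (at_right 0)"
      by (rule tendsto_mult_right_zero)
    then show "((\<lambda>h. ((L + J) * h powr e)\<^sup>2 / h ^ DIM('e)) \<longlongrightarrow> 0) (at_right 0)"
    proof (rule Lim_transform_eventually)
      show "\<forall>\<^sub>F h in at_right 0. (L + J)\<^sup>2 * h powr (2 * e - d) = ((L + J) * h powr e)\<^sup>2 / h ^ DIM('e)"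
        using eventually_at_right_less[of "0::real"]
      proof eventually_elim
        case (elim h)
        have "h powr (2 * e - d) = (h powr e)\<^sup>2 / h powr d"
          using elim by (simp add: powr_diff power2_eq_square flip: powr_add)
        then show ?case unfolding hd[OF elim] by (simp add: power_mult_distrib)
      qed
    qed
  qed
qed

end

text \<open>With \<open>\<psi> u\<close> the mass of the ball of radius \<open>\<rho>\<close> around \<open>u\<close>, integrate \<open>\<psi>\<^sup>2 \<ge> 2 l \<psi> - l\<^sup>2\<close> over the ball of
  radius \<open>R + 1\<close>; the optimal constant is \<open>l = prob A * V / VR\<close>.\<close>

lemma (in prob_space) close_pairs_lower_bound:
  fixes \<zeta> :: "'a \<Rightarrow> 'e::euclidean_space"
  assumes [measurable]: "\<zeta> \<in> borel_measurable M" "A \<in> sets M"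
    and R: "\<And>x. x \<in> A \<Longrightarrow> norm (\<zeta> x) \<le> R" "0 \<le> R"
    and \<rho>: "0 < \<rho>" "\<rho> \<le> 1"
  shows "ennreal ((prob A)\<^sup>2 * (\<rho> / (R + 1)) ^ DIM('e))
    \<le> (\<integral>\<^sup>+x. (\<integral>\<^sup>+y. (if x \<in> A \<and> y \<in> A \<and> norm (\<zeta> x - \<zeta> y) \<le> 2 * \<rho> then 1 else 0) \<partial>M) \<partial>M)"
proof -
  interpret MU: pair_sigma_finite M "lborel :: 'e measure" ..
  define V where "V = measure lborel (cball (0::'e) \<rho>)"
  \<comment> \<open>As \<rho> <= 1 and \<zeta> stays within distance \<open>R\<close> of the origin
    on \<open>A\<close>, the function \<open>\<psi>\<close> vanishes outside the ball of radius R +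
    1.\<close>
  define VR where "VR = measure lborel (cball (0::'e) (R + 1))"
  have V_pos: "0 < V" "0 < VR" unfolding V_def VR_def using \<rho> R by (auto intro!: content_cball_pos)
  have em: "emeasure lborel (cball c r) = ennreal (measure lborel (cball c r))" for c :: 'e and r
    using emeasure_lborel_cball_finite[of c r] by (intro emeasure_eq_ennreal_measure) auto
  have V: "emeasure lborel (cball c \<rho>) = ennreal V" for c :: 'e
    unfolding V_def em using \<rho> by (simp add: content_cball)
  have VRe: "emeasure lborel (cball (0::'e) (R + 1)) = ennreal VR"
    unfolding VR_def by (rule em)
  have ratio: "V / VR = (\<rho> / (R + 1)) ^ DIM('e)"
  proof -
    have "unit_ball_vol (real DIM('e)) \<noteq> 0" using unit_ball_vol_pos[of "real DIM('e)"] by linarith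
    then show ?thesis unfolding V_def VR_def using \<rho> R by (simp add: content_cball power_divide)
  qed
  define p where "p x u = (if x \<in> A \<and> dist (\<zeta> x) u \<le> \<rho> then 1 else 0 :: ennreal)" for x u
  define q where "q x y = (if x \<in> A \<and> y \<in> A \<and> norm (\<zeta> x - \<zeta> y) \<le> 2 * \<rho> then 1 else 0 :: ennreal)" for x y
  define \<psi> where "\<psi> u = (\<integral>\<^sup>+x. p x u \<partial>M)" for u
  define Q where "Q = (\<integral>\<^sup>+x. (\<integral>\<^sup>+y. q x y \<partial>M) \<partial>M)"
  have [measurable]: "(\<lambda>z. p (f z) (g z)) \<in> borel_measurable N"
    if [measurable]: "f \<in> measurable N M" "g \<in> borel_measurable N" for f g and N :: "'z measure"
    unfolding p_def by measurable
  have [measurable]: "(\<lambda>z. q (f z) (g z)) \<in> borel_measurable N"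
    if [measurable]: "f \<in> measurable N M" "g \<in> measurable N M" for f g and N :: "'z measure"
    unfolding q_def by measurable
  have [measurable]: "\<psi> \<in> borel_measurable borel" unfolding \<psi>_def[abs_def] by measurable
  have p_int: "(\<integral>\<^sup>+u. p x u \<partial>lborel) = indicator A x * ennreal V" for x
  proof -
    have "(\<integral>\<^sup>+u. p x u \<partial>lborel) = (\<integral>\<^sup>+u. indicator A x * indicator (cball (\<zeta> x) \<rho>) u \<partial>lborel)"
      by (intro nn_integral_cong) (auto simp: p_def indicator_def)
    also have "\<dots> = indicator A x * emeasure lborel (cball (\<zeta> x) \<rho>)"
      by (subst nn_integral_cmult) (auto intro!: borel_measurable_indicator)
    finally show ?thesis by (simp only: V)
  qed
  have 1: "(\<integral>\<^sup>+u. \<psi> u \<partial>lborel) = ennreal (prob A * V)"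
  proof -
    have "(\<integral>\<^sup>+u. \<psi> u \<partial>lborel) = (\<integral>\<^sup>+x. (\<integral>\<^sup>+u. p x u \<partial>lborel) \<partial>M)"
      unfolding \<psi>_def by (rule MU.Fubini') measurable
    also have "\<dots> = ennreal (prob A * V)"
      unfolding p_int using V_pos by (simp add: nn_integral_multc emeasure_eq_measure ennreal_mult)
    finally show ?thesis .
  qed
  \<comment> \<open>Expanding the square of \<open>\<psi>\<close> gives the volume common to the
    balls around two points, which is at most \<open>V\<close> and zero unless the points are within
    2 \<rho>.\<close>
  have 2: "(\<integral>\<^sup>+u. \<psi> u * \<psi> u \<partial>lborel) \<le> Q * ennreal V"
  proof -
    have "(\<integral>\<^sup>+u. \<psi> u * \<psi> u \<partial>lborel) = (\<integral>\<^sup>+u. (\<integral>\<^sup>+x. p x u * \<psi> u \<partial>M) \<partial>lborel)"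
      unfolding \<psi>_def[of u for u] by (simp add: nn_integral_multc)
    also have "\<dots> = (\<integral>\<^sup>+x. (\<integral>\<^sup>+u. p x u * \<psi> u \<partial>lborel) \<partial>M)"
      by (rule MU.Fubini') measurable
    also have "\<dots> = (\<integral>\<^sup>+x. (\<integral>\<^sup>+u. (\<integral>\<^sup>+y. p x u * p y u \<partial>M) \<partial>lborel) \<partial>M)"
      unfolding \<psi>_def by (simp add: nn_integral_cmult)
    also have "\<dots> = (\<integral>\<^sup>+x. (\<integral>\<^sup>+y. (\<integral>\<^sup>+u. p x u * p y u \<partial>lborel) \<partial>M) \<partial>M)"
    proof (rule nn_integral_cong)
      fix x assume [measurable]: "x \<in> space M"
      show "(\<integral>\<^sup>+u. (\<integral>\<^sup>+y. p x u * p y u \<partial>M) \<partial>lborel) = (\<integral>\<^sup>+y. (\<integral>\<^sup>+u. p x u * p y u \<partial>lborel) \<partial>M)"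
        by (rule MU.Fubini') measurable
    qed
    also have "\<dots> \<le> (\<integral>\<^sup>+x. (\<integral>\<^sup>+y. q x y * ennreal V \<partial>M) \<partial>M)"
    proof (intro nn_integral_mono)
      fix x y
      have "(\<integral>\<^sup>+u. p x u * p y u \<partial>lborel) \<le> (\<integral>\<^sup>+u. q x y * indicator (cball (\<zeta> x) \<rho>) u \<partial>lborel)"
      proof (intro nn_integral_mono)
        fix u
        have "norm (\<zeta> x - \<zeta> y) \<le> 2 * \<rho>" if "dist (\<zeta> x) u \<le> \<rho>" "dist (\<zeta> y) u \<le> \<rho>"
          using dist_triangle2[of "\<zeta> x" "\<zeta> y" u] that by (simp add: dist_norm)
        then show "p x u * p y u \<le> q x y * indicator (cball (\<zeta> x) \<rho>) u"
          by (auto simp: p_def q_def)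
      qed
      also have "\<dots> = q x y * emeasure lborel (cball (\<zeta> x) \<rho>)"
        by (subst nn_integral_cmult) (auto intro!: borel_measurable_indicator)
      also have "\<dots> = q x y * ennreal V" by (simp only: V)
      finally show "(\<integral>\<^sup>+u. p x u * p y u \<partial>lborel) \<le> q x y * ennreal V" .
    qed
    also have "\<dots> = (\<integral>\<^sup>+x. (\<integral>\<^sup>+y. q x y \<partial>M) * ennreal V \<partial>M)"
    proof (rule nn_integral_cong)
      fix x assume [measurable]: "x \<in> space M"
      show "(\<integral>\<^sup>+y. q x y * ennreal V \<partial>M) = (\<integral>\<^sup>+y. q x y \<partial>M) * ennreal V"
        by (rule nn_integral_multc) measurable
    qed
    also have "\<dots> = Q * ennreal V"
      unfolding Q_def by (rule nn_integral_multc) measurable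
    finally show ?thesis .
  qed
  have \<psi>_le: "\<psi> u \<le> 1" for u
  proof -
    have "\<psi> u \<le> (\<integral>\<^sup>+x. 1 \<partial>M)" unfolding \<psi>_def p_def by (intro nn_integral_mono) auto
    then show ?thesis by (simp add: emeasure_space_1)
  qed
  have Q_le: "Q \<le> 1"
  proof -
    have "Q \<le> (\<integral>\<^sup>+x. (\<integral>\<^sup>+y. 1 \<partial>M) \<partial>M)" unfolding Q_def q_def by (intro nn_integral_mono) auto
    then show ?thesis by (simp add: emeasure_space_1)
  qed
  then obtain c where c: "Q = ennreal c" "0 \<le> c" by (cases Q) (auto simp: top_unique)
  define l where "l = prob A * V / VR"
  have l: "0 \<le> l" unfolding l_def using V_pos by simp
  have "ennreal (2 * l * (prob A * V)) = (\<integral>\<^sup>+u. ennreal (2 * l) * \<psi> u \<partial>lborel)"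
    using l V_pos by (subst nn_integral_cmult) (auto simp: 1 ennreal_mult)
  also have "\<dots> \<le> (\<integral>\<^sup>+u. \<psi> u * \<psi> u + ennreal (l\<^sup>2) * indicator (cball 0 (R + 1)) u \<partial>lborel)"
  proof (intro nn_integral_mono)
    fix u :: 'e
    obtain r where r: "\<psi> u = ennreal r" "0 \<le> r" using \<psi>_le[of u] by (cases "\<psi> u") (auto simp: top_unique)
    show "ennreal (2 * l) * \<psi> u \<le> \<psi> u * \<psi> u + ennreal (l\<^sup>2) * indicator (cball 0 (R + 1)) u"
    proof (cases "u \<in> cball 0 (R + 1)")
      case True
      have "2 * l * r \<le> r * r + l\<^sup>2" using sum_squares_bound[of l r] by (simp add: power2_eq_square)
      then have "ennreal (2 * l * r) \<le> ennreal (r * r + l\<^sup>2)" by (rule ennreal_leI)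
      then show ?thesis using True l r by (simp add: ennreal_mult ennreal_plus)
    next
      case False
      have "p x u = 0" for x
      proof -
        have "norm u \<le> norm (\<zeta> x) + dist (\<zeta> x) u" by (metis dist_commute dist_norm norm_triangle_sub)
        then show ?thesis using False R(1)[of x] \<rho> by (auto simp: p_def)
      qed
      then show ?thesis by (simp add: \<psi>_def)
    qed
  qed
  also have "\<dots> = (\<integral>\<^sup>+u. \<psi> u * \<psi> u \<partial>lborel) + ennreal (l\<^sup>2) * ennreal VR"
  proof -
    have [measurable]: "indicator (cball (0::'e) (R + 1)) \<in> borel_measurable (borel :: 'e measure)"
      by (intro borel_measurable_indicator) auto
    have "(\<integral>\<^sup>+u. ennreal (l\<^sup>2) * indicator (cball (0::'e) (R + 1)) u \<partial>lborel)
      = ennreal (l\<^sup>2) * emeasure lborel (cball (0::'e) (R + 1))"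
      by (subst nn_integral_cmult) auto
    then show ?thesis by (subst nn_integral_add) (auto simp only: VRe, measurable)
  qed
  also have "\<dots> \<le> Q * ennreal V + ennreal (l\<^sup>2) * ennreal VR" by (intro add_right_mono 2)
  also have "\<dots> = ennreal (c * V + l\<^sup>2 * VR)"
    unfolding c using c V_pos by (simp add: ennreal_mult ennreal_plus)
  finally have "2 * l * (prob A * V) \<le> c * V + l\<^sup>2 * VR"
    using c V_pos by (subst (asm) ennreal_le_iff) auto
  moreover have "l\<^sup>2 * VR = l * (prob A * V)"
    unfolding l_def using V_pos by (simp add: power2_eq_square)
  ultimately have "l * prob A * V \<le> c * V" by (simp add: mult_ac)
  then have "l * prob A \<le> c" using V_pos by simp
  moreover have "l * prob A = (prob A)\<^sup>2 * (\<rho> / (R + 1)) ^ DIM('e)"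
    unfolding ratio[symmetric] l_def by (simp add: power2_eq_square)
  ultimately have "ennreal ((prob A)\<^sup>2 * (\<rho> / (R + 1)) ^ DIM('e)) \<le> Q"
    unfolding c by (intro ennreal_leI) simp
  then show ?thesis unfolding Q_def q_def .
qed

section \<open>Moments of the localized kernel\<close>

text \<open>\<open>u\<close> stands for \<omega>(Z) U. The conditional hypotheses appear tested
  against bounded measurable functions (\<open>u2_le\<close>, \<open>u_centered\<close>,
  \<open>u_nondegenerate\<close>), so the moment estimates are plain integrals over one law \<mu>.
  \<open>\<beta>\<close> bounds the one-dimensional kernel, and \<open>A\<close> compares the
  squared seminorm \<open>N\<close> with the squared norm.\<close>

locale localized_kernel = prob_space \<mu> + smoothed_density k f
  for \<mu> :: "'x measure" and k :: "real \<Rightarrow> real" and f :: "'e::euclidean_space \<Rightarrow> real" +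
  fixes u :: "'x \<Rightarrow> 'a::{real_inner, banach, second_countable_topology}" and \<zeta> :: "'x \<Rightarrow> 'e"
    and w :: "'x \<Rightarrow> 'b::{real_inner, banach, second_countable_topology}" and N :: "'b \<Rightarrow> real"
    and \<beta> \<sigma>2 C2 A :: real
  assumes u_meas[measurable]: "u \<in> borel_measurable \<mu>"
    and \<zeta>_meas[measurable]: "\<zeta> \<in> borel_measurable \<mu>"
    and w_meas[measurable]: "w \<in> borel_measurable \<mu>"
    and N_meas[measurable]: "N \<in> borel_measurable borel"
    and N_nonneg: "0 \<le> N v" and N_minus: "N (- v) = N v" and N_le: "N v \<le> A * (norm v)\<^sup>2"
    and k_le: "k t \<le> \<beta>"
    and \<zeta>_density: "distributed \<mu> lborel \<zeta> (\<lambda>z. ennreal (f z))"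
    and u4: "integrable \<mu> (\<lambda>x. norm (u x) ^ 4)"
    and u2_le: "\<lbrakk>\<phi> \<in> borel_measurable borel; \<And>z. 0 \<le> \<phi> z; \<And>z. \<phi> z \<le> B\<rbrakk> \<Longrightarrow>
      (\<integral>x. (norm (u x))\<^sup>2 * \<phi> (\<zeta> x) \<partial>\<mu>) \<le> C2 * (\<integral>x. \<phi> (\<zeta> x) \<partial>\<mu>)"
    and u_centered: "\<lbrakk>\<xi> \<in> borel_measurable borel; \<And>p. \<bar>\<xi> p\<bar> \<le> B\<rbrakk> \<Longrightarrow>
      (\<integral>x. (c \<bullet> u x) * \<xi> (\<zeta> x, w x) \<partial>\<mu>) = 0"
    and u_nondegenerate: "\<lbrakk>\<Phi> \<in> borel_measurable borel; \<And>r. 0 \<le> \<Phi> r; \<And>r. \<Phi> r \<le> B\<rbrakk> \<Longrightarrow>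
      \<sigma>2 * (\<integral>x. (\<integral>y. \<Phi> ((\<zeta> x, w x), (\<zeta> y, w y)) \<partial>\<mu>) \<partial>\<mu>)
        \<le> (\<integral>x. (\<integral>y. (u x \<bullet> u y)\<^sup>2 * \<Phi> ((\<zeta> x, w x), (\<zeta> y, w y)) \<partial>\<mu>) \<partial>\<mu>)"
    and C2: "0 < C2" and \<sigma>2: "0 < \<sigma>2"
begin

definition L :: "real \<Rightarrow> 'e \<Rightarrow> 'e \<Rightarrow> real" where "L h z z' = kE ((z - z') /\<^sub>R h)"
definition \<Psi> :: "'b \<Rightarrow> 'b \<Rightarrow> real" where "\<Psi> v v' = exp (- N (v - v') / 2)"
definition H :: "real \<Rightarrow> 'x \<Rightarrow> 'x \<Rightarrow> real" where
  "H h x y = (u x \<bullet> u y) * (L h (\<zeta> x) (\<zeta> y) * \<Psi> (w x) (w y))"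
definition \<kappa>0 :: real where "\<kappa>0 = \<beta> ^ DIM('e)"
definition M4 :: real where "M4 = (\<integral>x. norm (u x) ^ 4 \<partial>\<mu>)"

lemma \<beta>_pos: "0 < \<beta>"
proof (rule ccontr)
  assume "\<not> 0 < \<beta>"
  then have "k x = 0" for x using k_le[of x] k_nonneg[of x] by simp
  then show False using k_one by simp
qed

lemma \<kappa>0_pos: "0 < \<kappa>0" unfolding \<kappa>0_def using \<beta>_pos by simp

lemma kE_le: "kE (z::'e) \<le> \<kappa>0"
proof -
  have "kE z \<le> (\<Prod>b\<in>(Basis::'e set). \<beta>)"
    unfolding kE_def by (intro prod_mono) (auto simp: k_nonneg k_le)
  then show ?thesis by (simp add: \<kappa>0_def)
qed

lemma L_nonneg: "0 \<le> L h z z'" unfolding L_def by (rule kE_nonneg)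
lemma L_le: "L h z z' \<le> \<kappa>0" unfolding L_def by (rule kE_le)
lemma L_sym: "L h z z' = L h z' z"
  using kE_minus[of "(z - z') /\<^sub>R h"] unfolding L_def by (simp add: scaleR_right.minus[symmetric])

lemma \<Psi>_pos: "0 < \<Psi> v v'" and \<Psi>_le_1: "\<Psi> v v' \<le> 1" unfolding \<Psi>_def by (auto simp: N_nonneg)
lemma \<Psi>_sym: "\<Psi> v v' = \<Psi> v' v" using N_minus[of "v - v'"] unfolding \<Psi>_def by simp

lemma L_meas[measurable]:
  assumes [measurable]: "a \<in> borel_measurable N'" "b \<in> borel_measurable N'"
  shows "(\<lambda>x. L h (a x) (b x)) \<in> borel_measurable N'"
  unfolding L_def by measurable

lemma \<Psi>_meas[measurable]:
  assumes [measurable]: "a \<in> borel_measurable N'" "b \<in> borel_measurable N'"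
  shows "(\<lambda>x. \<Psi> (a x) (b x)) \<in> borel_measurable N'"
  unfolding \<Psi>_def by measurable

lemma L\<Psi>_le: "0 \<le> L h z z' * \<Psi> v v'" "L h z z' * \<Psi> v v' \<le> L h z z'" "L h z z' * \<Psi> v v' \<le> \<kappa>0"
proof -
  show "0 \<le> L h z z' * \<Psi> v v'" using L_nonneg \<Psi>_pos by (simp add: less_imp_le)
  show 1: "L h z z' * \<Psi> v v' \<le> L h z z'" using L_nonneg \<Psi>_le_1 by (intro mult_left_le)
  show "L h z z' * \<Psi> v v' \<le> \<kappa>0" using 1 L_le order_trans by blast
qed

lemma abs_H_le: "\<bar>H h x y\<bar> \<le> norm (u x) * norm (u y) * L h (\<zeta> x) (\<zeta> y)"
proof -
  have "\<bar>H h x y\<bar> = \<bar>u x \<bullet> u y\<bar> * (L h (\<zeta> x) (\<zeta> y) * \<Psi> (w x) (w y))"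
    unfolding H_def abs_mult[of "u x \<bullet> u y"] by (simp only: abs_of_nonneg[OF L\<Psi>_le(1)])
  also have "\<dots> \<le> (norm (u x) * norm (u y)) * L h (\<zeta> x) (\<zeta> y)"
    using L\<Psi>_le by (intro mult_mono Cauchy_Schwarz_ineq2) auto
  finally show ?thesis .
qed

lemma abs_H_le': "\<bar>H h x y\<bar> \<le> \<kappa>0 * (norm (u x) * norm (u y))"
proof -
  have "norm (u x) * norm (u y) * L h (\<zeta> x) (\<zeta> y) \<le> norm (u x) * norm (u y) * \<kappa>0"
    using L_le by (intro mult_left_mono) auto
  then show ?thesis using abs_H_le[of h x y] by (simp add: mult_ac)
qed

lemma norm_u_int: "j \<le> 4 \<Longrightarrow> integrable \<mu> (\<lambda>x. norm (u x) ^ j)"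
proof (rule Bochner_Integration.integrable_bound)
  show "integrable \<mu> (\<lambda>x. 1 + norm (u x) ^ 4)" using u4 by simp
  assume j: "j \<le> 4"
  have "norm v ^ j \<le> 1 + norm v ^ 4" for v :: 'a
  proof (cases "norm v \<le> 1")
    case True then have "norm v ^ j \<le> 1" by (simp add: power_le_one)
    then show ?thesis by (simp add: add_increasing2)
  next
    case False then have "norm v ^ j \<le> norm v ^ 4" using j by (intro power_increasing) auto
    then show ?thesis by simp
  qed
  then show "AE x in \<mu>. norm (norm (u x) ^ j) \<le> norm (1 + norm (u x) ^ 4)" by auto
qed measurable

lemma norm_u2_bounded_int:
  assumes [measurable]: "\<phi> \<in> borel_measurable \<mu>" and "\<And>x. \<bar>\<phi> x\<bar> \<le> B"
  shows "integrable \<mu> (\<lambda>x. (norm (u x))\<^sup>2 * \<phi> x)" "integrable \<mu> \<phi>"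
proof -
  show "integrable \<mu> (\<lambda>x. (norm (u x))\<^sup>2 * \<phi> x)"
    by (rule Bochner_Integration.integrable_bound[of _ "\<lambda>x. (norm (u x))\<^sup>2 * B"])
      (use assms norm_u_int[of 2] in \<open>auto simp: abs_mult intro!: mult_left_mono order_trans[OF assms(2) abs_ge_self]\<close>)
  show "integrable \<mu> \<phi>" by (rule integrable_const_bound[of _ B]) (use assms in auto)
qed

lemma H_meas: "(\<lambda>(x, y). H h x y) \<in> borel_measurable (\<mu> \<Otimes>\<^sub>M \<mu>)"
  unfolding H_def by measurable

lemma H_power_int:
  assumes "j \<le> 4" and [measurable]: "x \<in> space \<mu>"
  shows "integrable \<mu> (\<lambda>y. H h x y ^ j)"
proof (rule Bochner_Integration.integrable_bound)
  show "integrable \<mu> (\<lambda>y. (\<kappa>0 * norm (u x)) ^ j * norm (u y) ^ j)" using norm_u_int[OF assms(1)] by simp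
  have "\<bar>H h x y\<bar> ^ j \<le> (\<kappa>0 * (norm (u x) * norm (u y))) ^ j" for y
    using abs_H_le' by (intro power_mono) auto
  then show "AE y in \<mu>. norm (H h x y ^ j) \<le> norm ((\<kappa>0 * norm (u x)) ^ j * norm (u y) ^ j)"
    using \<kappa>0_pos by (auto simp: power_abs power_mult_distrib mult_ac)
  show "(\<lambda>y. H h x y ^ j) \<in> borel_measurable \<mu>" unfolding H_def by measurable
qed

sublocale \<mu>2: pair_sigma_finite \<mu> \<mu> ..

lemma H4_le: "H h x y ^ 4 \<le> \<kappa>0 ^ 4 * norm (u x) ^ 4 * norm (u y) ^ 4"
proof -
  have "\<bar>H h x y\<bar> ^ 4 \<le> (\<kappa>0 * (norm (u x) * norm (u y))) ^ 4" using abs_H_le' by (intro power_mono) auto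
  then show ?thesis by (simp add: power_mult_distrib mult_ac)
qed

text \<open>Degeneracy is \<open>u_centered\<close> with the first argument frozen: c = u x, and the
  test function is the product of the two localizing factors, bounded by
  \<open>\<kappa>0\<close>.\<close>

lemma degenerate_kernel_H: "finite I \<Longrightarrow> degenerate_kernel \<mu> (H h) I"
proof unfold_locales
  show "(\<lambda>(x, y). H h x y) \<in> borel_measurable (\<mu> \<Otimes>\<^sub>M \<mu>)" by (rule H_meas)
  show "H h x y = H h y x" for x y
    unfolding H_def using L_sym[of h "\<zeta> x"] \<Psi>_sym[of "w x"] by (simp add: inner_commute)
  show "integrable \<mu> (H h x)" if "x \<in> space \<mu>" for x using H_power_int[OF _ that, of 1 h] by simp
  show "integrable \<mu> (\<lambda>y. H h x y ^ 4)" if "x \<in> space \<mu>" for x using H_power_int[OF _ that, of 4 h] by simp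
  show "(\<integral>y. H h x y \<partial>\<mu>) = 0" if "x \<in> space \<mu>" for x
  proof -
    have "(\<lambda>p. L h (\<zeta> x) (fst p) * \<Psi> (w x) (snd p)) \<in> borel_measurable borel"
      unfolding borel_prod[symmetric] by measurable
    from u_centered[OF this, of \<kappa>0 "u x"] show ?thesis
      unfolding H_def using L\<Psi>_le by (simp only: fst_conv snd_conv abs_of_nonneg)
  qed
  show "integrable (\<mu> \<Otimes>\<^sub>M \<mu>) (\<lambda>(x, y). H h x y ^ 4)"
  proof (rule Bochner_Integration.integrable_bound)
    show "integrable (\<mu> \<Otimes>\<^sub>M \<mu>) (\<lambda>(x, y). \<kappa>0 ^ 4 * norm (u x) ^ 4 * norm (u y) ^ 4)"
    proof (rule \<mu>2.Fubini_integrable)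
      show "integrable \<mu> (\<lambda>x. \<integral>y. norm (case (x, y) of (x, y) \<Rightarrow> \<kappa>0 ^ 4 * norm (u x) ^ 4 * norm (u y) ^ 4) \<partial>\<mu>)"
        using u4 by (simp add: abs_mult)
      show "AE x in \<mu>. integrable \<mu> (\<lambda>y. case (x, y) of (x, y) \<Rightarrow> \<kappa>0 ^ 4 * norm (u x) ^ 4 * norm (u y) ^ 4)"
        using u4 by simp
    qed measurable
    show "(\<lambda>(x, y). H h x y ^ 4) \<in> borel_measurable (\<mu> \<Otimes>\<^sub>M \<mu>)"
      using H_meas[of h] by (simp add: split_beta')
    have "\<bar>H h x y ^ 4\<bar> \<le> \<bar>\<kappa>0 ^ 4 * norm (u x) ^ 4 * norm (u y) ^ 4\<bar>" for x y
      using H4_le[of h x y] by simp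
    then show "AE p in \<mu> \<Otimes>\<^sub>M \<mu>. norm (case p of (x, y) \<Rightarrow> H h x y ^ 4) \<le> norm (case p of (x, y) \<Rightarrow> \<kappa>0 ^ 4 * norm (u x) ^ 4 * norm (u y) ^ 4)"
      by auto
  qed
qed

lemma E_\<zeta>: "\<phi> \<in> borel_measurable borel \<Longrightarrow> (\<integral>x. \<phi> (\<zeta> x) \<partial>\<mu>) = (LINT z|lborel. f z * \<phi> z)" for \<phi> :: "'e \<Rightarrow> real"
  using distributed_integral[OF \<zeta>_density, of \<phi>] f_nonneg by simp

lemma E_L: "(\<integral>y. L h z (\<zeta> y) \<partial>\<mu>) = conv h z"
  unfolding conv_def L_def by (rule E_\<zeta>) measurable

end

text \<open>One bandwidth is fixed; \<open>S\<close> and \<open>C1\<close> record what is known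
  about the smoothed density at it, so the moment bounds display their dependence on both.\<close>

locale bounded_smoothing = localized_kernel \<mu> k f u \<zeta> w N \<beta> \<sigma>2 C2 A
  for \<mu> :: "'x measure" and k and f :: "'e::euclidean_space \<Rightarrow> real"
    and u :: "'x \<Rightarrow> 'a::{real_inner, banach, second_countable_topology}" and \<zeta>
    and w :: "'x \<Rightarrow> 'b::{real_inner, banach, second_countable_topology}" and N \<beta> \<sigma>2 C2 A +
  fixes h S C1 :: real
  assumes h: "0 < h" and S: "\<And>z. conv h z \<le> S" and C1: "(LINT z|lborel. f z * conv h z) \<le> C1 * h ^ DIM('e)"
begin

lemma S_nonneg: "0 \<le> S" using order_trans[OF conv_nonneg S] .
text \<open>The overlap of two smoothing windows: \<open>G\<close> stripped of the residuals and of
  the factor in \<open>w\<close>. It is of order \<open>S\<close> pointwise and of order S h^d on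
  average.\<close>

definition \<Gamma> :: "'e \<Rightarrow> 'e \<Rightarrow> real" where "\<Gamma> z z' = (\<integral>v. L h z (\<zeta> v) * L h z' (\<zeta> v) \<partial>\<mu>)"

lemma LL_le: "0 \<le> L h z a * L h z' a" "L h z a * L h z' a \<le> \<kappa>0 * L h z' a" "L h z a * L h z' a \<le> \<kappa>0 * \<kappa>0"
proof -
  show "0 \<le> L h z a * L h z' a" using L_nonneg by simp
  show 1: "L h z a * L h z' a \<le> \<kappa>0 * L h z' a" using L_nonneg L_le by (intro mult_right_mono)
  have "\<kappa>0 * L h z' a \<le> \<kappa>0 * \<kappa>0" using L_le \<kappa>0_pos by (intro mult_left_mono) auto
  with 1 show "L h z a * L h z' a \<le> \<kappa>0 * \<kappa>0" by simp
qed

lemma \<Gamma>_meas[measurable]: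
  assumes [measurable]: "a \<in> borel_measurable N'" "b \<in> borel_measurable N'"
  shows "(\<lambda>x. \<Gamma> (a x) (b x)) \<in> borel_measurable N'"
  unfolding \<Gamma>_def by measurable

lemma \<Gamma>_nonneg: "0 \<le> \<Gamma> z z'"
  unfolding \<Gamma>_def by (intro Bochner_Integration.integral_nonneg LL_le)

lemma L_int: "integrable \<mu> (\<lambda>y. L h z (\<zeta> y))"
  by (rule norm_u2_bounded_int(2)[of _ \<kappa>0]) (auto simp: L_nonneg L_le)

lemma LL_int: "integrable \<mu> (\<lambda>v. L h z (\<zeta> v) * L h z' (\<zeta> v))"
  by (rule norm_u2_bounded_int(2)[of _ "\<kappa>0 * \<kappa>0"]) (auto simp: LL_le)

lemma \<Gamma>_le: "\<Gamma> z z' \<le> \<kappa>0 * S"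
proof -
  have "\<Gamma> z z' \<le> (\<integral>v. \<kappa>0 * L h z' (\<zeta> v) \<partial>\<mu>)"
    unfolding \<Gamma>_def using LL_int L_int LL_le by (intro integral_mono) auto
  also have "\<dots> \<le> \<kappa>0 * S" using S \<kappa>0_pos by (simp add: E_L)
  finally show ?thesis .
qed

text \<open>By Fubini the left side is the mean of the square of \<open>conv h\<close> at \<zeta>;
  one factor is bounded by \<open>S\<close>, the other is averaged.\<close>

lemma E_\<Gamma>: "(\<integral>x. (\<integral>y. \<Gamma> (\<zeta> x) (\<zeta> y) \<partial>\<mu>) \<partial>\<mu>) \<le> S * (C1 * h ^ DIM('e))"
proof -
  have sym: "(\<integral>y. L h (\<zeta> y) z \<partial>\<mu>) = conv h z" for z
    unfolding E_L[symmetric] by (intro Bochner_Integration.integral_cong refl L_sym)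
  have i2: "integrable (\<mu> \<Otimes>\<^sub>M \<mu>) F" if "F \<in> borel_measurable (\<mu> \<Otimes>\<^sub>M \<mu>)" "\<And>p. \<bar>F p\<bar> \<le> B" for F :: "_ \<Rightarrow> real" and B
  proof -
    interpret PP: prob_space "\<mu> \<Otimes>\<^sub>M \<mu>" by (rule prob_space_pair) (rule prob_space_axioms)+
    show ?thesis using that by (intro PP.integrable_const_bound[of _ B]) auto
  qed
  have sw: "(\<integral>y. (\<integral>v. L h (\<zeta> x) (\<zeta> v) * L h (\<zeta> y) (\<zeta> v) \<partial>\<mu>) \<partial>\<mu>) = (\<integral>v. L h (\<zeta> x) (\<zeta> v) * conv h (\<zeta> v) \<partial>\<mu>)" if [measurable]: "x \<in> space \<mu>" for x
  proof -
    have "(\<integral>y. (\<integral>v. L h (\<zeta> x) (\<zeta> v) * L h (\<zeta> y) (\<zeta> v) \<partial>\<mu>) \<partial>\<mu>) = (\<integral>v. (\<integral>y. L h (\<zeta> x) (\<zeta> v) * L h (\<zeta> y) (\<zeta> v) \<partial>\<mu>) \<partial>\<mu>)"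
      by (rule \<mu>2.Fubini_integral, rule i2[of _ "\<kappa>0 * \<kappa>0"]) (measurable, auto simp: LL_le)
    then show ?thesis by (simp add: sym)
  qed
  have Lc_le: "L h z a * conv h a \<le> \<kappa>0 * S" for z a
    using L_le S conv_nonneg L_nonneg \<kappa>0_pos by (intro mult_mono) auto
  have "(\<integral>x. (\<integral>y. \<Gamma> (\<zeta> x) (\<zeta> y) \<partial>\<mu>) \<partial>\<mu>) = (\<integral>x. (\<integral>v. L h (\<zeta> x) (\<zeta> v) * conv h (\<zeta> v) \<partial>\<mu>) \<partial>\<mu>)"
    unfolding \<Gamma>_def by (intro Bochner_Integration.integral_cong refl sw)
  also have "\<dots> = (\<integral>v. (\<integral>x. L h (\<zeta> x) (\<zeta> v) * conv h (\<zeta> v) \<partial>\<mu>) \<partial>\<mu>)"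
    by (rule \<mu>2.Fubini_integral, rule i2[of _ "\<kappa>0 * S"])
       (measurable, auto simp: Lc_le L_nonneg conv_nonneg abs_mult)
  also have "\<dots> = (\<integral>v. conv h (\<zeta> v) * conv h (\<zeta> v) \<partial>\<mu>)" by (simp add: sym)
  also have "\<dots> = (LINT z|lborel. f z * (conv h z * conv h z))" by (rule E_\<zeta>) measurable
  also have "\<dots> \<le> (LINT z|lborel. S * (f z * conv h z))"
  proof (rule order_trans[OF abs_ge_self], unfold real_norm_def[symmetric], rule norm_integral_le_AE)
    show "integrable lborel (\<lambda>z. S * (f z * conv h z))" using f_conv_int(1)[OF h S] by simp
    have "f z * conv h z * conv h z \<le> f z * conv h z * S" for z
      using S f_nonneg conv_nonneg by (intro mult_left_mono) auto
    then show "AE z in lborel. norm (f z * (conv h z * conv h z)) \<le> S * (f z * conv h z)"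
      by (auto simp: abs_mult f_nonneg conv_nonneg mult_ac)
  qed measurable
  also have "\<dots> \<le> S * (C1 * h ^ DIM('e))" using C1 S_nonneg by (simp add: mult_left_mono)
  finally show ?thesis .
qed

end

locale finite_bounded_smoothing = bounded_smoothing \<mu> k f u \<zeta> w N \<beta> \<sigma>2 C2 A h S C1
  for \<mu> :: "'x measure" and k and f :: "'e::euclidean_space \<Rightarrow> real"
    and u :: "'x \<Rightarrow> 'a::{real_inner, banach, second_countable_topology}" and \<zeta>
    and w :: "'x \<Rightarrow> 'b::{real_inner, banach, second_countable_topology}" and N \<beta> \<sigma>2 C2 A h S C1 +
  fixes I :: "'i set" assumes I_finite: "finite I"
begin

sublocale D: degenerate_kernel \<mu> "H h" I
  by (rule degenerate_kernel_H) (rule I_finite)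

text \<open>The residuals enter to the fourth power, where no conditional bound is at hand, so the
  localization is bounded by its maximum.\<close>

lemma m4_le: "D.m4 \<le> \<kappa>0 ^ 4 * M4\<^sup>2"
proof -
  have "D.m4 \<le> (\<integral>x. \<kappa>0 ^ 4 * norm (u x) ^ 4 * M4 \<partial>\<mu>)"
    unfolding D.m4_def
  proof (intro integral_mono)
    show "integrable \<mu> (\<lambda>x. \<integral>y. H h x y ^ 4 \<partial>\<mu>)" by (rule D.H4_int)
    show "integrable \<mu> (\<lambda>x. \<kappa>0 ^ 4 * norm (u x) ^ 4 * M4)" using u4 by simp
    fix x assume x: "x \<in> space \<mu>"
    have "(\<integral>y. H h x y ^ 4 \<partial>\<mu>) \<le> (\<integral>y. \<kappa>0 ^ 4 * norm (u x) ^ 4 * norm (u y) ^ 4 \<partial>\<mu>)"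
      using u4 H4_le D.H4x[OF x] by (intro integral_mono) auto
    then show "(\<integral>y. H h x y ^ 4 \<partial>\<mu>) \<le> \<kappa>0 ^ 4 * norm (u x) ^ 4 * M4" by (simp add: M4_def)
  qed
  then show ?thesis by (simp add: M4_def[symmetric] power2_eq_square mult.assoc)
qed

text \<open>One factor of the squared localization is bounded by \<open>\<kappa>0\<close>. The
  conditional second moment replaces the inner residual by \<open>C2\<close>, and what is left is
  the smoothed density, at most \<open>S\<close>.\<close>

lemma a_le: "D.a x \<le> (norm (u x))\<^sup>2 * (\<kappa>0 * C2 * S)" if x: "x \<in> space \<mu>"
proof -
  have le: "(H h x y)\<^sup>2 \<le> (norm (u x))\<^sup>2 * \<kappa>0 * ((norm (u y))\<^sup>2 * L h (\<zeta> x) (\<zeta> y))" for y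
  proof -
    have "\<bar>H h x y\<bar>\<^sup>2 \<le> (norm (u x) * norm (u y) * L h (\<zeta> x) (\<zeta> y))\<^sup>2"
      using abs_H_le by (intro power_mono) auto
    also have "\<dots> = (norm (u x))\<^sup>2 * (norm (u y))\<^sup>2 * (L h (\<zeta> x) (\<zeta> y) * L h (\<zeta> x) (\<zeta> y))"
      by (simp add: power_mult_distrib power2_eq_square)
    also have "\<dots> \<le> (norm (u x))\<^sup>2 * (norm (u y))\<^sup>2 * (\<kappa>0 * L h (\<zeta> x) (\<zeta> y))"
      using LL_le by (intro mult_left_mono) auto
    finally show ?thesis by (simp add: mult_ac)
  qed
  have i: "integrable \<mu> (\<lambda>y. (norm (u y))\<^sup>2 * L h (\<zeta> x) (\<zeta> y))"
    by (rule norm_u2_bounded_int(1)[of _ \<kappa>0]) (use x in \<open>auto simp: L_nonneg L_le\<close>)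
  have "D.a x \<le> (\<integral>y. (norm (u x))\<^sup>2 * \<kappa>0 * ((norm (u y))\<^sup>2 * L h (\<zeta> x) (\<zeta> y)) \<partial>\<mu>)"
    unfolding D.a_def using le i D.H2x[OF x] by (intro integral_mono) auto
  also have "\<dots> \<le> (norm (u x))\<^sup>2 * \<kappa>0 * (C2 * S)"
  proof -
    have "(\<integral>y. (norm (u y))\<^sup>2 * L h (\<zeta> x) (\<zeta> y) \<partial>\<mu>) \<le> C2 * (\<integral>y. L h (\<zeta> x) (\<zeta> y) \<partial>\<mu>)"
      by (rule u2_le[of _ \<kappa>0]) (auto simp: L_nonneg L_le)
    also have "\<dots> \<le> C2 * S" using S C2 by (simp add: E_L)
    finally have "(\<integral>y. (norm (u y))\<^sup>2 * L h (\<zeta> x) (\<zeta> y) \<partial>\<mu>) \<le> C2 * S" .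
    then show ?thesis using \<kappa>0_pos unfolding integral_mult_right_zero by (intro mult_left_mono) auto
  qed
  finally show ?thesis by (simp add: mult_ac)
qed

lemma b_le: "D.b \<le> M4 * (\<kappa>0 * C2 * S)\<^sup>2"
proof -
  have "D.b \<le> (\<integral>x. norm (u x) ^ 4 * (\<kappa>0 * C2 * S)\<^sup>2 \<partial>\<mu>)"
    unfolding D.b_def
  proof (intro integral_mono)
    show "integrable \<mu> (\<lambda>x. (D.a x)\<^sup>2)" by (rule D.a2_int)
    show "integrable \<mu> (\<lambda>x. norm (u x) ^ 4 * (\<kappa>0 * C2 * S)\<^sup>2)" using u4 by simp
    fix x assume x: "x \<in> space \<mu>"
    have "(D.a x)\<^sup>2 \<le> ((norm (u x))\<^sup>2 * (\<kappa>0 * C2 * S))\<^sup>2" using a_le[OF x] D.a_nonneg by (intro power_mono)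
    then show "(D.a x)\<^sup>2 \<le> norm (u x) ^ 4 * (\<kappa>0 * C2 * S)\<^sup>2" by (simp add: power_mult_distrib flip: power_mult)
  qed
  then show ?thesis by (simp add: M4_def)
qed

lemma abs_G_le: "\<bar>D.G x y\<bar> \<le> norm (u x) * norm (u y) * (C2 * \<Gamma> (\<zeta> x) (\<zeta> y))" if x: "x \<in> space \<mu>" "y \<in> space \<mu>"
proof -
  let ?l = "\<lambda>v. L h (\<zeta> x) (\<zeta> v) * L h (\<zeta> y) (\<zeta> v)"
  have i: "integrable \<mu> (\<lambda>v. (norm (u v))\<^sup>2 * ?l v)"
    by (rule norm_u2_bounded_int(1)[of _ "\<kappa>0 * \<kappa>0"]) (auto simp: LL_le)
  have le: "\<bar>H h x v * H h y v\<bar> \<le> norm (u x) * norm (u y) * ((norm (u v))\<^sup>2 * ?l v)" for v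
  proof -
    have "\<bar>H h x v\<bar> * \<bar>H h y v\<bar> \<le> (norm (u x) * norm (u v) * L h (\<zeta> x) (\<zeta> v)) * (norm (u y) * norm (u v) * L h (\<zeta> y) (\<zeta> v))"
      using abs_H_le L_nonneg by (intro mult_mono) auto
    then show ?thesis by (simp add: abs_mult power2_eq_square mult_ac)
  qed
  have "norm (D.G x y) \<le> (\<integral>v. norm (u x) * norm (u y) * ((norm (u v))\<^sup>2 * ?l v) \<partial>\<mu>)"
    unfolding D.G_def using i le D.H_comp_meas[OF measurable_const[OF x(1)] measurable_ident] D.H_comp_meas[OF measurable_const[OF x(2)] measurable_ident]
    by (intro norm_integral_le_AE) auto
  also have "\<dots> = norm (u x) * norm (u y) * (\<integral>v. (norm (u v))\<^sup>2 * ?l v \<partial>\<mu>)" by simp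
  also have "\<dots> \<le> norm (u x) * norm (u y) * (C2 * \<Gamma> (\<zeta> x) (\<zeta> y))"
    unfolding \<Gamma>_def
    by (intro mult_left_mono u2_le[of "\<lambda>z. L h (\<zeta> x) z * L h (\<zeta> y) z" "\<kappa>0 * \<kappa>0"]) (auto simp: LL_le)
  finally show ?thesis by simp
qed

text \<open>Of the squared \<open>\<Gamma>\<close> one factor is bounded by \<kappa>0 S and the
  other is kept. Integrating over \<open>y\<close> and then over \<open>x\<close> removes the
  residuals at the cost of one \<open>C2\<close> each, and the mean of \<open>\<Gamma>\<close>
  supplies the remaining S h^d.\<close>

lemma g4_le: "D.g4 \<le> C2 ^ 4 * \<kappa>0 * S\<^sup>2 * (C1 * h ^ DIM('e))"
proof -
  let ?c = "C2\<^sup>2 * (\<kappa>0 * S)"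
  have c: "0 \<le> ?c" using C2 \<kappa>0_pos S_nonneg by simp
  define \<gamma> where "\<gamma> z = (\<integral>y. \<Gamma> z (\<zeta> y) \<partial>\<mu>)" for z
  have [measurable]: "\<gamma> \<in> borel_measurable borel" unfolding \<gamma>_def[abs_def] by measurable
  have \<gamma>0: "0 \<le> \<gamma> z" for z unfolding \<gamma>_def by (intro Bochner_Integration.integral_nonneg \<Gamma>_nonneg)
  have \<Gamma>i: "integrable \<mu> (\<lambda>y. \<Gamma> z (\<zeta> y))" for z
    by (rule norm_u2_bounded_int(2)[of _ "\<kappa>0 * S"]) (auto simp: \<Gamma>_nonneg \<Gamma>_le)
  have \<gamma>1: "\<gamma> z \<le> \<kappa>0 * S" for z
  proof -
    have "\<gamma> z \<le> (\<integral>y. \<kappa>0 * S \<partial>\<mu>)" unfolding \<gamma>_def using \<Gamma>i \<Gamma>_le by (intro integral_mono) auto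
    then show ?thesis by (simp add: prob_space)
  qed
  have 1: "(\<integral>y. (D.G x y)\<^sup>2 \<partial>\<mu>) \<le> ?c * C2 * ((norm (u x))\<^sup>2 * \<gamma> (\<zeta> x))" if x: "x \<in> space \<mu>" for x
  proof -
    have i: "integrable \<mu> (\<lambda>y. (norm (u y))\<^sup>2 * \<Gamma> (\<zeta> x) (\<zeta> y))"
      by (rule norm_u2_bounded_int(1)[of _ "\<kappa>0 * S"]) (auto simp: \<Gamma>_nonneg \<Gamma>_le)
    have le: "(D.G x y)\<^sup>2 \<le> ?c * (norm (u x))\<^sup>2 * ((norm (u y))\<^sup>2 * \<Gamma> (\<zeta> x) (\<zeta> y))" if y: "y \<in> space \<mu>" for y
    proof -
      have "\<bar>D.G x y\<bar>\<^sup>2 \<le> (norm (u x) * norm (u y) * (C2 * \<Gamma> (\<zeta> x) (\<zeta> y)))\<^sup>2"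
        using abs_G_le[OF x y] by (intro power_mono) auto
      also have "\<dots> = C2\<^sup>2 * (norm (u x))\<^sup>2 * (norm (u y))\<^sup>2 * (\<Gamma> (\<zeta> x) (\<zeta> y) * \<Gamma> (\<zeta> x) (\<zeta> y))"
        by (simp add: power_mult_distrib power2_eq_square)
      also have "\<dots> \<le> C2\<^sup>2 * (norm (u x))\<^sup>2 * (norm (u y))\<^sup>2 * (\<kappa>0 * S * \<Gamma> (\<zeta> x) (\<zeta> y))"
        using \<Gamma>_le \<Gamma>_nonneg by (intro mult_left_mono mult_right_mono) auto
      finally show ?thesis by (simp add: mult_ac)
    qed
    have "(\<integral>y. (D.G x y)\<^sup>2 \<partial>\<mu>) \<le> (\<integral>y. ?c * (norm (u x))\<^sup>2 * ((norm (u y))\<^sup>2 * \<Gamma> (\<zeta> x) (\<zeta> y)) \<partial>\<mu>)"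
    proof (rule order_trans[OF abs_ge_self], unfold real_norm_def[symmetric], rule norm_integral_le_AE)
      show "integrable \<mu> (\<lambda>y. ?c * (norm (u x))\<^sup>2 * ((norm (u y))\<^sup>2 * \<Gamma> (\<zeta> x) (\<zeta> y)))" using i by simp
      show "(\<lambda>y. (D.G x y)\<^sup>2) \<in> borel_measurable \<mu>"
        using x by (intro borel_measurable_power D.G_meas) auto
      show "AE y in \<mu>. norm ((D.G x y)\<^sup>2) \<le> ?c * (norm (u x))\<^sup>2 * ((norm (u y))\<^sup>2 * \<Gamma> (\<zeta> x) (\<zeta> y))"
        using le by (intro AE_I2) simp
    qed
    also have "\<dots> = ?c * (norm (u x))\<^sup>2 * (\<integral>y. (norm (u y))\<^sup>2 * \<Gamma> (\<zeta> x) (\<zeta> y) \<partial>\<mu>)" by (rule integral_mult_right_zero)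
    also have "\<dots> \<le> ?c * (norm (u x))\<^sup>2 * (C2 * \<gamma> (\<zeta> x))"
      unfolding \<gamma>_def using c by (intro mult_left_mono u2_le[of _ "\<kappa>0 * S"]) (auto simp: \<Gamma>_nonneg \<Gamma>_le)
    finally show ?thesis by (simp add: mult_ac)
  qed
  have i: "integrable \<mu> (\<lambda>x. (norm (u x))\<^sup>2 * \<gamma> (\<zeta> x))"
    by (rule norm_u2_bounded_int(1)[of _ "\<kappa>0 * S"]) (auto simp: \<gamma>0 \<gamma>1)
  have "D.g4 \<le> (\<integral>x. ?c * C2 * ((norm (u x))\<^sup>2 * \<gamma> (\<zeta> x)) \<partial>\<mu>)"
    unfolding D.g4_def
  proof (rule order_trans[OF abs_ge_self], unfold real_norm_def[symmetric], rule norm_integral_le_AE)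
    show "integrable \<mu> (\<lambda>x. ?c * C2 * ((norm (u x))\<^sup>2 * \<gamma> (\<zeta> x)))" using i by simp
    show "AE x in \<mu>. norm (\<integral>y. (D.G x y)\<^sup>2 \<partial>\<mu>) \<le> ?c * C2 * ((norm (u x))\<^sup>2 * \<gamma> (\<zeta> x))"
      using 1 by (intro AE_I2) simp
  qed measurable
  also have "\<dots> = ?c * C2 * (\<integral>x. (norm (u x))\<^sup>2 * \<gamma> (\<zeta> x) \<partial>\<mu>)" by (rule integral_mult_right_zero)
  also have "\<dots> \<le> ?c * C2 * (C2 * (\<integral>x. \<gamma> (\<zeta> x) \<partial>\<mu>))"
    using c C2 by (intro mult_left_mono u2_le[of _ "\<kappa>0 * S"]) (auto simp: \<gamma>0 \<gamma>1)
  also have "\<dots> \<le> ?c * C2 * (C2 * (S * (C1 * h ^ DIM('e))))"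
    using E_\<Gamma> c C2 unfolding \<gamma>_def by (intro mult_left_mono) auto
  finally show ?thesis by (simp add: power2_eq_square mult_ac eval_nat_numeral)
qed

end

section \<open>Lower bound on the second moment and the limit theorem\<close>

context localized_kernel
begin

text \<open>On this event the positions lie in a ball, so that they can be compared with its volume,
  and the exponential factor in \<open>w\<close> is bounded away from 0.\<close>

lemma concentrated:
  obtains R where "0 \<le> R" "1/2 \<le> prob {x \<in> space \<mu>. norm (\<zeta> x) \<le> R \<and> norm (w x) \<le> R}"
proof -
  let ?E = "\<lambda>n::nat. {x \<in> space \<mu>. norm (\<zeta> x) \<le> real n \<and> norm (w x) \<le> real n}"
  have "(\<lambda>n. prob (?E n)) \<longlonglongrightarrow> prob (\<Union>n. ?E n)"
    by (rule finite_Lim_measure_incseq) (auto simp: incseq_def intro: order_trans)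
  also have "(\<Union>n. ?E n) = space \<mu>"
  proof safe
    fix x assume "x \<in> space \<mu>"
    moreover obtain n where "max (norm (\<zeta> x)) (norm (w x)) \<le> real n" using real_arch_simple by blast
    ultimately show "x \<in> (\<Union>n. ?E n)" by auto
  qed
  finally have "\<forall>\<^sub>F n in sequentially. 1/2 < prob (?E n)"
    using prob_space by (intro order_tendstoD(1)) auto
  then obtain n where "1/2 < prob (?E n)" by (auto dest: eventually_happens)
  then show thesis by (intro that[of "real n"]) auto
qed

text \<open>The lower bound on the kernel fails at most on a Lebesgue null set. Since \<zeta> has a
  density, it holds for almost every \<open>y\<close> at each fixed \<open>z\<close>.\<close>

lemma L_ge_AE:
  assumes AE: "AE z in lborel. norm (z::'e) \<le> r \<longrightarrow> \<delta> \<le> kE z" and h: "0 < h"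
  shows "AE y in \<mu>. norm (z - \<zeta> y) \<le> r * h \<longrightarrow> \<delta> \<le> L h z (\<zeta> y)"
proof -
  let ?P = "\<lambda>z::'e. norm z \<le> r \<longrightarrow> \<delta> \<le> kE z"
  have d: "distr \<mu> lborel \<zeta> = density lborel (\<lambda>z. ennreal (f z))"
    using \<zeta>_density by (rule distributed_distr_eq_density)
  have "AE x in lborel. ?P (z /\<^sub>R h + (- 1 / h) *\<^sub>R x)"
    by (rule AE_lborel_affine[OF _ _ AE]) (use h in auto)
  then have "AE x in density lborel (\<lambda>z. ennreal (f z)). ?P (z /\<^sub>R h + (- 1 / h) *\<^sub>R x)"
    by (subst AE_density) auto
  then have "AE y in \<mu>. ?P (z /\<^sub>R h + (- 1 / h) *\<^sub>R \<zeta> y)"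
    unfolding d[symmetric] by (rule AE_distrD[rotated]) simp
  then show ?thesis
  proof eventually_elim
    case (elim y)
    have eq: "z /\<^sub>R h + (- 1 / h) *\<^sub>R \<zeta> y = (z - \<zeta> y) /\<^sub>R h"
      by (simp add: scaleR_diff_right divide_inverse)
    have "norm (z - \<zeta> y) / h \<le> r" if "norm (z - \<zeta> y) \<le> r * h"
      using that h by (simp add: divide_le_eq)
    then show ?case using elim h unfolding eq L_def by (simp add: divide_inverse mult.commute)
  qed
qed

text \<open>Nondegeneracy removes the residuals. On pairs from the bounded event at distance at most
  r h both localizing factors are bounded below, and \<open>close_pairs_lower_bound\<close>
  estimates the probability of such pairs.\<close>

lemma second_moment_lower_bound:
  obtains c h0 where "0 < c" "0 < h0"
    "\<And>h. 0 < h \<Longrightarrow> h \<le> h0 \<Longrightarrow> c * h ^ DIM('e) \<le> (\<integral>x. (\<integral>y. (H h x y)\<^sup>2 \<partial>\<mu>) \<partial>\<mu>)"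
proof -
  obtain R where R: "0 \<le> R" "1/2 \<le> prob {x \<in> space \<mu>. norm (\<zeta> x) \<le> R \<and> norm (w x) \<le> R}"
    by (rule concentrated)
  obtain r \<delta> where r: "0 < r" "0 < \<delta>" "AE z in lborel. norm (z::'e) \<le> r \<longrightarrow> \<delta> \<le> kE z"
    by (rule kE_ge_near_0)
  define E where "E = {x \<in> space \<mu>. norm (\<zeta> x) \<le> R \<and> norm (w x) \<le> R}"
  have [measurable]: "E \<in> sets \<mu>" unfolding E_def by measurable
  \<comment> \<open>On the event the difference of two \<open>w\<close> values has norm at most 2 R.
    The exponent carries no half because the factor \<open>\<Psi>\<close> occurs squared.\<close>
  define e0 where "e0 = exp (- (\<bar>A\<bar> * (2 * R)\<^sup>2))"
  define c where "c = \<sigma>2 * (\<delta>\<^sup>2 * e0 * (1/4 * (r / (2 * (R + 1))) ^ DIM('e)))"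
  have c: "0 < c" unfolding c_def e0_def using \<sigma>2 r R by simp
  show thesis
  proof (rule that[OF c])
    show "0 < 2 / r" using r by simp
    fix h :: real assume h: "0 < h" "h \<le> 2 / r"
    \<comment> \<open>Then 2 \<rho> = r h is the range in which the kernel is at least \<delta>, and
      h <= 2 / r is the condition \<rho> <= 1.\<close>
    define \<rho> where "\<rho> = r * h / 2"
    have \<rho>: "0 < \<rho>" "\<rho> \<le> 1" unfolding \<rho>_def using r h by (auto simp: field_simps)
    define q where "q x y = (if x \<in> E \<and> y \<in> E \<and> norm (\<zeta> x - \<zeta> y) \<le> 2 * \<rho> then 1 else 0 :: real)" for x y
    have q_meas[measurable]: "(\<lambda>p. q (a p) (b p)) \<in> borel_measurable K" if [measurable]: "a \<in> measurable K \<mu>" "b \<in> measurable K \<mu>"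
      for a b and K :: "'z measure" unfolding q_def by measurable
    have q01: "0 \<le> q x y" "q x y \<le> 1" for x y unfolding q_def by auto
    have q_int: "integrable \<mu> (q x)" if "x \<in> space \<mu>" for x
      by (rule integrable_const_bound[of _ 1]) (use that q01 in auto)
    have q_int2: "integrable \<mu> (\<lambda>x. \<integral>y. q x y \<partial>\<mu>)"
    proof (rule integrable_const_bound[of _ 1])
      show "AE x in \<mu>. norm (\<integral>y. q x y \<partial>\<mu>) \<le> 1"
      proof (rule AE_I2)
        fix x assume x: "x \<in> space \<mu>"
        have "norm (\<integral>y. q x y \<partial>\<mu>) \<le> (\<integral>y. 1 \<partial>\<mu>)"
          using q01 q_int[OF x] by (intro norm_integral_le_AE) auto
        then show "norm (\<integral>y. q x y \<partial>\<mu>) \<le> 1" by (simp add: prob_space)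
      qed
    qed measurable
    have 3: "(prob E)\<^sup>2 * (\<rho> / (R + 1)) ^ DIM('e) \<le> (\<integral>x. (\<integral>y. q x y \<partial>\<mu>) \<partial>\<mu>)"
    proof -
      have "ennreal ((prob E)\<^sup>2 * (\<rho> / (R + 1)) ^ DIM('e))
        \<le> (\<integral>\<^sup>+x. (\<integral>\<^sup>+y. (if x \<in> E \<and> y \<in> E \<and> norm (\<zeta> x - \<zeta> y) \<le> 2 * \<rho> then 1 else 0) \<partial>\<mu>) \<partial>\<mu>)"
        by (rule close_pairs_lower_bound) (use R \<rho> in \<open>auto simp: E_def\<close>)
      also have "\<dots> = (\<integral>\<^sup>+x. ennreal (\<integral>y. q x y \<partial>\<mu>) \<partial>\<mu>)"
      proof (rule nn_integral_cong)
        fix x assume x: "x \<in> space \<mu>"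
        have "(\<integral>\<^sup>+y. (if x \<in> E \<and> y \<in> E \<and> norm (\<zeta> x - \<zeta> y) \<le> 2 * \<rho> then 1 else 0) \<partial>\<mu>) = (\<integral>\<^sup>+y. ennreal (q x y) \<partial>\<mu>)"
          by (intro nn_integral_cong) (auto simp: q_def)
        also have "\<dots> = ennreal (\<integral>y. q x y \<partial>\<mu>)" using q_int[OF x] q01 by (intro nn_integral_eq_integral) auto
        finally show "(\<integral>\<^sup>+y. (if x \<in> E \<and> y \<in> E \<and> norm (\<zeta> x - \<zeta> y) \<le> 2 * \<rho> then 1 else 0) \<partial>\<mu>) = ennreal (\<integral>y. q x y \<partial>\<mu>)" .
      qed
      also have "\<dots> = ennreal (\<integral>x. (\<integral>y. q x y \<partial>\<mu>) \<partial>\<mu>)"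
        using q_int2 q01 by (intro nn_integral_eq_integral) (auto intro!: Bochner_Integration.integral_nonneg)
      finally show ?thesis
        using q01 by (subst (asm) ennreal_le_iff) (auto intro!: Bochner_Integration.integral_nonneg)
    qed
    define \<Phi> where "\<Phi> p = (L h (fst (fst p)) (fst (snd p)) * \<Psi> (snd (fst p)) (snd (snd p)))\<^sup>2" for p
    have \<Phi>_meas: "\<Phi> \<in> borel_measurable borel"
      unfolding \<Phi>_def[abs_def] borel_prod[symmetric] by measurable
    have \<Phi>_le: "0 \<le> \<Phi> p" "\<Phi> p \<le> \<kappa>0\<^sup>2" for p
      unfolding \<Phi>_def using L\<Psi>_le by (auto intro!: power_mono)
    have \<Phi>_int: "integrable \<mu> (\<lambda>y. \<Phi> ((\<zeta> x, w x), (\<zeta> y, w y)))" for x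
    proof (rule integrable_const_bound[of _ "\<kappa>0\<^sup>2"])
      show "(\<lambda>y. \<Phi> ((\<zeta> x, w x), (\<zeta> y, w y))) \<in> borel_measurable \<mu>" unfolding \<Phi>_def by simp
    qed (use \<Phi>_le in auto)
    have \<Phi>_int2: "integrable \<mu> (\<lambda>x. \<integral>y. \<Phi> ((\<zeta> x, w x), (\<zeta> y, w y)) \<partial>\<mu>)"
    proof (rule integrable_const_bound[of _ "\<kappa>0\<^sup>2"])
      show "AE x in \<mu>. norm (\<integral>y. \<Phi> ((\<zeta> x, w x), (\<zeta> y, w y)) \<partial>\<mu>) \<le> \<kappa>0\<^sup>2"
      proof (rule AE_I2)
        fix x
        have "norm (\<integral>y. \<Phi> ((\<zeta> x, w x), (\<zeta> y, w y)) \<partial>\<mu>) \<le> (\<integral>y. \<kappa>0\<^sup>2 \<partial>\<mu>)"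
          using \<Phi>_le \<Phi>_int[of x] by (intro norm_integral_le_AE) auto
        then show "norm (\<integral>y. \<Phi> ((\<zeta> x, w x), (\<zeta> y, w y)) \<partial>\<mu>) \<le> \<kappa>0\<^sup>2" by (simp add: prob_space)
      qed
      show "(\<lambda>x. \<integral>y. \<Phi> ((\<zeta> x, w x), (\<zeta> y, w y)) \<partial>\<mu>) \<in> borel_measurable \<mu>" unfolding \<Phi>_def by simp
    qed
    have pt: "\<delta>\<^sup>2 * e0 * q x y \<le> \<Phi> ((\<zeta> x, w x), (\<zeta> y, w y))"
      if L: "norm (\<zeta> x - \<zeta> y) \<le> r * h \<longrightarrow> \<delta> \<le> L h (\<zeta> x) (\<zeta> y)" for x y
    proof (cases "x \<in> E \<and> y \<in> E \<and> norm (\<zeta> x - \<zeta> y) \<le> 2 * \<rho>")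
      case True
      then have "\<delta> \<le> L h (\<zeta> x) (\<zeta> y)" using L by (simp add: \<rho>_def)
      then have L2: "\<delta>\<^sup>2 \<le> (L h (\<zeta> x) (\<zeta> y))\<^sup>2" using r by (intro power_mono) auto
      have "norm (w x - w y) \<le> 2 * R" using True norm_triangle_ineq4[of "w x" "w y"] by (auto simp: E_def)
      then have "(norm (w x - w y))\<^sup>2 \<le> (2 * R)\<^sup>2" by (intro power_mono) auto
      then have "A * (norm (w x - w y))\<^sup>2 \<le> \<bar>A\<bar> * (2 * R)\<^sup>2" by (intro mult_mono) auto
      then have "N (w x - w y) \<le> \<bar>A\<bar> * (2 * R)\<^sup>2" using N_le[of "w x - w y"] by linarith
      then have "e0 \<le> exp (- N (w x - w y))" unfolding e0_def by simp
      also have "\<dots> = (\<Psi> (w x) (w y))\<^sup>2" unfolding \<Psi>_def by (simp add: power2_eq_square flip: exp_add)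
      finally have "\<delta>\<^sup>2 * e0 \<le> (L h (\<zeta> x) (\<zeta> y))\<^sup>2 * (\<Psi> (w x) (w y))\<^sup>2"
        using L2 by (intro mult_mono) (auto simp: e0_def)
      then show ?thesis using True by (simp add: q_def \<Phi>_def power_mult_distrib)
    next
      case False
      then have "q x y = 0" unfolding q_def by auto
      then show ?thesis using \<Phi>_le(1) by simp
    qed
    have 2: "\<delta>\<^sup>2 * e0 * (\<integral>x. (\<integral>y. q x y \<partial>\<mu>) \<partial>\<mu>) \<le> (\<integral>x. (\<integral>y. \<Phi> ((\<zeta> x, w x), (\<zeta> y, w y)) \<partial>\<mu>) \<partial>\<mu>)"
      proof -
      have "(\<integral>x. (\<integral>y. \<delta>\<^sup>2 * e0 * q x y \<partial>\<mu>) \<partial>\<mu>) \<le> (\<integral>x. (\<integral>y. \<Phi> ((\<zeta> x, w x), (\<zeta> y, w y)) \<partial>\<mu>) \<partial>\<mu>)"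
    proof (rule integral_mono)
      show "integrable \<mu> (\<lambda>x. \<integral>y. \<delta>\<^sup>2 * e0 * q x y \<partial>\<mu>)" using q_int2 by simp
      fix x assume x: "x \<in> space \<mu>"
      show "(\<integral>y. \<delta>\<^sup>2 * e0 * q x y \<partial>\<mu>) \<le> (\<integral>y. \<Phi> ((\<zeta> x, w x), (\<zeta> y, w y)) \<partial>\<mu>)"
      proof (rule integral_mono_AE)
        show "integrable \<mu> (\<lambda>y. \<delta>\<^sup>2 * e0 * q x y)" using q_int[OF x] by simp
        show "AE y in \<mu>. \<delta>\<^sup>2 * e0 * q x y \<le> \<Phi> ((\<zeta> x, w x), (\<zeta> y, w y))"
          using L_ge_AE[OF r(3) h(1), of "\<zeta> x"] by eventually_elim (rule pt)
      qed (rule \<Phi>_int)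
    qed (rule \<Phi>_int2)
      then show ?thesis by simp
    qed
    have "c * h ^ DIM('e) = \<sigma>2 * (\<delta>\<^sup>2 * e0 * ((1/2)\<^sup>2 * (\<rho> / (R + 1)) ^ DIM('e)))"
    proof -
      have "\<rho> / (R + 1) = r / (2 * (R + 1)) * h" unfolding \<rho>_def by simp
      then have "(\<rho> / (R + 1)) ^ DIM('e) = (r / (2 * (R + 1))) ^ DIM('e) * h ^ DIM('e)"
        by (simp only: power_mult_distrib)
      moreover have "\<sigma>2 * (\<delta>\<^sup>2 * e0 * (1/4 * X)) * Y = \<sigma>2 * (\<delta>\<^sup>2 * e0 * ((1/2)\<^sup>2 * (X * Y)))" for X Y
        by (simp add: power2_eq_square)
      ultimately show ?thesis unfolding c_def by (simp only:)
    qed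
    also have "\<dots> \<le> \<sigma>2 * (\<delta>\<^sup>2 * e0 * ((prob E)\<^sup>2 * (\<rho> / (R + 1)) ^ DIM('e)))"
      using R \<rho> \<sigma>2 unfolding E_def[symmetric] e0_def
      by (intro mult_left_mono mult_right_mono power_mono) auto
    also have "\<dots> \<le> \<sigma>2 * (\<delta>\<^sup>2 * e0 * (\<integral>x. (\<integral>y. q x y \<partial>\<mu>) \<partial>\<mu>))"
      using 3 \<sigma>2 unfolding e0_def by (intro mult_left_mono) auto
    also have "\<dots> \<le> \<sigma>2 * (\<integral>x. (\<integral>y. \<Phi> ((\<zeta> x, w x), (\<zeta> y, w y)) \<partial>\<mu>) \<partial>\<mu>)"
      using 2 \<sigma>2 by (intro mult_left_mono) auto
    also have "\<dots> \<le> (\<integral>x. (\<integral>y. (u x \<bullet> u y)\<^sup>2 * \<Phi> ((\<zeta> x, w x), (\<zeta> y, w y)) \<partial>\<mu>) \<partial>\<mu>)"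
      by (rule u_nondegenerate[OF \<Phi>_meas \<Phi>_le])
    also have "\<dots> = (\<integral>x. (\<integral>y. (H h x y)\<^sup>2 \<partial>\<mu>) \<partial>\<mu>)"
      unfolding \<Phi>_def H_def by (simp add: power_mult_distrib)
    finally show "c * h ^ DIM('e) \<le> (\<integral>x. (\<integral>y. (H h x y)\<^sup>2 \<partial>\<mu>) \<partial>\<mu>)" .
  qed
qed

text \<open>The sample enters only through its joint law, the n-fold power of \<mu>, and
  \<open>T\<close> is prescribed only where the sum of squares is positive. The remaining work is to
  see that the normalized error \<epsilon> tends to 0.\<close>

theorem self_normalized_clt:
  fixes Xs :: "nat \<Rightarrow> 's \<Rightarrow> 'x" and h :: "nat \<Rightarrow> real"
  assumes f: "bounded (range f) \<or> (\<exists>r. 0 < r \<and> r \<le> 1 \<and> integrable lborel (\<lambda>t. cmod (fourier f t) powr (2 - r)))"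
    and h: "\<And>n. 0 < h n" "h \<longlonglongrightarrow> 0" "filterlim (\<lambda>n. real n * h n ^ DIM('e)) at_top sequentially"
    and M: "prob_space M"
    and X: "\<And>n. (\<lambda>s. \<lambda>i\<in>{1..n}. Xs i s) \<in> measurable M (PiM {1..n} (\<lambda>_. \<mu>))"
      "\<And>n. 1 \<le> n \<Longrightarrow> distr M (PiM {1..n} (\<lambda>_. \<mu>)) (\<lambda>s. \<lambda>i\<in>{1..n}. Xs i s) = PiM {1..n} (\<lambda>_. \<mu>)"
    and T[measurable]: "\<And>n. T n \<in> borel_measurable M"
    and T_eq: "\<And>n s. s \<in> space M \<Longrightarrow> 0 < (\<Sum>i\<in>{1..n}. \<Sum>j\<in>{1..n} - {i}. (H (h n) (Xs i s) (Xs j s))\<^sup>2) \<Longrightarrow>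
      T n s = (\<Sum>i\<in>{1..n}. \<Sum>j\<in>{1..n} - {i}. H (h n) (Xs i s) (Xs j s)) /
        sqrt (2 * (\<Sum>i\<in>{1..n}. \<Sum>j\<in>{1..n} - {i}. (H (h n) (Xs i s) (Xs j s))\<^sup>2))"
  shows "weak_conv_m (\<lambda>n. distr M borel (T n)) std_normal_distribution"
proof -
  interpret M: prob_space M by (rule M)
  obtain C1 S where S: "\<And>h z. 0 < h \<Longrightarrow> conv h z \<le> S h"
      "\<And>h. 0 < h \<Longrightarrow> (LINT z|lborel. f z * conv h z) \<le> C1 * h ^ DIM('e)"
      "((\<lambda>h. (S h)\<^sup>2 / h ^ DIM('e)) \<longlongrightarrow> 0) (at_right 0)"
    by (rule conv_bounds[OF f]) blast
  obtain c h0 where c: "0 < c" "0 < h0"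
    "\<And>h. 0 < h \<Longrightarrow> h \<le> h0 \<Longrightarrow> c * h ^ DIM('e) \<le> (\<integral>x. (\<integral>y. (H h x y)\<^sup>2 \<partial>\<mu>) \<partial>\<mu>)"
    by (rule second_moment_lower_bound) blast
  define p where "p n = real n * h n ^ DIM('e)" for n
  define g where "g n = (S (h n))\<^sup>2 / h n ^ DIM('e)" for n
  define B1 where "B1 = \<kappa>0 ^ 4 * M4\<^sup>2"
  define B2 where "B2 = M4 * (\<kappa>0 * C2)\<^sup>2"
  define B3 where "B3 = C2 ^ 4 * \<kappa>0 * C1"
  \<comment> \<open>16 / c^2 comes from the lower bound n^2 c h^d / 4 for n (n - 1) \<tau> / 2,
    where n - 1 >= n / 2. The added 1 / n keeps \<open>\<epsilon> n\<close> strictly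
    positive.\<close>
  define \<epsilon> where "\<epsilon> n = 16 / c\<^sup>2 * (B1 * (1 / p n)\<^sup>2 + B2 * g n * (1 / p n) + B3 * g n) + 1 / real n" for n
  have p0: "(\<lambda>n. 1 / p n) \<longlonglongrightarrow> 0"
    using tendsto_divide_0[OF tendsto_const filterlim_at_top_imp_at_infinity[OF h(3)]] unfolding p_def .
  have "filterlim h (at_right 0) sequentially"
    unfolding filterlim_at using h(1,2) by (auto simp: less_le intro!: always_eventually)
  then have g0: "g \<longlonglongrightarrow> 0" unfolding g_def[abs_def] by (rule filterlim_compose[OF S(3)])
  have "\<epsilon> \<longlonglongrightarrow> 16 / c\<^sup>2 * (B1 * 0\<^sup>2 + B2 * 0 * 0 + B3 * 0) + 0"
    unfolding \<epsilon>_def[abs_def] by (intro tendsto_intros p0 g0 lim_1_over_n)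
  then have \<epsilon>0: "\<epsilon> \<longlonglongrightarrow> 0" by simp
  have M4: "0 \<le> M4" unfolding M4_def by simp
  have C1: "0 \<le> C1"
  proof -
    have "0 \<le> (LINT z|lborel. f z * conv 1 z)" by (intro Bochner_Integration.integral_nonneg) (auto simp: f_nonneg conv_nonneg)
    then show ?thesis using S(2)[of 1] by simp
  qed
  have B: "0 \<le> B1" "0 \<le> B2" "0 \<le> B3"
    unfolding B1_def B2_def B3_def using M4 C1 C2 \<kappa>0_pos by (auto intro!: mult_nonneg_nonneg)
  show ?thesis
  proof (rule M.weak_conv_std_normal_of_char_bound[OF T \<epsilon>0])
    have "\<forall>\<^sub>F n in sequentially. h n < h0" using h(2) c(2) by (rule order_tendstoD(2))
    then show "\<forall>\<^sub>F n in sequentially. \<forall>t \<delta>. 0 < \<delta> \<longrightarrow> \<delta> \<le> 1/2 \<longrightarrow>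
      norm ((\<integral>s. iexp (t * T n s) \<partial>M) - of_real (exp (- t\<^sup>2 / 2)))
        \<le> 4 * (t\<^sup>2 + \<bar>t\<bar> ^ 3) * sqrt (\<epsilon> n) + 2 * sqrt (\<epsilon> n) / \<delta> + 2 * \<bar>t\<bar> * \<delta>"
      using eventually_ge_at_top[of 2]
    proof eventually_elim
      case (elim n)
      interpret D: finite_bounded_smoothing \<mu> k f u \<zeta> w N \<beta> \<sigma>2 C2 A "h n" "S (h n)" C1 "{1..n}"
        by unfold_locales (use h(1) S in auto)
      have hp: "0 < h n ^ DIM('e)" using h(1) by simp
      have n: "0 < real n" "2 \<le> real n" using elim by auto
      have P: "D.D.P = PiM {1..n} (\<lambda>_. \<mu>)" by (rule D.D.P_def)
      have \<tau>: "c * h n ^ DIM('e) \<le> D.D.\<tau>"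
        unfolding D.D.\<tau>_def D.D.a_def using c(3)[OF h(1)] elim by simp
      have \<tau>0: "0 < D.D.\<tau>" using \<tau> c(1) hp by (smt (verit) mult_pos_pos)
      have pp: "0 < p n" unfolding p_def using n hp by simp
      have gg: "0 \<le> g n" unfolding g_def using hp by simp
      have \<epsilon>p: "0 < \<epsilon> n"
        unfolding \<epsilon>_def using B pp gg n by (intro add_nonneg_pos mult_nonneg_nonneg add_nonneg_nonneg) auto
      have main: "real n ^ 2 * D.D.m4 + real n ^ 3 * D.D.b + real n ^ 4 * D.D.g4
        \<le> \<epsilon> n * (real n * real (n - 1) * D.D.\<tau> / 2)\<^sup>2"
      proof -
        define v where "v = (real n)\<^sup>2 * (c * h n ^ DIM('e)) / 4"
        have "v \<le> real n * real (n - 1) * D.D.\<tau> / 2"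
        proof -
          have "real n / 2 \<le> real (n - 1)" using elim by simp
          then have "real n * (real n / 2) * (c * h n ^ DIM('e)) \<le> real n * real (n - 1) * D.D.\<tau>"
            using \<tau> c(1) hp n by (intro mult_mono) auto
          then show ?thesis unfolding v_def by (simp add: power2_eq_square mult_ac)
        qed
        moreover have "0 \<le> v" unfolding v_def using c(1) hp by simp
        ultimately have vv: "v\<^sup>2 \<le> (real n * real (n - 1) * D.D.\<tau> / 2)\<^sup>2" by (intro power_mono)
        have v2: "16 / c\<^sup>2 * v\<^sup>2 = real n ^ 4 * (h n ^ DIM('e))\<^sup>2"
          unfolding v_def using c(1) by (simp add: power_mult_distrib power_divide flip: power_mult)
        have "real n ^ 2 * D.D.m4 + real n ^ 3 * D.D.b + real n ^ 4 * D.D.g4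
          \<le> real n ^ 2 * B1 + real n ^ 3 * (B2 * (S (h n))\<^sup>2) + real n ^ 4 * (B3 * (S (h n))\<^sup>2 * h n ^ DIM('e))"
          using D.m4_le D.b_le D.g4_le unfolding B1_def B2_def B3_def
          by (intro add_mono mult_left_mono) (auto simp: power_mult_distrib mult_ac)
        also have "\<dots> = (B1 * (1 / p n)\<^sup>2 + B2 * g n * (1 / p n) + B3 * g n) * (real n ^ 4 * (h n ^ DIM('e))\<^sup>2)"
          unfolding p_def g_def using n h(1)[of n] by (simp add: field_simps power2_eq_square eval_nat_numeral)
        also have "\<dots> = 16 / c\<^sup>2 * (B1 * (1 / p n)\<^sup>2 + B2 * g n * (1 / p n) + B3 * g n) * v\<^sup>2"
          unfolding v2[symmetric] by (simp only: mult_ac)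
        also have "\<dots> \<le> \<epsilon> n * v\<^sup>2" unfolding \<epsilon>_def using n by (intro mult_right_mono) auto
        also have "\<dots> \<le> \<epsilon> n * (real n * real (n - 1) * D.D.\<tau> / 2)\<^sup>2" using vv \<epsilon>p by (intro mult_left_mono) auto
        finally show ?thesis .
      qed
      show ?case
      proof (intro allI impI)
        fix t \<delta> :: real assume \<delta>: "0 < \<delta>" "\<delta> \<le> 1/2"
        let ?X = "\<lambda>s. \<lambda>i\<in>{1..n}. Xs i s"
        show "norm ((\<integral>s. iexp (t * T n s) \<partial>M) - of_real (exp (- t\<^sup>2 / 2)))
          \<le> 4 * (t\<^sup>2 + \<bar>t\<bar> ^ 3) * sqrt (\<epsilon> n) + 2 * sqrt (\<epsilon> n) / \<delta> + 2 * \<bar>t\<bar> * \<delta>"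
        proof (rule D.D.char_self_normalized_U_statistic[OF M, where X = ?X])
          show "?X \<in> measurable M D.D.P" unfolding P by (rule X)
          show "distr M D.D.P ?X = D.D.P" unfolding P using elim by (intro X) auto
          fix s assume s: "s \<in> space M" "0 < D.D.Q (?X s)"
          define q where "q = (\<Sum>i\<in>{1..n}. \<Sum>j\<in>{1..n} - {i}. (H (h n) (Xs i s) (Xs j s))\<^sup>2)"
          have Q: "D.D.Q (?X s) = q / 2"
            unfolding D.D.Q_def D.D.h_def q_def by (auto intro!: sum.cong arg_cong2[where f = "(/)"])
          have W: "D.D.W (?X s) = (\<Sum>i\<in>{1..n}. \<Sum>j\<in>{1..n} - {i}. H (h n) (Xs i s) (Xs j s)) / 2"
            unfolding D.D.W_def D.D.V_def D.D.h_def by (auto intro!: sum.cong arg_cong2[where f = "(/)"])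
          have q: "0 < q" using s(2) unfolding Q by simp
          \<comment> \<open>\<open>W\<close> is half of the sum and \<open>Q\<close> half of the sum
            of squares; this identity reconciles these halves with the 2 under the root.\<close>
          have "sqrt (2 * q) = 2 * sqrt (q / 2)"
            using q by (intro real_sqrt_unique) (auto simp: power_mult_distrib)
          then show "T n s = D.D.W (?X s) / sqrt (D.D.Q (?X s))"
            unfolding Q W T_eq[OF s(1) q[unfolded q_def], folded q_def] by simp
        next
          show "2 \<le> card {1..n}" using elim by simp
          show "real (card {1..n}) ^ 2 * D.D.m4 + real (card {1..n}) ^ 3 * D.D.b + real (card {1..n}) ^ 4 * D.D.g4
             \<le> \<epsilon> n * (real (card {1..n}) * real (card {1..n} - 1) * D.D.\<tau> / 2)\<^sup>2"
            using main by simp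
        qed (use \<tau>0 \<epsilon>p \<delta> in auto)
      qed
    qed
  qed
qed

end

section \<open>Conditional moments and independent copies\<close>

lemma subalgebra_sigma_gen:
  "X \<in> borel_measurable M \<Longrightarrow> subalgebra M (sigma_gen M X)"
  unfolding subalgebra_def sigma_gen_def using sets_image_in_sets[of M "space M" X borel] by simp

lemma measurable_sigma_gen: "X \<in> measurable (sigma_gen M X) borel"
  unfolding sigma_gen_def by (rule measurable_vimage_algebra1) auto

lemma (in prob_space) sigma_finite_subalgebra_sigma_gen:
  "X \<in> borel_measurable M \<Longrightarrow> sigma_finite_subalgebra M (sigma_gen M X)"
  by (intro finite_measure_subalgebra_is_sigma_finite finite_measure_subalgebra.intro
      finite_measure_subalgebra_axioms.intro subalgebra_sigma_gen finite_measure_axioms)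

text \<open>The tower property for the nonnegative conditional expectation, which allows infinite
  values, so the bounds are available before any moment is known to be finite.\<close>

lemma (in prob_space) nn_integral_cond_bound:
  assumes X[measurable]: "X \<in> borel_measurable M" and Y[measurable]: "Y \<in> borel_measurable M" and g[measurable]: "g \<in> borel_measurable borel"
  shows "AE s in M. nn_cond_exp M (sigma_gen M X) Y s \<le> c \<Longrightarrow>
      (\<integral>\<^sup>+s. g (X s) * Y s \<partial>M) \<le> c * (\<integral>\<^sup>+s. g (X s) \<partial>M)"
    and "AE s in M. c \<le> nn_cond_exp M (sigma_gen M X) Y s \<Longrightarrow>
      c * (\<integral>\<^sup>+s. g (X s) \<partial>M) \<le> (\<integral>\<^sup>+s. g (X s) * Y s \<partial>M)"
proof -
  interpret F: sigma_finite_subalgebra M "sigma_gen M X" by (rule sigma_finite_subalgebra_sigma_gen[OF X])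
  have eq: "(\<integral>\<^sup>+s. g (X s) * Y s \<partial>M) = (\<integral>\<^sup>+s. g (X s) * nn_cond_exp M (sigma_gen M X) Y s \<partial>M)"
    using measurable_compose[OF measurable_sigma_gen g] by (intro F.nn_cond_exp_intg[symmetric]) auto
  have c: "c * (\<integral>\<^sup>+s. g (X s) \<partial>M) = (\<integral>\<^sup>+s. g (X s) * c \<partial>M)"
    unfolding mult.commute[of c] by (rule nn_integral_multc[symmetric]) measurable
  show "AE s in M. nn_cond_exp M (sigma_gen M X) Y s \<le> c \<Longrightarrow>
      (\<integral>\<^sup>+s. g (X s) * Y s \<partial>M) \<le> c * (\<integral>\<^sup>+s. g (X s) \<partial>M)"
    unfolding eq c by (rule nn_integral_mono_AE) (auto elim!: eventually_mono intro: mult_left_mono)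
  show "AE s in M. c \<le> nn_cond_exp M (sigma_gen M X) Y s \<Longrightarrow>
      c * (\<integral>\<^sup>+s. g (X s) \<partial>M) \<le> (\<integral>\<^sup>+s. g (X s) * Y s \<partial>M)"
    unfolding eq c by (rule nn_integral_mono_AE) (auto elim!: eventually_mono intro: mult_left_mono)
qed

text \<open>\<open>U\<close> itself need not be integrable, so the weight is first restricted to the sets where it is
  bounded away from zero.\<close>

lemma (in prob_space) weighted_cond_exp_zero:
  fixes U :: "'a \<Rightarrow> 'u::{real_inner, banach, second_countable_topology}" and v :: "'x::topological_space \<Rightarrow> real"
  assumes U[measurable]: "U \<in> borel_measurable M" and X[measurable]: "X \<in> borel_measurable M"
    and U0: "has_cond_exp M (sigma_gen M X) U (\<lambda>_. 0)"
    and v[measurable]: "v \<in> borel_measurable borel" and v_pos: "\<And>x. 0 < v x"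
    and vU: "integrable M (\<lambda>s. v (X s) *\<^sub>R U s)"
    and \<xi>[measurable]: "\<xi> \<in> borel_measurable borel" and \<xi>_le: "\<And>x. \<bar>\<xi> x\<bar> \<le> B"
  shows "expectation (\<lambda>s. (c \<bullet> (v (X s) *\<^sub>R U s)) * \<xi> (X s)) = 0"
proof -
  let ?F = "sigma_gen M X"
  interpret F: sigma_finite_subalgebra M ?F by (rule sigma_finite_subalgebra_sigma_gen[OF X])
  have subF: "A \<in> sets ?F \<Longrightarrow> A \<in> sets M" for A
    using subalgebra_sigma_gen[OF X] by (auto simp: subalgebra_def)
  have spF: "space ?F = space M" by (simp add: sigma_gen_def)
  have Fm: "(\<lambda>s. g (X s)) \<in> borel_measurable ?F" if "g \<in> borel_measurable borel" for g :: "'x \<Rightarrow> real"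
    using measurable_compose[OF measurable_sigma_gen that] .
  \<comment> \<open>On these sets of the conditioning \<sigma>-algebra (m + 1) v >= 1, so
    integrability passes from the weighted variable to \<open>U\<close>. They exhaust the space
    because \<open>v\<close> is positive.\<close>
  define A where "A m = {s \<in> space M. 1 / real (Suc m) \<le> v (X s)}" for m
  have A_F: "A m \<in> sets ?F" for m
  proof -
    note [measurable] = Fm[OF v]
    have "{s \<in> space ?F. 1 / real (Suc m) \<le> v (X s)} \<in> sets ?F" by measurable
    then show ?thesis unfolding A_def spF .
  qed
  have [measurable]: "A m \<in> sets M" for m using subF[OF A_F] .
  define Y where "Y m s = indicator (A m) s * (c \<bullet> U s)" for m s
  have [measurable]: "Y m \<in> borel_measurable M" for m unfolding Y_def by measurable
  have int_AU: "integrable M (\<lambda>s. indicator (A m) s *\<^sub>R U s)" for m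
  proof (rule Bochner_Integration.integrable_bound)
    show "integrable M (\<lambda>s. real (Suc m) *\<^sub>R (v (X s) *\<^sub>R U s))" using vU by (rule integrable_scaleR_right)
    show "AE s in M. norm (indicator (A m) s *\<^sub>R U s) \<le> norm (real (Suc m) *\<^sub>R (v (X s) *\<^sub>R U s))"
    proof (rule AE_I2)
      fix s
      have "1 * norm (U s) \<le> (real (Suc m) * v (X s)) * norm (U s)" if "s \<in> A m"
        using that by (intro mult_right_mono) (auto simp: A_def field_simps)
      then show "norm (indicator (A m) s *\<^sub>R U s) \<le> norm (real (Suc m) *\<^sub>R (v (X s) *\<^sub>R U s))"
        using v_pos[of "X s"] by (auto simp: indicator_def mult.assoc)
    qed
  qed measurable
  have Y_int: "integrable M (Y m)" for m
  proof -
    have "integrable M (\<lambda>s. c \<bullet> (indicator (A m) s *\<^sub>R U s))" using int_AU by (rule integrable_inner_right)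
    then show ?thesis unfolding Y_def by simp
  qed
  have cond: "AE s in M. real_cond_exp M ?F (Y m) s = 0" for m
  proof (rule F.real_cond_exp_charact)
    fix D assume D: "D \<in> sets ?F"
    have DA: "D \<inter> A m \<in> sets ?F" using D A_F by blast
    have DAU: "set_integrable M (D \<inter> A m) U"
    proof -
      have "integrable M (\<lambda>s. indicator D s *\<^sub>R (indicator (A m) s *\<^sub>R U s))"
        using integrable_mult_indicator[OF subF[OF D] int_AU] .
      then show ?thesis unfolding set_integrable_def by (simp add: indicator_inter_arith)
    qed
    have "(LINT s:D \<inter> A m|M. U s) = 0"
      using U0 DA DAU unfolding has_cond_exp_def set_lebesgue_integral_def by auto
    have "(LINT s:D|M. Y m s) = (LINT s|M. c \<bullet> (indicator (D \<inter> A m) s *\<^sub>R U s))"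
      unfolding set_lebesgue_integral_def Y_def by (intro Bochner_Integration.integral_cong) (auto simp: indicator_def)
    also have "\<dots> = c \<bullet> (LINT s:D \<inter> A m|M. U s)"
      unfolding set_lebesgue_integral_def using DAU by (intro integral_inner_right) (auto simp: set_integrable_def)
    also have "\<dots> = 0" using \<open>(LINT s:D \<inter> A m|M. U s) = 0\<close> by simp
    finally show "(LINT s:D|M. Y m s) = (LINT s:D|M. 0)" by simp
  qed (use Y_int in auto)
  let ?G = "\<lambda>s. (c \<bullet> (v (X s) *\<^sub>R U s)) * \<xi> (X s)"
  have B: "0 \<le> B" using \<xi>_le[of undefined] by linarith
  have dom_int: "integrable M (\<lambda>s. B * (norm c * norm (v (X s) *\<^sub>R U s)))"
    using integrable_norm[OF vU] by (intro integrable_mult_right)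
  have dom: "norm (?G s) \<le> B * (norm c * norm (v (X s) *\<^sub>R U s))" for s
  proof -
    have "\<bar>c \<bullet> (v (X s) *\<^sub>R U s)\<bar> * \<bar>\<xi> (X s)\<bar> \<le> (norm c * norm (v (X s) *\<^sub>R U s)) * B"
      by (intro mult_mono Cauchy_Schwarz_ineq2 \<xi>_le) auto
    then show ?thesis by (simp add: abs_mult mult.commute)
  qed
  have zero: "expectation (\<lambda>s. indicator (A m) s * ?G s) = 0" for m
  proof -
    have eq: "indicator (A m) s * ?G s = (v (X s) * \<xi> (X s)) * Y m s" for s
      unfolding Y_def by simp
    have i: "integrable M (\<lambda>s. (v (X s) * \<xi> (X s)) * Y m s)"
    proof (rule Bochner_Integration.integrable_bound[OF dom_int])
      have "norm (indicator (A m) s * ?G s) \<le> norm (?G s)" for s by (simp add: indicator_def)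
      then show "AE s in M. norm ((v (X s) * \<xi> (X s)) * Y m s) \<le> norm (B * (norm c * norm (v (X s) *\<^sub>R U s)))"
        unfolding eq[symmetric] real_norm_def[of "B * (norm c * norm (v (X s) *\<^sub>R U s))" for s]
        by (intro AE_I2 order_trans[OF _ abs_ge_self]) (rule order_trans[OF _ dom])
    qed measurable
    have "expectation (\<lambda>s. (v (X s) * \<xi> (X s)) * Y m s) = expectation (\<lambda>s. (v (X s) * \<xi> (X s)) * real_cond_exp M ?F (Y m) s)"
      using F.real_cond_exp_intg(2)[OF i] Fm[of "\<lambda>x. v x * \<xi> x"] by simp
    also have "\<dots> = expectation (\<lambda>s. 0)"
      using cond[of m] by (intro integral_cong_AE) (auto elim!: eventually_mono)
    finally show ?thesis unfolding eq by simp
  qed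
  have "(\<lambda>m. expectation (\<lambda>s. indicator (A m) s * ?G s)) \<longlonglongrightarrow> expectation ?G"
  proof (rule integral_dominated_convergence[OF _ _ dom_int])
    show "AE s in M. (\<lambda>m. indicator (A m) s * ?G s) \<longlonglongrightarrow> ?G s"
    proof (rule AE_I2)
      fix s assume s: "s \<in> space M"
      obtain n where n: "1 / v (X s) \<le> real n" using real_arch_simple by blast
      have "\<forall>\<^sub>F m in sequentially. indicator (A m) s * ?G s = ?G s"
        using eventually_ge_at_top[of n]
      proof eventually_elim
        case (elim m)
        have "1 / v (X s) \<le> real (Suc m)" using n elim by linarith
        then have "s \<in> A m" using s v_pos[of "X s"] by (simp add: A_def field_simps)
        then show ?case by simp
      qed
      then show "(\<lambda>m. indicator (A m) s * ?G s) \<longlonglongrightarrow> ?G s" by (rule tendsto_eventually)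
    qed
    show "AE s in M. norm (indicator (A m) s * ?G s) \<le> B * (norm c * norm (v (X s) *\<^sub>R U s))" for m
      using dom by (intro AE_I2) (auto simp: indicator_def intro: order_trans[OF abs_ge_zero])
  qed measurable
  then show ?thesis unfolding zero by (simp add: LIMSEQ_const_iff)
qed

text \<open>For \<nu> > 2 one has x^2 <= 1 + x^\<nu>, so a conditional moment of order \<nu> bounded
  by \<open>C\<close> yields the constant 1 + C for second moments.\<close>

lemma (in prob_space) weighted_second_moment_le:
  fixes G :: "'a \<Rightarrow> 'u::{real_normed_vector, second_countable_topology}" and g :: "'x::topological_space \<Rightarrow> real"
  assumes X[measurable]: "X \<in> borel_measurable M" and G[measurable]: "G \<in> borel_measurable M"
    and cond: "AE s in M. nn_cond_exp M (sigma_gen M X) (\<lambda>s. ennreal (norm (G s) powr \<nu>)) s \<le> ennreal C"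
    and \<nu>: "2 < \<nu>" and C: "0 < C"
    and g[measurable]: "g \<in> borel_measurable borel" and g_bounds: "\<And>x. 0 \<le> g x" "\<And>x. g x \<le> B"
  shows "expectation (\<lambda>s. (norm (G s))\<^sup>2 * g (X s)) \<le> (1 + C) * expectation (\<lambda>s. g (X s))"
proof (rule integral_real_bounded)
  have g_int: "integrable M (\<lambda>s. g (X s))"
    by (rule integrable_const_bound[of _ B]) (use g_bounds in auto)
  have Eg: "(\<integral>\<^sup>+s. ennreal (g (X s)) \<partial>M) = ennreal (expectation (\<lambda>s. g (X s)))"
    using g_int g_bounds by (intro nn_integral_eq_integral) auto
  have Eg0: "0 \<le> expectation (\<lambda>s. g (X s))" using g_bounds by (intro Bochner_Integration.integral_nonneg)
  show "0 \<le> (1 + C) * expectation (\<lambda>s. g (X s))" using Eg0 C by simp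
  have pw: "x\<^sup>2 \<le> 1 + x powr \<nu>" if "0 \<le> x" for x :: real
  proof (cases "x \<le> 1")
    case True
    then have "x\<^sup>2 \<le> 1" using that by (simp add: power_le_one)
    then show ?thesis by (simp add: add_increasing2)
  next
    case False
    then have "x\<^sup>2 = x powr 2" by simp
    also have "\<dots> \<le> x powr \<nu>" using False \<nu> by (intro powr_mono) auto
    finally show ?thesis by simp
  qed
  have "(\<integral>\<^sup>+s. ennreal ((norm (G s))\<^sup>2 * g (X s)) \<partial>M)
    \<le> (\<integral>\<^sup>+s. ennreal (g (X s)) + ennreal (g (X s)) * ennreal (norm (G s) powr \<nu>) \<partial>M)"
  proof (intro nn_integral_mono)
    fix s
    have "(norm (G s))\<^sup>2 * g (X s) \<le> g (X s) + g (X s) * norm (G s) powr \<nu>"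
      using mult_right_mono[OF pw[of "norm (G s)"] g_bounds(1)[of "X s"]] by (simp add: algebra_simps)
    then have "ennreal ((norm (G s))\<^sup>2 * g (X s)) \<le> ennreal (g (X s) + g (X s) * norm (G s) powr \<nu>)" by (rule ennreal_leI)
    then show "ennreal ((norm (G s))\<^sup>2 * g (X s)) \<le> ennreal (g (X s)) + ennreal (g (X s)) * ennreal (norm (G s) powr \<nu>)"
      using g_bounds(1)[of "X s"] by (simp add: ennreal_plus ennreal_mult)
  qed
  also have "\<dots> = (\<integral>\<^sup>+s. ennreal (g (X s)) \<partial>M) + (\<integral>\<^sup>+s. ennreal (g (X s)) * ennreal (norm (G s) powr \<nu>) \<partial>M)"
    by (rule nn_integral_add) measurable
  also have "\<dots> \<le> (\<integral>\<^sup>+s. ennreal (g (X s)) \<partial>M) + ennreal C * (\<integral>\<^sup>+s. ennreal (g (X s)) \<partial>M)"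
    by (intro add_left_mono nn_integral_cond_bound(1)[OF _ _ _ cond]) measurable
  also have "\<dots> = ennreal ((1 + C) * expectation (\<lambda>s. g (X s)))"
    unfolding Eg using C Eg0 by (simp add: ennreal_mult[symmetric] ennreal_plus[symmetric] algebra_simps del: ennreal_plus)
  finally show "(\<integral>\<^sup>+s. ennreal ((norm (G s))\<^sup>2 * g (X s)) \<partial>M) \<le> ennreal ((1 + C) * expectation (\<lambda>s. g (X s)))" .
qed

lemma (in prob_space) weighted_square_ge:
  fixes Y :: "'a \<Rightarrow> real" and g :: "'x::topological_space \<Rightarrow> real"
  assumes X[measurable]: "X \<in> borel_measurable M" and Y[measurable]: "Y \<in> borel_measurable M"
    and cond: "AE s in M. ennreal c \<le> nn_cond_exp M (sigma_gen M X) (\<lambda>s. ennreal ((Y s)\<^sup>2)) s" and c: "0 \<le> c"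
    and g[measurable]: "g \<in> borel_measurable borel" and g_bounds: "\<And>x. 0 \<le> g x" "\<And>x. g x \<le> B"
    and int: "integrable M (\<lambda>s. (Y s)\<^sup>2 * g (X s))"
  shows "c * expectation (\<lambda>s. g (X s)) \<le> expectation (\<lambda>s. (Y s)\<^sup>2 * g (X s))"
proof -
  have g_int: "integrable M (\<lambda>s. g (X s))"
    by (rule integrable_const_bound[of _ B]) (use g_bounds in auto)
  have Eg: "(\<integral>\<^sup>+s. ennreal (g (X s)) \<partial>M) = ennreal (expectation (\<lambda>s. g (X s)))"
    using g_int g_bounds by (intro nn_integral_eq_integral) auto
  have Eg0: "0 \<le> expectation (\<lambda>s. g (X s))" using g_bounds by (intro Bochner_Integration.integral_nonneg)
  have "ennreal (c * expectation (\<lambda>s. g (X s))) = ennreal c * (\<integral>\<^sup>+s. ennreal (g (X s)) \<partial>M)"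
    unfolding Eg using c Eg0 by (simp add: ennreal_mult)
  also have "\<dots> \<le> (\<integral>\<^sup>+s. ennreal (g (X s)) * ennreal ((Y s)\<^sup>2) \<partial>M)"
    by (intro nn_integral_cond_bound(2)[OF _ _ _ cond]) measurable
  also have "\<dots> = (\<integral>\<^sup>+s. ennreal ((Y s)\<^sup>2 * g (X s)) \<partial>M)"
    by (intro nn_integral_cong) (simp add: ennreal_mult g_bounds mult.commute)
  also have "\<dots> = ennreal (expectation (\<lambda>s. (Y s)\<^sup>2 * g (X s)))"
    using int g_bounds by (intro nn_integral_eq_integral) auto
  finally show ?thesis
    using g_bounds by (subst (asm) ennreal_le_iff) (auto intro!: Bochner_Integration.integral_nonneg)
qed

lemma (in prob_space) indep_vars_pair_distr:
  assumes ind: "indep_vars (\<lambda>_. N) X I" and ij: "i \<in> I" "j \<in> I" "i \<noteq> j"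
  shows "distr M (N \<Otimes>\<^sub>M N) (\<lambda>s. (X i s, X j s)) = distr M N (X i) \<Otimes>\<^sub>M distr M N (X j)"
proof -
  have "indep_var (PiM {i} (\<lambda>_. N)) (\<lambda>s. \<lambda>k\<in>{i}. X k s) (PiM {j} (\<lambda>_. N)) (\<lambda>s. \<lambda>k\<in>{j}. X k s)"
    by (rule indep_var_restrict[OF ind]) (use ij in auto)
  then have "indep_var N ((\<lambda>f. f i) \<circ> (\<lambda>s. \<lambda>k\<in>{i}. X k s)) N ((\<lambda>f. f j) \<circ> (\<lambda>s. \<lambda>k\<in>{j}. X k s))"
    by (rule indep_var_compose) (auto intro!: measurable_component_singleton)
  then have "indep_var N (X i) N (X j)" by (simp add: comp_def)
  then show ?thesis unfolding indep_var_distribution_eq by simp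
qed

text \<open>The partition with the two points 0 and \<open>t\<close>, put in order by min and max,
  already bounds |f t - f 0| by the total variation.\<close>

lemma bounded_variation_bounded:
  assumes "bounded_variation f" shows "\<exists>\<beta>. \<forall>x. f x \<le> \<beta>"
proof -
  from assms obtain B where B: "\<And>n x. mono x \<Longrightarrow> (\<Sum>k<n. \<bar>f (x (Suc k)) - f (x k)\<bar>) \<le> B"
    unfolding bounded_variation_def by blast
  have "f t \<le> \<bar>f 0\<bar> + B" for t
  proof -
    define x where "x k = (if k = 0 then min 0 t else max 0 t)" for k :: nat
    have "mono x" unfolding x_def by (auto simp: mono_def)
    from B[OF this, of 1] have "\<bar>f (max 0 t) - f (min 0 t)\<bar> \<le> B" by (simp add: x_def)
    then show ?thesis by (auto simp: max_def min_def split: if_splits)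
  qed
  then show ?thesis by blast
qed

text \<open>Each \<open>\<phi> k\<close> is a unit vector, so by Cauchy-Schwarz the series is
  dominated by the summable one with terms a_k |w|^2. For measurability the unordered sum over
  \<open>J\<close> is rewritten as a series over all k, with zero terms outside
  \<open>J\<close>.\<close>

lemma sqnorm_A_properties:
  fixes \<phi> :: "nat \<Rightarrow> 'b::{real_inner, second_countable_topology}"
  assumes J: "J \<subseteq> {1..}" and \<phi>: "orthonormal_basis J \<phi>"
    and a_pos: "\<And>k. 1 \<le> k \<Longrightarrow> 0 < a k" and a_sum: "a summable_on {1..}"
  shows "0 \<le> sqnorm_A J a \<phi> w" and "sqnorm_A J a \<phi> (- w) = sqnorm_A J a \<phi> w"
    and "sqnorm_A J a \<phi> w \<le> infsum a J * (norm w)\<^sup>2"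
    and "sqnorm_A J a \<phi> \<in> borel_measurable borel"
proof -
  have a0: "0 \<le> a k" if "k \<in> J" for k using a_pos[of k] J that by auto
  have aJ: "a summable_on J" using summable_on_subset_banach[OF a_sum J] .
  have le: "a k * (w \<bullet> \<phi> k)\<^sup>2 \<le> a k * (norm w)\<^sup>2" if k: "k \<in> J" for k w
  proof -
    have "norm (\<phi> k) = 1" using \<phi> k unfolding orthonormal_basis_def by (simp add: norm_eq_sqrt_inner)
    then have "\<bar>w \<bullet> \<phi> k\<bar> \<le> norm w" using Cauchy_Schwarz_ineq2[of w "\<phi> k"] by simp
    then have "(w \<bullet> \<phi> k)\<^sup>2 \<le> (norm w)\<^sup>2" using abs_le_square_iff[of "w \<bullet> \<phi> k" "norm w"] by simp
    then show ?thesis using a0[OF k] by (rule mult_left_mono)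
  qed
  have sum2: "(\<lambda>k. a k * (norm w)\<^sup>2) summable_on J" for w using aJ by (rule summable_on_cmult_left)
  have sum1: "(\<lambda>k. a k * (w \<bullet> \<phi> k)\<^sup>2) summable_on J" for w
    by (rule summable_on_comparison_test[OF sum2[of w]]) (use le a0 in auto)
  show "0 \<le> sqnorm_A J a \<phi> w" unfolding sqnorm_A_def using a0 by (intro infsum_nonneg) auto
  show "sqnorm_A J a \<phi> (- w) = sqnorm_A J a \<phi> w" unfolding sqnorm_A_def by simp
  show "sqnorm_A J a \<phi> w \<le> infsum a J * (norm w)\<^sup>2"
    unfolding sqnorm_A_def infsum_cmult_left'[symmetric] by (rule infsum_mono[OF sum1 sum2]) (rule le)
  let ?g = "\<lambda>w k. if k \<in> J then a k * (w \<bullet> \<phi> k)\<^sup>2 else 0"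
  have "sqnorm_A J a \<phi> w = (\<Sum>k. ?g w k)" for w
  proof -
    have "((\<lambda>k. a k * (w \<bullet> \<phi> k)\<^sup>2) has_sum sqnorm_A J a \<phi> w) J"
      unfolding sqnorm_A_def using sum1 by (rule has_sum_infsum)
    then have "(?g w has_sum sqnorm_A J a \<phi> w) UNIV"
      by (rule has_sum_cong_neutral[THEN iffD1, rotated 3]) auto
    then show ?thesis by (intro sums_unique has_sum_imp_sums)
  qed
  then have "sqnorm_A J a \<phi> = (\<lambda>w. \<Sum>k. ?g w k)" by (rule ext)
  also have "\<dots> \<in> borel_measurable borel" by measurable
  finally show "sqnorm_A J a \<phi> \<in> borel_measurable borel" .
qed

lemma prod_Basis_vec: "(\<Prod>b\<in>Basis. f (z \<bullet> b)) = (\<Prod>i\<in>UNIV. f (z $ i))" for z :: "real^'q" and f :: "real \<Rightarrow> real"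
proof -
  have B: "(Basis :: (real^'q) set) = (\<lambda>i. axis i 1) ` UNIV" by (auto simp: Basis_vec_def)
  have "inj (\<lambda>i::'q. axis i (1::real))" by (auto simp: inj_def axis_eq_axis)
  then show ?thesis unfolding B by (subst prod.reindex) (auto simp: inner_axis)
qed

text \<open>Separable Hilbert spaces are encoded as complete second countable inner product spaces.
  \<open>J\<close> is {1..} for an infinite and {1..d} for a finite orthonormal basis. The moment
  conditions in (c) use the nonnegative conditional expectation, which is defined for every
  nonnegative variable.\<close>

theorem theorem1:
  fixes M :: "'s measure"
    and U :: "'s \<Rightarrow> 'a::{real_inner, banach, second_countable_topology}"
    and Z :: "'s \<Rightarrow> real^'q"
    and W :: "'s \<Rightarrow> 'b::{real_inner, banach, second_countable_topology}"
    and Us :: "nat \<Rightarrow> 's \<Rightarrow> 'a" and Zs :: "nat \<Rightarrow> 's \<Rightarrow> real^'q" and Ws :: "nat \<Rightarrow> 's \<Rightarrow> 'b"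
    and \<omega> :: "real^'q \<Rightarrow> real"
    and J :: "nat set" and \<phi> :: "nat \<Rightarrow> 'b" and a :: "nat \<Rightarrow> real"
    and fZ :: "real^'q \<Rightarrow> real"
    and \<sigma>2 C \<nu> :: real
    and K :: "real^'q \<Rightarrow> real" and Kt :: "real \<Rightarrow> real"
    and h :: "nat \<Rightarrow> real"
    and T :: "nat \<Rightarrow> 's \<Rightarrow> real"
  assumes "prob_space M"
    and U_meas: "U \<in> borel_measurable M"
    and Z_meas: "Z \<in> borel_measurable M"
    and W_meas: "W \<in> borel_measurable M"
    and sample_indep:
      "prob_space.indep_vars M (\<lambda>_. borel) (\<lambda>i s. (Us i s, Zs i s, Ws i s)) {1..}"
    and sample_distr:
      "\<And>i. 1 \<le> i \<Longrightarrow> distr M borel (\<lambda>s. (Us i s, Zs i s, Ws i s)) = distr M borel (\<lambda>s. (U s, Z s, W s))"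
    and omega_meas: "\<omega> \<in> borel_measurable borel"
    and omega_pos: "\<And>z. 0 < \<omega> z"
    and basis_index: "J = {1..} \<or> (\<exists>d. J = {1..d})"
    and basis: "orthonormal_basis J \<phi>"
    and Da: "integrable M (\<lambda>s. norm (\<omega> (Z s) *\<^sub>R U s) ^ 4)"
    and Db_i_nonneg: "\<And>z. 0 \<le> fZ z"
    and Db_i_density: "distributed M lborel Z (\<lambda>z. ennreal (fZ z))"
    and Db_i: "bounded (range fZ) \<or>
      (\<exists>r. 0 < r \<and> r \<le> 1 \<and> integrable lborel (\<lambda>t. cmod (fourier fZ t) powr (2 - r)))"
    and Db_ii: "integrable M (\<lambda>s. (norm (W s))\<^sup>2)"
    and Db_iii_pos: "\<And>k. 1 \<le> k \<Longrightarrow> 0 < a k"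
    and Db_iii_sum: "a summable_on {1..}"
    and Dc_const: "0 < \<sigma>2" "0 < C" "2 < \<nu>"
    and Dc_i: "AE s in M. ennreal \<sigma>2 \<le>
      nn_cond_exp M (sigma_gen M (\<lambda>s. ((Zs 1 s, Ws 1 s), (Zs 2 s, Ws 2 s))))
        (\<lambda>s. ennreal (((\<omega> (Zs 1 s) *\<^sub>R Us 1 s) \<bullet> (\<omega> (Zs 2 s) *\<^sub>R Us 2 s))\<^sup>2)) s"
    and Dc_ii: "AE s in M.
      nn_cond_exp M (sigma_gen M (\<lambda>s. (Z s, W s)))
        (\<lambda>s. ennreal (norm (\<omega> (Z s) *\<^sub>R U s) powr \<nu>)) s \<le> ennreal C"
    and Ka_prod: "\<And>z. K z = (\<Prod>l\<in>UNIV. Kt (z $ l))"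
    and Ka_sym: "\<And>x. Kt (- x) = Kt x"
    and Ka_density: "\<And>x. 0 \<le> Kt x" "integrable lborel Kt" "(LINT x|lborel. Kt x) = 1"
    and Ka_bv: "bounded_variation Kt"
    and Ka_fourier_pos: "\<And>t. Im (fourier Kt t) = 0 \<and> 0 < Re (fourier Kt t)"
    and Ka_fourier_int: "integrable lborel (fourier Kt)"
    and h_pos: "\<And>n. 0 < h n"
    and Kb_h: "h \<longlonglongrightarrow> 0"
    and Kb_nh: "filterlim (\<lambda>n. real n * h n ^ CARD('q) / ln (real n)) at_top sequentially"
    and T_meas: "\<And>n. T n \<in> borel_measurable M"
    and T_def: "\<And>n s. s \<in> space M \<Longrightarrow>
      v_stat K (sqnorm_A J a \<phi>) \<omega> n (h n) (\<lambda>i. Us i s) (\<lambda>i. Zs i s) (\<lambda>i. Ws i s) \<noteq> 0 \<Longrightarrow>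
      T n s = I_stat K (sqnorm_A J a \<phi>) \<omega> n (h n) (\<lambda>i. Us i s) (\<lambda>i. Zs i s) (\<lambda>i. Ws i s) /
              v_stat K (sqnorm_A J a \<phi>) \<omega> n (h n) (\<lambda>i. Us i s) (\<lambda>i. Zs i s) (\<lambda>i. Ws i s)"
    and null_hyp: "has_cond_exp M (sigma_gen M (\<lambda>s. (Z s, W s))) U (\<lambda>_. 0)"
  shows "weak_conv_m (\<lambda>n. distr M borel (T n)) std_normal_distribution \<and>
    (\<forall>\<alpha>. 0 < \<alpha> \<and> \<alpha> < 1 \<longrightarrow>
       (\<lambda>n. measure M {s \<in> space M. quantile std_normal_distribution (1 - \<alpha>) \<le> T n s}) \<longlonglongrightarrow> \<alpha>)"
proof -
  interpret M: prob_space M by fact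
  define X where "X s = (U s, Z s, W s)" for s
  define Xs where "Xs i s = (Us i s, Zs i s, Ws i s)" for i s
  \<comment> \<open>The argument is transported to the law of one observation on the product space,
    where \<open>\<zeta>\<close> and \<open>w\<close> are coordinate functions and \<open>u\<close>
    is the weighted first coordinate.\<close>
  define \<mu> where "\<mu> = distr M borel X"
  define u where "u x = \<omega> (fst (snd x)) *\<^sub>R fst x" for x :: "'a \<times> (real^'q) \<times> 'b"
  define \<zeta> where "\<zeta> x = fst (snd x)" for x :: "'a \<times> (real^'q) \<times> 'b"
  define w where "w x = snd (snd x)" for x :: "'a \<times> (real^'q) \<times> 'b"
  note [measurable] = U_meas Z_meas W_meas omega_meas
  have fst_meas: "fst \<in> borel_measurable (borel :: ('v::second_countable_topology \<times> 'w::second_countable_topology) measure)"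
    and snd_meas: "snd \<in> borel_measurable (borel :: ('v \<times> 'w) measure)"
    unfolding borel_prod[symmetric] by measurable
  have X_meas[measurable]: "X \<in> borel_measurable M" unfolding X_def[abs_def] by measurable
  have \<zeta>_meas0[measurable]: "\<zeta> \<in> borel_measurable borel"
    unfolding \<zeta>_def[abs_def] by (rule measurable_compose[OF snd_meas fst_meas])
  have w_meas0[measurable]: "w \<in> borel_measurable borel"
    unfolding w_def[abs_def] by (rule measurable_compose[OF snd_meas snd_meas])
  have u_meas0[measurable]: "u \<in> borel_measurable borel"
    unfolding u_def[abs_def] \<zeta>_def[symmetric] using fst_meas by measurable
  have \<mu>_sets[measurable_cong]: "sets \<mu> = sets borel" unfolding \<mu>_def by simp
  have Xs_meas: "Xs i \<in> borel_measurable M" if "1 \<le> i" for i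
    using sample_indep that unfolding M.indep_vars_def Xs_def by auto
  have Xs_distr: "distr M borel (Xs i) = \<mu>" if "1 \<le> i" for i
    using sample_distr[OF that] unfolding \<mu>_def X_def Xs_def .
  have ind: "M.indep_vars (\<lambda>_. borel) Xs {1..}" using sample_indep unfolding Xs_def .
  have E\<mu>: "(\<integral>x. F x \<partial>\<mu>) = M.expectation (\<lambda>s. F (X s))" if "F \<in> borel_measurable borel" for F :: "_ \<Rightarrow> real"
    unfolding \<mu>_def by (rule integral_distr[OF X_meas that])
  have I\<mu>: "integrable \<mu> F \<longleftrightarrow> integrable M (\<lambda>s. F (X s))" if "F \<in> borel_measurable borel" for F :: "_ \<Rightarrow> real"
    unfolding \<mu>_def by (rule integrable_distr_eq[OF X_meas that])
  have prob\<mu>: "prob_space \<mu>" unfolding \<mu>_def by (rule M.prob_space_distr) simp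
  interpret \<mu>: prob_space \<mu> by (rule prob\<mu>)
  interpret \<mu>2: pair_sigma_finite \<mu> \<mu> ..
  let ?ZW = "\<lambda>s. (Z s, W s)"
  have ZW_meas[measurable]: "?ZW \<in> borel_measurable M" by measurable
  have fZ_meas[measurable]: "fZ \<in> borel_measurable borel"
    using distributed_real_measurable[OF Db_i_nonneg Db_i_density] by simp
  have J: "J \<subseteq> {1..}" using basis_index by auto
  note N = sqnorm_A_properties[OF J basis Db_iii_pos Db_iii_sum]
  obtain \<beta> where \<beta>: "\<And>x. Kt x \<le> \<beta>" using bounded_variation_bounded[OF Ka_bv] by blast
  have \<omega>U_meas[measurable]: "(\<lambda>s. \<omega> (Z s) *\<^sub>R U s) \<in> borel_measurable M" by measurable
  have uX: "u (X s) = \<omega> (Z s) *\<^sub>R U s" "\<zeta> (X s) = Z s" "w (X s) = W s" for s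
    by (auto simp: u_def \<zeta>_def w_def X_def)
  have u4: "integrable \<mu> (\<lambda>x. norm (u x) ^ 4)"
    by (subst I\<mu>) (use Da in \<open>auto simp: uX\<close>)
  have u2: "integrable \<mu> (\<lambda>x. (norm (u x))\<^sup>2)"
    using \<mu>.square_integrable_imp_integrable[of "\<lambda>x. (norm (u x))\<^sup>2"] u4 by (simp flip: power_mult)
  have u1: "integrable \<mu> u"
  proof -
    have "integrable \<mu> (\<lambda>x. norm (u x))"
      using \<mu>.square_integrable_imp_integrable[of "\<lambda>x. norm (u x)"] u2 by simp
    then show ?thesis by (subst (asm) integrable_norm_iff) auto
  qed
  have \<omega>U_int: "integrable M (\<lambda>s. \<omega> (Z s) *\<^sub>R U s)"
    using u1 unfolding \<mu>_def by (subst (asm) integrable_distr_eq) (auto simp: uX)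
  have fZ_int: "integrable lborel fZ" and fZ_one: "(LINT z|lborel. fZ z) = 1"
  proof -
    have d: "distr M lborel Z = density lborel (\<lambda>z. ennreal (fZ z))"
      by (rule distributed_distr_eq_density[OF Db_i_density])
    interpret D: prob_space "distr M lborel Z" by (rule M.prob_space_distr) simp
    have "(\<integral>\<^sup>+z. ennreal (fZ z) \<partial>lborel) = emeasure (density lborel (\<lambda>z. ennreal (fZ z))) (space lborel)"
      by (subst emeasure_density) auto
    also have "\<dots> = 1" using D.emeasure_space_1 unfolding d by simp
    finally have e: "(\<integral>\<^sup>+z. ennreal (fZ z) \<partial>lborel) = 1" .
    then show "integrable lborel fZ" using Db_i_nonneg by (intro integrableI_nonneg) auto
    show "(LINT z|lborel. fZ z) = 1"
      using e Db_i_nonneg by (subst integral_eq_nn_integral) auto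
  qed
  have K_eq: "positive_fourier_density Kt"
    by unfold_locales (use Ka_sym Ka_density Ka_fourier_pos Ka_fourier_int in auto)
  have lk: "localized_kernel \<mu> Kt fZ u \<zeta> w (sqnorm_A J a \<phi>) \<beta> \<sigma>2 (1 + C) (infsum a J)"
  proof (intro localized_kernel.intro smoothed_density.intro smoothed_density_axioms.intro localized_kernel_axioms.intro prob\<mu> K_eq)
    show "u \<in> borel_measurable \<mu>" "\<zeta> \<in> borel_measurable \<mu>" "w \<in> borel_measurable \<mu>" by measurable
    show "distributed \<mu> lborel \<zeta> (\<lambda>z. ennreal (fZ z))"
    proof -
      have "distr \<mu> lborel \<zeta> = distr M lborel Z"
        unfolding \<mu>_def by (subst distr_distr) (auto simp: comp_def uX)
      then show ?thesis using Db_i_density unfolding distributed_def by auto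
    qed
  next
    fix g :: "real^'q \<Rightarrow> real" and B assume g[measurable]: "g \<in> borel_measurable borel" and gb: "\<And>z. 0 \<le> g z" "\<And>z. g z \<le> B"
    \<comment> \<open>The hypothesis conditions on (Z, W), so a test function of Z alone is read as
      a function of the pair.\<close>
    have "M.expectation (\<lambda>s. (norm (\<omega> (Z s) *\<^sub>R U s))\<^sup>2 * (g \<circ> fst) (?ZW s)) \<le> (1 + C) * M.expectation (\<lambda>s. (g \<circ> fst) (?ZW s))"
    proof (rule M.weighted_second_moment_le[OF ZW_meas \<omega>U_meas Dc_ii Dc_const(3,2), where B = B])
      show "(g \<circ> fst :: (real^'q) \<times> 'b \<Rightarrow> real) \<in> borel_measurable borel" by (rule measurable_comp[OF fst_meas g])
    qed (auto simp: gb)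
    then show "(\<integral>x. (norm (u x))\<^sup>2 * g (\<zeta> x) \<partial>\<mu>) \<le> (1 + C) * (\<integral>x. g (\<zeta> x) \<partial>\<mu>)"
      by (simp add: E\<mu> uX)
  next
    fix \<xi> :: "(real^'q) \<times> 'b \<Rightarrow> real" and B c assume \<xi>[measurable]: "\<xi> \<in> borel_measurable borel" and \<xi>b: "\<And>p. \<bar>\<xi> p\<bar> \<le> B"
    have "M.expectation (\<lambda>s. (c \<bullet> ((\<omega> \<circ> fst) (?ZW s) *\<^sub>R U s)) * \<xi> (?ZW s)) = 0"
    proof (rule M.weighted_cond_exp_zero[OF U_meas ZW_meas null_hyp, where B = B])
      show "(\<omega> \<circ> fst :: (real^'q) \<times> 'b \<Rightarrow> real) \<in> borel_measurable borel" by (rule measurable_comp[OF fst_meas omega_meas])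
    qed (use omega_pos \<omega>U_int \<xi> \<xi>b in auto)
    then show "(\<integral>x. (c \<bullet> u x) * \<xi> (\<zeta> x, w x) \<partial>\<mu>) = 0"
      by (subst E\<mu>) (auto simp: uX)
  next
    fix \<Phi> :: "((real^'q) \<times> 'b) \<times> ((real^'q) \<times> 'b) \<Rightarrow> real" and B
    assume \<Phi>[measurable]: "\<Phi> \<in> borel_measurable borel" and \<Phi>b: "\<And>r. 0 \<le> \<Phi> r" "\<And>r. \<Phi> r \<le> B"
    let ?V = "\<lambda>x. (\<zeta> x, w x)"
    have [measurable]: "Xs 1 \<in> borel_measurable M" "Xs 2 \<in> borel_measurable M" by (rule Xs_meas, simp)+
    \<comment> \<open>The nondegeneracy hypothesis concerns the first two observations; their joint
      law translates it into an iterated integral over \<mu>.\<close>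
    have pd: "distr M (borel \<Otimes>\<^sub>M borel) (\<lambda>s. (Xs 1 s, Xs 2 s)) = \<mu> \<Otimes>\<^sub>M \<mu>"
      using M.indep_vars_pair_distr[OF ind, of 1 2] by (simp add: Xs_distr)
    have E2: "(\<integral>x. (\<integral>y. F x y \<partial>\<mu>) \<partial>\<mu>) = M.expectation (\<lambda>s. F (Xs 1 s) (Xs 2 s))"
        "integrable M (\<lambda>s. F (Xs 1 s) (Xs 2 s))"
      if i: "integrable (\<mu> \<Otimes>\<^sub>M \<mu>) (\<lambda>(x, y). F x y)" for F :: "_ \<Rightarrow> _ \<Rightarrow> real"
    proof -
      have m: "(\<lambda>(x, y). F x y) \<in> borel_measurable (borel \<Otimes>\<^sub>M borel)"
        using i by (simp add: measurable_cong_sets[OF sets_pair_measure_cong[OF \<mu>_sets \<mu>_sets] refl])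
      have p: "(\<lambda>s. (Xs 1 s, Xs 2 s)) \<in> measurable M (borel \<Otimes>\<^sub>M borel)" by measurable
      have "(\<integral>x. (\<integral>y. F x y \<partial>\<mu>) \<partial>\<mu>) = (\<integral>z. (case z of (x, y) \<Rightarrow> F x y) \<partial>(\<mu> \<Otimes>\<^sub>M \<mu>))"
        using \<mu>2.integral_fst'[OF i] by simp
      also have "\<dots> = M.expectation (\<lambda>s. F (Xs 1 s) (Xs 2 s))"
        unfolding pd[symmetric] using integral_distr[OF p m] by simp
      finally show "(\<integral>x. (\<integral>y. F x y \<partial>\<mu>) \<partial>\<mu>) = M.expectation (\<lambda>s. F (Xs 1 s) (Xs 2 s))" .
      show "integrable M (\<lambda>s. F (Xs 1 s) (Xs 2 s))"
        using i unfolding pd[symmetric] integrable_distr_eq[OF p m] by simp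
    qed
    have uu: "integrable (\<mu> \<Otimes>\<^sub>M \<mu>) (\<lambda>(x, y). B * ((norm (u x))\<^sup>2 * (norm (u y))\<^sup>2))"
      by (rule \<mu>2.Fubini_integrable) (use u2 in \<open>auto simp: abs_mult\<close>)
    have \<Phi>m: "(\<lambda>(x, y). \<Phi> (?V x, ?V y)) \<in> borel_measurable (\<mu> \<Otimes>\<^sub>M \<mu>)" by measurable
    have i1: "integrable (\<mu> \<Otimes>\<^sub>M \<mu>) (\<lambda>(x, y). \<Phi> (?V x, ?V y))"
    proof -
      interpret PP: prob_space "\<mu> \<Otimes>\<^sub>M \<mu>" by (rule prob_space_pair) (rule prob\<mu>)+
      show ?thesis by (rule PP.integrable_const_bound[of _ B]) (use \<Phi>b \<Phi>m in auto)
    qed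
    have i2: "integrable (\<mu> \<Otimes>\<^sub>M \<mu>) (\<lambda>(x, y). (u x \<bullet> u y)\<^sup>2 * \<Phi> (?V x, ?V y))"
    proof (rule Bochner_Integration.integrable_bound[OF uu])
      show "(\<lambda>(x, y). (u x \<bullet> u y)\<^sup>2 * \<Phi> (?V x, ?V y)) \<in> borel_measurable (\<mu> \<Otimes>\<^sub>M \<mu>)" by measurable
      have "\<bar>(u x \<bullet> u y)\<^sup>2 * \<Phi> (?V x, ?V y)\<bar> \<le> \<bar>B * ((norm (u x))\<^sup>2 * (norm (u y))\<^sup>2)\<bar>" for x y
      proof -
        have "(u x \<bullet> u y)\<^sup>2 \<le> (norm (u x))\<^sup>2 * (norm (u y))\<^sup>2"
          using power_mono[OF Cauchy_Schwarz_ineq2[of "u x" "u y"], of 2] by (simp add: power_mult_distrib)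
        then have "(u x \<bullet> u y)\<^sup>2 * \<Phi> (?V x, ?V y) \<le> ((norm (u x))\<^sup>2 * (norm (u y))\<^sup>2) * B"
          using \<Phi>b by (intro mult_mono) auto
        then show ?thesis using \<Phi>b(1) by (simp add: abs_mult mult_ac order_trans[OF _ mult_right_mono[OF abs_ge_self]])
      qed
      then show "AE p in \<mu> \<Otimes>\<^sub>M \<mu>. norm (case p of (x, y) \<Rightarrow> (u x \<bullet> u y)\<^sup>2 * \<Phi> (?V x, ?V y))
        \<le> norm (case p of (x, y) \<Rightarrow> B * ((norm (u x))\<^sup>2 * (norm (u y))\<^sup>2))"
        by (auto split: prod.split)
    qed
    let ?X2 = "\<lambda>s. ((Zs 1 s, Ws 1 s), (Zs 2 s, Ws 2 s))"
    have X2: "?X2 s = (?V (Xs 1 s), ?V (Xs 2 s))" for s by (simp add: \<zeta>_def w_def Xs_def)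
    let ?Y = "\<lambda>s. (\<omega> (Zs 1 s) *\<^sub>R Us 1 s) \<bullet> (\<omega> (Zs 2 s) *\<^sub>R Us 2 s)"
    have Y: "?Y s = u (Xs 1 s) \<bullet> u (Xs 2 s)" for s by (simp add: u_def Xs_def)
    have "\<sigma>2 * M.expectation (\<lambda>s. \<Phi> (?X2 s)) \<le> M.expectation (\<lambda>s. (?Y s)\<^sup>2 * \<Phi> (?X2 s))"
    proof (rule M.weighted_square_ge[OF _ _ Dc_i, where B = B])
      show "?X2 \<in> borel_measurable M" unfolding X2 by measurable
      show "?Y \<in> borel_measurable M" unfolding Y by measurable
      show "integrable M (\<lambda>s. (?Y s)\<^sup>2 * \<Phi> (?X2 s))" using E2(2)[OF i2] unfolding X2 Y .
    qed (use \<Phi> \<Phi>b Dc_const in auto)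
    then show "\<sigma>2 * (\<integral>x. (\<integral>y. \<Phi> (?V x, ?V y) \<partial>\<mu>) \<partial>\<mu>) \<le> (\<integral>x. (\<integral>y. (u x \<bullet> u y)\<^sup>2 * \<Phi> (?V x, ?V y) \<partial>\<mu>) \<partial>\<mu>)"
      unfolding E2(1)[OF i1] E2(1)[OF i2] X2 Y .
  qed (use N \<beta> u4 Db_i_nonneg fZ_int fZ_one Dc_const in auto)
  interpret LK: localized_kernel \<mu> Kt fZ u \<zeta> w "sqnorm_A J a \<phi>" \<beta> \<sigma>2 "1 + C" "infsum a J" by (rule lk)
  have pw: "pair_weight K (sqnorm_A J a \<phi>) \<omega> r (\<lambda>i. Us i s) (\<lambda>i. Zs i s) (\<lambda>i. Ws i s) i j = LK.H r (Xs i s) (Xs j s)" for r i j s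
    unfolding pair_weight_def LK.H_def LK.L_def LK.\<Psi>_def LK.kE_def Ka_prod prod_Basis_vec
    by (simp add: u_def \<zeta>_def w_def Xs_def)
  have conv: "weak_conv_m (\<lambda>n. distr M borel (T n)) std_normal_distribution"
  proof (rule LK.self_normalized_clt[where h = h and Xs = Xs])
    show "filterlim (\<lambda>n. real n * h n ^ DIM(real^'q)) at_top sequentially"
    proof (rule filterlim_at_top_mono[OF Kb_nh])
      show "\<forall>\<^sub>F n in sequentially. real n * h n ^ CARD('q) / ln (real n) \<le> real n * h n ^ DIM(real^'q)"
        using eventually_ge_at_top[of 3]
      proof eventually_elim
        case (elim n)
        \<comment> \<open>From n = 3 on, n exceeds e and ln n is at least 1, so n h^q dominates its
          quotient by ln n.\<close>
        have "exp 1 \<le> real n" using e_less_272 elim by simp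
        then have l: "1 \<le> ln (real n)" using elim by (subst ln_ge_iff) auto
        have "real n * h n ^ CARD('q) / ln (real n) \<le> real n * h n ^ CARD('q) / 1"
          using l h_pos[of n] by (intro divide_left_mono) auto
        then show ?case by simp
      qed
    qed
  next
    fix n :: nat
    have sub: "M.indep_vars (\<lambda>_. borel) Xs {1..n}" by (rule M.indep_vars_subset[OF ind]) auto
    have sP: "sets (PiM {1..n} (\<lambda>_. \<mu>)) = sets (PiM {1..n} (\<lambda>_. borel))"
      by (intro sets_PiM_cong refl \<mu>_sets)
    have m: "(\<lambda>s. \<lambda>i\<in>{1..n}. Xs i s) \<in> measurable M (PiM {1..n} (\<lambda>_. borel))"
      by (intro measurable_restrict Xs_meas) auto
    then show "(\<lambda>s. \<lambda>i\<in>{1..n}. Xs i s) \<in> measurable M (PiM {1..n} (\<lambda>_. \<mu>))"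
      by (simp only: measurable_cong_sets[OF refl sP])
    assume n: "1 \<le> n"
    have "distr M (PiM {1..n} (\<lambda>_. borel)) (\<lambda>s. \<lambda>i\<in>{1..n}. Xs i s) = PiM {1..n} (\<lambda>i. distr M borel (Xs i))"
      using M.indep_vars_iff_distr_eq_PiM'[where I = "{1..n}" and X = Xs and M' = "\<lambda>_. borel"] sub n Xs_meas by auto
    also have "\<dots> = PiM {1..n} (\<lambda>_. \<mu>)" by (intro PiM_cong) (auto simp: Xs_distr)
    finally show "distr M (PiM {1..n} (\<lambda>_. \<mu>)) (\<lambda>s. \<lambda>i\<in>{1..n}. Xs i s) = PiM {1..n} (\<lambda>_. \<mu>)"
      using distr_cong[OF refl sP, of M "\<lambda>s. \<lambda>i\<in>{1..n}. Xs i s"] by simp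
  next
    fix n s assume s: "s \<in> space M"
    let ?S = "\<Sum>i\<in>{1..n}. \<Sum>j\<in>{1..n} - {i}. LK.H (h n) (Xs i s) (Xs j s)"
    let ?q = "\<Sum>i\<in>{1..n}. \<Sum>j\<in>{1..n} - {i}. (LK.H (h n) (Xs i s) (Xs j s))\<^sup>2"
    assume q: "0 < ?q"
    have n: "2 \<le> n"
    proof (rule ccontr)
      assume "\<not> 2 \<le> n"
      then consider "n = 0" | "n = 1" by linarith
      then show False using q by cases auto
    qed
    \<comment> \<open>The common normalizing factor of \<open>I_stat\<close> and
      \<open>v_stat\<close>, which cancels in the ratio.\<close>
    define d where "d = real n * (real n - 1) * h n ^ CARD('q)"
    have d: "0 < d" unfolding d_def using n h_pos[of n] by simp
    have v: "v_stat K (sqnorm_A J a \<phi>) \<omega> n (h n) (\<lambda>i. Us i s) (\<lambda>i. Zs i s) (\<lambda>i. Ws i s) = sqrt (2 * ?q) / d"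
    proof -
      have "(real n)\<^sup>2 * (real n - 1)\<^sup>2 * h n ^ (2 * CARD('q)) = d\<^sup>2"
        unfolding d_def by (simp add: power_mult_distrib power_mult[symmetric] mult.commute)
      then show ?thesis unfolding v_stat_def pw using d by (simp add: real_sqrt_divide)
    qed
    have I: "I_stat K (sqnorm_A J a \<phi>) \<omega> n (h n) (\<lambda>i. Us i s) (\<lambda>i. Zs i s) (\<lambda>i. Ws i s) = ?S / d"
      unfolding I_stat_def pw d_def by simp
    have "sqrt (2 * ?q) / d \<noteq> 0" using q d by simp
    then have "T n s = (?S / d) / (sqrt (2 * ?q) / d)" using T_def[OF s, of n] unfolding v I by simp
    then show "T n s = ?S / sqrt (2 * ?q)" using d by simp
  qed (use h_pos Kb_h Db_i T_meas assms(1) in auto)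
  then show ?thesis using M.level_of_weak_conv[where T = T, OF T_meas conv] by auto
qed

end
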